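(* For every fixed $k,m\in\mathbb N$ the following problem is decidable: given finite alphabets $A,B$ and a timed automaton with $\varepsilon$-transitions recognising (with Büchi acceptance) a timed $\omega$-language $W\subseteq (A\times B\times\mathbb R_{\ge0})^\omega$ over the alphabet $A\times B$, decide whether Player II has a winning $k,m$-controller in the timed synthesis game $G(A,B,W)$.
   Context: Timed words and clock constraints: a timed word over $\Sigma$ is a sequence $(a_1,t_1)(a_2,t_2)\cdots$, $a_i\in\Sigma$, $0\le t_1\le t_2\le\cdots$ reals; clock constraints over clocks $X$ are Boolean combinations of $x\sim z$, $x-y\sim z$ ($z\in\mathbb Z$, $\sim\in\{<,\le,=,\ge,>\}$). A timed automaton with $\varepsilon$-transitions $(\Sigma,L,X,I,F,\Delta)$ has rules $(p,a,\varphi,Y,q)$, $a\in\Sigma\cup\{\varepsilon\}$, taken after a time elapse when the current valuation satisfies $\varphi$, resetting $Y$ to $0$; runs start in $I$ with all clocks $0$. Its timed $\omega$-language consists of the infinite timed words over $\Sigma$ obtained, by deleting $\varepsilon$-letters, from infinite accepted words (runs visiting $F$ infinitely often), keeping only infinite results. For a set of clocks $X$ and $m\in\mathbb N$, two valuations are $(X,m)$-region equivalent if they satisfy the same clock constraints over $X$ with constants of absolute value at most $m$; the equivalence classes (finitely many) are regions. Timed synthesis game $G(A,B,W)$: in rounds $i=1,2,\dots$ Player I chooses $a_i\in A$ and $t_i\in\mathbb R_{\ge0}$ with $t_i\ge t_{i-1}$ ($t_0=0$), then Player II chooses $b_i\in B$; Player I wins iff the play $(a_1,b_1,t_1)(a_2,b_2,t_2)\cdots\in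 W$. A $k,m$-controller for Player II is $(A,B,L,\ell_0,\delta)$ with finite memory set $L$, $\ell_0\in L$, a set $X$ of $k$ clocks, and $\delta: L\times A\times\mathrm{Regions}(X,m)\to L\times B\times 2^X$. It plays as follows: starting from $\ell_0$ and the all-zero valuation $\mu_0$, on Player I's move $(a_{n+1},t_{n+1})$ with current $(\ell_n,\mu_n)$, let $\nu=\mu_n+(t_{n+1}-t_n)$ and $\delta(\ell_n,a_{n+1},[\nu])=(\ell',b,Y)$; it answers $b_{n+1}=b$ and updates to $\ell_{n+1}=\ell'$, $\mu_{n+1}=\nu$ with clocks in $Y$ reset to $0$. It is winning if no infinite play consistent with it belongs to $W$. *)

theory Defs
  imports Complex_Main "HOL-Library.Nat_Bijection"
begin

datatype recf = Z | S | Id nat | Cn recf "recf list" | Pr recf recf | Mn recf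

inductive eval :: "recf \<Rightarrow> nat list \<Rightarrow> nat \<Rightarrow> bool" where
  eval_Z: "eval Z xs 0"
| eval_S: "eval S [x] (Suc x)"
| eval_Id: "i < length xs \<Longrightarrow> eval (Id i) xs (xs ! i)"
| eval_Cn: "length ys = length gs \<Longrightarrow> (\<forall>i<length gs. eval (gs ! i) xs (ys ! i))
             \<Longrightarrow> eval f ys z \<Longrightarrow> eval (Cn f gs) xs z"
| eval_Pr0: "eval f xs y \<Longrightarrow> eval (Pr f g) (0 # xs) y"
| eval_PrS: "eval (Pr f g) (n # xs) y \<Longrightarrow> eval g (n # y # xs) z
             \<Longrightarrow> eval (Pr f g) (Suc n # xs) z"
| eval_Mn: "eval f (n # xs) 0 \<Longrightarrow> (\<forall>i<n. \<exists>y. eval f (i # xs) y \<and> y > 0)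
             \<Longrightarrow> eval (Mn f) xs n"

definition decidable_set :: "nat set \<Rightarrow> bool" where
  "decidable_set P \<longleftrightarrow> (\<exists>f. \<forall>n. eval f [n] (if n \<in> P then 1 else 0))"

type_synonym clock = nat
type_synonym valuation = "clock \<Rightarrow> real"

datatype cmp = CLt | CLe | CEq | CGe | CGt

datatype cc =
    CTrue
  | CAtom clock cmp int
  | CDiff clock clock cmp int
  | CNot cc
  | CAnd cc cc
  | COr cc cc

fun cmp_sem :: "cmp \<Rightarrow> real \<Rightarrow> real \<Rightarrow> bool" where
  "cmp_sem CLt a b = (a < b)"
| "cmp_sem CLe a b = (a \<le> b)"
| "cmp_sem CEq a b = (a = b)"
| "cmp_sem CGe a b = (a \<ge> b)"
| "cmp_sem CGt a b = (a > b)"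

fun sat :: "cc \<Rightarrow> valuation \<Rightarrow> bool" where
  "sat CTrue v = True"
| "sat (CAtom x c z) v = cmp_sem c (v x) (of_int z)"
| "sat (CDiff x y c z) v = cmp_sem c (v x - v y) (of_int z)"
| "sat (CNot \<phi>) v = (\<not> sat \<phi> v)"
| "sat (CAnd \<phi> \<psi>) v = (sat \<phi> v \<and> sat \<psi> v)"
| "sat (COr \<phi> \<psi>) v = (sat \<phi> v \<or> sat \<psi> v)"

fun cc_over :: "clock set \<Rightarrow> nat \<Rightarrow> cc \<Rightarrow> bool" where
  "cc_over X m CTrue = True"
| "cc_over X m (CAtom x c z) = (x \<in> X \<and> \<bar>z\<bar> \<le> int m)"
| "cc_over X m (CDiff x y c z) = (x \<in> X \<and> y \<in> X \<and> \<bar>z\<bar> \<le> int m)"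
| "cc_over X m (CNot \<phi>) = cc_over X m \<phi>"
| "cc_over X m (CAnd \<phi> \<psi>) = (cc_over X m \<phi> \<and> cc_over X m \<psi>)"
| "cc_over X m (COr \<phi> \<psi>) = (cc_over X m \<phi> \<and> cc_over X m \<psi>)"

definition region_equiv :: "clock set \<Rightarrow> nat \<Rightarrow> valuation \<Rightarrow> valuation \<Rightarrow> bool" where
  "region_equiv X m \<nu> \<mu> \<longleftrightarrow> (\<forall>\<phi>. cc_over X m \<phi> \<longrightarrow> (sat \<phi> \<nu> \<longleftrightarrow> sat \<phi> \<mu>))"

definition region_of :: "clock set \<Rightarrow> nat \<Rightarrow> valuation \<Rightarrow> valuation set" where
  "region_of X m \<nu> = {\<mu>. region_equiv X m \<nu> \<mu>}"

definition regions :: "clock set \<Rightarrow> nat \<Rightarrow> valuation set set" where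
  "regions X m = range (region_of X m)"

definition delay :: "valuation \<Rightarrow> real \<Rightarrow> valuation" where
  "delay v d = (\<lambda>x. v x + d)"

definition reset :: "clock set \<Rightarrow> valuation \<Rightarrow> valuation" where
  "reset Y v = (\<lambda>x. if x \<in> Y then 0 else v x)"

definition timed_word :: "(nat \<Rightarrow> 's \<times> real) \<Rightarrow> bool" where
  "timed_word w \<longleftrightarrow> 0 \<le> snd (w 0) \<and> (\<forall>i. snd (w i) \<le> snd (w (Suc i)))"

definition prev_time :: "(nat \<Rightarrow> 's \<times> real) \<Rightarrow> nat \<Rightarrow> real" where
  "prev_time w n = (if n = 0 then 0 else snd (w (n - 1)))"

text \<open>Letters: pairs (a,b) of naturals (alphabet A \<times> B); None is epsilon.
  A rule is (p, letter, guard, resets, q).\<close>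
type_synonym letter = "nat \<times> nat"
type_synonym rule = "nat \<times> letter option \<times> cc \<times> clock list \<times> nat"

record ta =
  ta_clocks :: nat            \<comment> \<open>the clock set is {0..<ta_clocks}\<close>
  ta_init   :: "nat list"
  ta_final  :: "nat list"
  ta_rules  :: "rule list"

definition accepting_run ::
  "ta \<Rightarrow> (nat \<Rightarrow> letter option \<times> real) \<Rightarrow> (nat \<Rightarrow> nat) \<Rightarrow> (nat \<Rightarrow> valuation) \<Rightarrow> bool" where
  "accepting_run T w ls vs \<longleftrightarrow>
     ls 0 \<in> set (ta_init T) \<and> vs 0 = (\<lambda>_. 0) \<and>
     (\<forall>i. \<exists>\<phi> Y. (ls i, fst (w i), \<phi>, Y, ls (Suc i)) \<in> set (ta_rules T) \<and>
                 set Y \<subseteq> {0..<ta_clocks T} \<and>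
                 sat \<phi> (delay (vs i) (snd (w i) - prev_time w i)) \<and>
                 vs (Suc i) = reset (set Y) (delay (vs i) (snd (w i) - prev_time w i))) \<and>
     infinite {i. ls i \<in> set (ta_final T)}"

definition erase :: "(nat \<Rightarrow> 's option \<times> real) \<Rightarrow> (nat \<Rightarrow> 's \<times> real) \<Rightarrow> bool" where
  "erase w w' \<longleftrightarrow> (\<exists>h. strict_mono h \<and> range h = {i. fst (w i) \<noteq> None} \<and>
                       (\<forall>j. w' j = (the (fst (w (h j))), snd (w (h j)))))"

definition timed_lang :: "ta \<Rightarrow> (nat \<Rightarrow> letter \<times> real) set" where
  "timed_lang T = {w'. \<exists>w ls vs. timed_word w \<and> accepting_run T w ls vs \<and> erase w w'}"

text \<open>Instance: (number of letters of A, number of letters of B, automaton);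
  A = {0..<na}, B = {0..<nb}.\<close>
type_synonym problem_inst = "nat \<times> nat \<times> ta"

definition is_controller ::
  "nat \<Rightarrow> nat \<Rightarrow> nat set \<Rightarrow> nat set \<Rightarrow> nat set \<Rightarrow> nat \<Rightarrow>
   (nat \<Rightarrow> nat \<Rightarrow> valuation set \<Rightarrow> nat \<times> nat \<times> clock set) \<Rightarrow> bool" where
  "is_controller k m A B L l0 \<delta> \<longleftrightarrow> finite L \<and> l0 \<in> L \<and>
     (\<forall>l\<in>L. \<forall>a\<in>A. \<forall>r\<in>regions {0..<k} m. \<delta> l a r \<in> L \<times> B \<times> Pow {0..<k})"

definition consistent_play ::
  "nat \<Rightarrow> nat \<Rightarrow> nat set \<Rightarrow> nat \<Rightarrow> (nat \<Rightarrow> nat \<Rightarrow> valuation set \<Rightarrow> nat \<times> nat \<times> clock set)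
   \<Rightarrow> (nat \<Rightarrow> letter \<times> real) \<Rightarrow> bool" where
  "consistent_play k m A l0 \<delta> w \<longleftrightarrow> timed_word w \<and> (\<forall>n. fst (fst (w n)) \<in> A) \<and>
     (\<exists>ls \<mu>s. ls 0 = l0 \<and> \<mu>s 0 = (\<lambda>_. 0) \<and>
        (\<forall>n. let \<nu> = delay (\<mu>s n) (snd (w n) - prev_time w n);
                 (l', b, Y) = \<delta> (ls n) (fst (fst (w n))) (region_of {0..<k} m \<nu>)
             in ls (Suc n) = l' \<and> snd (fst (w n)) = b \<and> \<mu>s (Suc n) = reset Y \<nu>))"

definition winning_controller ::
  "nat \<Rightarrow> nat \<Rightarrow> problem_inst \<Rightarrow> nat set \<Rightarrow> nat \<Rightarrow>
   (nat \<Rightarrow> nat \<Rightarrow> valuation set \<Rightarrow> nat \<times> nat \<times> clock set) \<Rightarrow> bool" where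
  "winning_controller k m I L l0 \<delta> \<longleftrightarrow>
     (case I of (na, nb, T) \<Rightarrow>
        is_controller k m {0..<na} {0..<nb} L l0 \<delta> \<and>
        (\<forall>w. consistent_play k m {0..<na} l0 \<delta> w \<longrightarrow> w \<notin> timed_lang T))"

definition has_winning_controller :: "nat \<Rightarrow> nat \<Rightarrow> problem_inst \<Rightarrow> bool" where
  "has_winning_controller k m I \<longleftrightarrow> (\<exists>L l0 \<delta>. winning_controller k m I L l0 \<delta>)"

fun enc_cmp :: "cmp \<Rightarrow> nat" where
  "enc_cmp CLt = 0" | "enc_cmp CLe = 1" | "enc_cmp CEq = 2" | "enc_cmp CGe = 3" | "enc_cmp CGt = 4"

fun enc_cc :: "cc \<Rightarrow> nat" where
  "enc_cc CTrue = list_encode [0]"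
| "enc_cc (CAtom x c z) = list_encode [1, x, enc_cmp c, int_encode z]"
| "enc_cc (CDiff x y c z) = list_encode [2, x, y, enc_cmp c, int_encode z]"
| "enc_cc (CNot \<phi>) = list_encode [3, enc_cc \<phi>]"
| "enc_cc (CAnd \<phi> \<psi>) = list_encode [4, enc_cc \<phi>, enc_cc \<psi>]"
| "enc_cc (COr \<phi> \<psi>) = list_encode [5, enc_cc \<phi>, enc_cc \<psi>]"

fun enc_letter :: "letter option \<Rightarrow> nat" where
  "enc_letter None = 0"
| "enc_letter (Some (a, b)) = Suc (prod_encode (a, b))"

fun enc_rule :: "rule \<Rightarrow> nat" where
  "enc_rule (p, \<sigma>, \<phi>, Y, q) = list_encode [p, enc_letter \<sigma>, enc_cc \<phi>, list_encode Y, q]"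

fun enc_instance :: "problem_inst \<Rightarrow> nat" where
  "enc_instance (na, nb, T) = list_encode [na, nb, ta_clocks T, list_encode (ta_init T),
      list_encode (ta_final T), list_encode (map enc_rule (ta_rules T))]"

end

theory Submission
  imports Defs "HOL-Library.AList" "HOL-Library.Extended_Nat" "HOL-Library.Infinite_Set"
    "HOL-Library.List_Lenlexorder" "HOL-Library.More_List"
begin

text \<open>
  Region equivalence on the clocks of the automaton together with those of the controller is a
  time-abstract bisimulation with finitely many classes, and each class contains a point of a
  rational grid. This turns the timed game into a game on a finite graph whose vertices carry grid
  points; Player II wins a play iff no path through the vertices compatible with it meets infinitely
  many flags (final locations). A finite-memory strategy of Player II wins iff the vertices can be
  given finite budgets that never grow and shrink at each flag.

  It remains to bound the memory. A weak form of Safra's determinisation tracks lists of sets of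
  vertices ordered by age, such that any path with infinitely many flags makes some eventually
  permanent position of the list flash infinitely often. If a finite-memory strategy wins, its
  budgets assign a weight to each position; playing at each tracking state as the given strategy does
  in the memory state with lexicographically least weights is again winning, since otherwise these
  weights would decrease forever. So a winning strategy exists iff there is a family of budgets of
  computably bounded size, and this is decided by bounded search.
\<close>

section \<open>Computable functions on codes\<close>

definition computable :: "(nat \<Rightarrow> nat) \<Rightarrow> bool" where
  "computable f \<longleftrightarrow> (\<exists>r. \<forall>n. eval r [n] (f n))"

abbreviation fst_decode :: "nat \<Rightarrow> nat" where "fst_decode p \<equiv> fst (prod_decode p)"
abbreviation snd_decode :: "nat \<Rightarrow> nat" where "snd_decode p \<equiv> snd (prod_decode p)"

subsection \<open>Recursive functions for arithmetic and pairing\<close>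

lemma eval_Id_nth: "i < length xs \<Longrightarrow> xs ! i = y \<Longrightarrow> eval (Id i) xs y"
  using eval_Id by blast

lemma eval_Cn_unary: "eval g xs y \<Longrightarrow> eval f [y] z \<Longrightarrow> eval (Cn f [g]) xs z"
  by (rule eval_Cn[of "[y]"]) auto

lemma eval_Cn_binary:
  "eval g\<^sub>1 xs y\<^sub>1 \<Longrightarrow> eval g\<^sub>2 xs y\<^sub>2 \<Longrightarrow> eval f [y\<^sub>1, y\<^sub>2] z \<Longrightarrow> eval (Cn f [g\<^sub>1, g\<^sub>2]) xs z"
  by (rule eval_Cn[of "[y\<^sub>1, y\<^sub>2]"]) (auto simp: less_Suc_eq)

definition recf_add :: recf where "recf_add = Pr (Id 0) (Cn S [Id 1])"
definition recf_pred :: recf where "recf_pred = Pr Z (Id 0)"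
definition recf_diff :: recf where "recf_diff = Cn (Pr (Id 0) (Cn recf_pred [Id 1])) [Id 1, Id 0]"
definition recf_mult :: recf where "recf_mult = Pr Z (Cn recf_add [Id 1, Id 2])"
definition recf_triangle :: recf where "recf_triangle = Pr Z (Cn recf_add [Id 1, Cn S [Id 0]])"
definition recf_pair :: recf where "recf_pair = Cn recf_add [Cn recf_triangle [recf_add], Id 0]"

lemma eval_add: "eval recf_add [x, y] (x + y)"
  unfolding recf_add_def
  by (induction x) (auto intro!: eval_Pr0 eval_PrS eval_Cn_unary eval_Id_nth eval_S)

lemma eval_pred: "eval recf_pred [x] (x - 1)"
  unfolding recf_pred_def by (induction x) (auto intro!: eval_Pr0 eval_PrS eval_Z eval_Id_nth)

lemma eval_diff: "eval recf_diff [x, y] (x - y)"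
proof -
  have "eval (Pr (Id 0) (Cn recf_pred [Id 1])) [y, x] (x - y)"
  proof (induction y)
    case (Suc y)
    have "eval (Cn recf_pred [Id 1]) [y, x - y, x] (x - y - 1)"
      by (rule eval_Cn_unary[OF eval_Id_nth eval_pred]) auto
    with Suc show ?case by (auto intro!: eval_PrS)
  qed (auto intro!: eval_Pr0 eval_Id_nth)
  then show ?thesis unfolding recf_diff_def by (auto intro!: eval_Cn_binary eval_Id_nth)
qed

lemma eval_mult: "eval recf_mult [x, y] (x * y)"
proof (induction x)
  case (Suc x)
  have "eval (Cn recf_add [Id 1, Id 2]) [x, x * y, y] (x * y + y)"
    by (rule eval_Cn_binary[OF eval_Id_nth eval_Id_nth]) (auto intro: eval_add)
  with Suc show ?case unfolding recf_mult_def by (auto intro!: eval_PrS simp: add.commute)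
qed (auto intro!: eval_Pr0 eval_Z simp: recf_mult_def)

lemma eval_triangle: "eval recf_triangle [x] (triangle x)"
proof (induction x)
  case (Suc x)
  have "eval (Cn recf_add [Id 1, Cn S [Id 0]]) [x, triangle x] (triangle x + Suc x)"
    by (rule eval_Cn_binary[OF eval_Id_nth eval_Cn_unary[OF eval_Id_nth eval_S] eval_add]) auto
  with Suc show ?case unfolding recf_triangle_def by (auto intro!: eval_PrS)
qed (auto intro!: eval_Pr0 eval_Z simp: recf_triangle_def)

lemma eval_pair: "eval recf_pair [x, y] (prod_encode (x, y))"
  unfolding recf_pair_def prod_encode_def
  by (auto intro!: eval_Cn_binary[OF eval_Cn_unary eval_Id_nth] eval_add eval_triangle)

text \<open>\<open>prod_encode (a, b) = triangle (a + b) + a\<close>, so \<open>a + b\<close> is found by unbounded search.\<close>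

definition recf_decode_sum :: recf where
  "recf_decode_sum = Mn (Cn recf_diff [Cn S [Id 1], Cn recf_triangle [Cn S [Id 0]]])"

definition recf_fst_decode :: recf where
  "recf_fst_decode = Cn recf_diff [Id 0, Cn recf_triangle [recf_decode_sum]]"

definition recf_snd_decode :: recf where
  "recf_snd_decode = Cn recf_diff [recf_decode_sum, recf_fst_decode]"

lemma triangle_mono: "x \<le> y \<Longrightarrow> triangle x \<le> triangle y"
  by (induction y) (auto simp: le_Suc_eq)

lemma triangle_decode_sum: "triangle (fst_decode p + snd_decode p) + fst_decode p = p"
  using prod_decode_inverse[of p] by (simp only: prod_encode_def split_beta prod.sel)

lemma eval_decode_sum: "eval recf_decode_sum [p] (fst_decode p + snd_decode p)"
proof -
  let ?test = "Cn recf_diff [Cn S [Id 1], Cn recf_triangle [Cn S [Id 0]]]"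
  define s where "s = fst_decode p + snd_decode p"
  have p_eq: "p = triangle s + fst_decode p" by (simp only: s_def triangle_decode_sum)
  have test: "eval ?test [i, p] (Suc p - triangle (Suc i))" for i
    by (rule eval_Cn_binary[OF eval_Cn_unary[OF eval_Id_nth]
          eval_Cn_unary[OF eval_Cn_unary[OF eval_Id_nth]] eval_diff])
      (auto intro: eval_S eval_triangle simp del: triangle_Suc)
  have "Suc p - triangle (Suc s) = 0" using p_eq by (simp add: s_def)
  moreover have "0 < Suc p - triangle (Suc i)" if "i < s" for i
    using triangle_mono[of "Suc i" s] that p_eq by simp
  ultimately have "eval (Mn ?test) [p] s"
    by (intro eval_Mn allI impI) (use test[of s] in simp, use test in blast)
  then show ?thesis by (simp only: recf_decode_sum_def s_def)
qed

lemma eval_fst_decode: "eval recf_fst_decode [p] (fst_decode p)"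
proof -
  have "eval recf_fst_decode [p] (p - triangle (fst_decode p + snd_decode p))"
    unfolding recf_fst_decode_def
    by (rule eval_Cn_binary[OF eval_Id_nth eval_Cn_unary[OF eval_decode_sum eval_triangle] eval_diff])
      auto
  moreover have "p - triangle (fst_decode p + snd_decode p) = fst_decode p"
    by (metis triangle_decode_sum add_diff_cancel_left')
  ultimately show ?thesis by simp
qed

lemma eval_snd_decode: "eval recf_snd_decode [p] (snd_decode p)"
  using eval_Cn_binary[OF eval_decode_sum eval_fst_decode eval_diff, of p]
  by (simp add: recf_snd_decode_def)

subsection \<open>Closure properties\<close>

text \<open>Functions of several arguments are handled by composing with the projections of a coded
  tuple: a function \<open>\<lambda>e i. f e i\<close> is computable iff \<open>\<lambda>p. f (fst_decode p) (snd_decode p)\<close> is.\<close>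

named_theorems computable_intros

lemma computable_compose:
  assumes "computable g" "computable f" shows "computable (\<lambda>e. g (f e))"
  using assms unfolding computable_def by (meson eval_Cn_unary)

lemma computable_binary:
  assumes "\<And>x y. eval r [x, y] (h x y)" "computable f" "computable g"
  shows "computable (\<lambda>e. h (f e) (g e))"
  using assms unfolding computable_def by (meson eval_Cn_binary)

lemma computable_curry:
  assumes "computable (\<lambda>p. h (fst_decode p) (snd_decode p))" "computable f" "computable g"
  shows "computable (\<lambda>e. h (f e) (g e))"
  using computable_compose[OF assms(1) computable_binary[OF eval_pair assms(2,3)]] by simp

lemma computable_ident [computable_intros]: "computable (\<lambda>e. e)"
  unfolding computable_def by (rule exI[of _ "Id 0"]) (auto intro: eval_Id_nth)

lemma computable_Suc [computable_intros]: "computable f \<Longrightarrow> computable (\<lambda>e. Suc (f e))"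
  by (rule computable_compose[of Suc]) (auto simp: computable_def intro: eval_S)

lemma computable_const [computable_intros]: "computable (\<lambda>e. c)"
proof (induction c)
  case 0
  show ?case unfolding computable_def using eval_Z by blast
next
  case (Suc c)
  then show ?case by (rule computable_Suc)
qed

lemma computable_fst_decode [computable_intros]: "computable f \<Longrightarrow> computable (\<lambda>e. fst_decode (f e))"
  by (rule computable_compose[of fst_decode]) (auto simp: computable_def intro: eval_fst_decode)

lemma computable_snd_decode [computable_intros]: "computable f \<Longrightarrow> computable (\<lambda>e. snd_decode (f e))"
  by (rule computable_compose[of snd_decode]) (auto simp: computable_def intro: eval_snd_decode)

lemmas computable_add [computable_intros] = computable_binary[OF eval_add]
  and computable_diff [computable_intros] = computable_binary[OF eval_diff]
  and computable_mult [computable_intros] = computable_binary[OF eval_mult]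
  and computable_prod_encode [computable_intros] = computable_binary[OF eval_pair]

lemma computable_rec_nat [computable_intros]:
  assumes "computable f" and computable_n: "computable n"
    and "computable (\<lambda>p. g (fst_decode p) (fst_decode (snd_decode p)) (snd_decode (snd_decode p)))"
  shows "computable (\<lambda>e. rec_nat (f e) (\<lambda>i y. g i y e) (n e))"
proof -
  obtain rf rg where eval_rf: "\<And>e. eval rf [e] (f e)"
    and eval_rg: "\<And>p. eval rg [p]
      (g (fst_decode p) (fst_decode (snd_decode p)) (snd_decode (snd_decode p)))"
    using assms(1,3) unfolding computable_def by blast
  let ?g = "Cn rg [Cn recf_pair [Id 0, Cn recf_pair [Id 1, Id 2]]]"
  have rec: "eval (Pr rf ?g) [i, e] (rec_nat (f e) (\<lambda>i y. g i y e) i)" for i e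
  proof (induction i)
    case 0
    then show ?case using eval_rf by (auto intro: eval_Pr0)
  next
    case (Suc i)
    let ?y = "rec_nat (f e) (\<lambda>i y. g i y e) i"
    have "eval ?g [i, ?y, e] (g i ?y e)"
      by (rule eval_Cn_unary[OF eval_Cn_binary[OF eval_Id_nth
              eval_Cn_binary[OF eval_Id_nth eval_Id_nth]]])
        (auto intro: eval_pair, use eval_rg[of "prod_encode (i, prod_encode (?y, e))"] in simp)
    with Suc show ?case by (auto intro: eval_PrS)
  qed
  show ?thesis by (rule computable_binary[OF rec computable_n computable_ident])
qed

definition decidable :: "(nat \<Rightarrow> bool) \<Rightarrow> bool" where
  "decidable P \<longleftrightarrow> computable (\<lambda>e. of_bool (P e))"

lemma decidable_set_Collect: "decidable P \<Longrightarrow> decidable_set {n. P n}"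
  unfolding decidable_def computable_def decidable_set_def of_bool_def by simp

lemma decidable_compose: "decidable P \<Longrightarrow> computable f \<Longrightarrow> decidable (\<lambda>e. P (f e))"
  unfolding decidable_def by (rule computable_compose)

lemma decidable_curry:
  assumes "decidable (\<lambda>p. P (fst_decode p) (snd_decode p))" "computable f" "computable g"
  shows "decidable (\<lambda>e. P (f e) (g e))"
  using decidable_compose[OF assms(1) computable_prod_encode[OF assms(2,3)]] by simp

lemma computable_of_bool [computable_intros]: "decidable P \<Longrightarrow> computable (\<lambda>e. of_bool (P e))"
  by (simp add: decidable_def)

lemma computable_If [computable_intros]:
  assumes "decidable P" "computable f" "computable g"
  shows "computable (\<lambda>e. if P e then f e else g e)"
proof -
  have "(if P e then f e else g e) = of_bool (P e) * f e + (1 - of_bool (P e)) * g e" for e by simp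
  then show ?thesis by (simp only:) (intro computable_intros assms)
qed

lemma decidable_pos: assumes "computable f" shows "decidable (\<lambda>e. 0 < f e)"
proof -
  have "of_bool (0 < f e) = 1 - (1 - f e)" for e by simp
  then show ?thesis unfolding decidable_def by (simp only:) (intro computable_intros assms)
qed

lemma decidable_const [computable_intros]: "decidable (\<lambda>e. c)"
  unfolding decidable_def by (rule computable_const)

lemma decidable_not [computable_intros]: assumes "decidable P" shows "decidable (\<lambda>e. \<not> P e)"
proof -
  have "of_bool (\<not> P e) = 1 - (of_bool (P e) :: nat)" for e by simp
  then show ?thesis unfolding decidable_def using assms by (simp only:) (intro computable_intros)
qed

lemma decidable_conj [computable_intros]:
  assumes "decidable P" "decidable Q" shows "decidable (\<lambda>e. P e \<and> Q e)"
  unfolding decidable_def of_bool_conj using assms by (intro computable_intros)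

lemma decidable_disj [computable_intros]:
  assumes "decidable P" "decidable Q" shows "decidable (\<lambda>e. P e \<or> Q e)"
  using decidable_not[OF decidable_conj[OF assms[THEN decidable_not]]] by simp

lemma decidable_imp [computable_intros]:
  assumes "decidable P" "decidable Q" shows "decidable (\<lambda>e. P e \<longrightarrow> Q e)"
  unfolding imp_conv_disj using assms by (intro computable_intros)

lemma decidable_iff [computable_intros]:
  assumes "decidable P" "decidable Q" shows "decidable (\<lambda>e. P e \<longleftrightarrow> Q e)"
  unfolding iff_conv_conj_imp using assms by (intro computable_intros)

lemma decidable_less [computable_intros]:
  assumes "computable f" "computable g" shows "decidable (\<lambda>e. f e < g e)"
  using decidable_pos[OF computable_diff[OF assms(2,1)]] by simp

lemma decidable_le [computable_intros]:
  assumes "computable f" "computable g" shows "decidable (\<lambda>e. f e \<le> g e)"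
  unfolding not_less[symmetric] using assms by (intro computable_intros)

lemma decidable_eq [computable_intros]:
  assumes "computable f" "computable g" shows "decidable (\<lambda>e. f e = g e)"
  unfolding order_eq_iff using assms by (intro computable_intros)

lemma decidable_all_less [computable_intros]:
  assumes decidable_P: "decidable (\<lambda>p. P (fst_decode p) (snd_decode p))"
    and computable_b: "computable b"
  shows "decidable (\<lambda>e. \<forall>i<b e. P e i)"
proof -
  have "of_bool (\<forall>i<n. P e i) = rec_nat (1 :: nat) (\<lambda>i y. of_bool (P e i) * y) n" for e n
  proof (induction n)
    case (Suc n)
    show ?case unfolding nat.rec Suc[symmetric] by (auto simp: less_Suc_eq)
  qed simp
  then show ?thesis
    unfolding decidable_def using computable_b
    by (simp only:) (intro computable_intros decidable_curry[OF decidable_P])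
qed

lemma decidable_ex_less [computable_intros]:
  assumes "decidable (\<lambda>p. P (fst_decode p) (snd_decode p))" "computable b"
  shows "decidable (\<lambda>e. \<exists>i<b e. P e i)"
  using decidable_not[OF decidable_all_less[OF decidable_not[OF assms(1)] assms(2)]] by simp

lemma decidable_all_le [computable_intros]:
  assumes "decidable (\<lambda>p. P (fst_decode p) (snd_decode p))" "computable b"
  shows "decidable (\<lambda>e. \<forall>i\<le>b e. P e i)"
  unfolding less_Suc_eq_le[symmetric] using assms by (intro computable_intros)

lemma decidable_ex_le [computable_intros]:
  assumes "decidable (\<lambda>p. P (fst_decode p) (snd_decode p))" "computable b"
  shows "decidable (\<lambda>e. \<exists>i\<le>b e. P e i)"
  unfolding less_Suc_eq_le[symmetric] using assms by (intro computable_intros)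

lemma computable_Least [computable_intros]:
  assumes decidable_P: "decidable (\<lambda>p. P (fst_decode p) (snd_decode p))"
    and exists_P: "\<And>e. \<exists>i. P e i"
  shows "computable (\<lambda>e. LEAST i. P e i)"
proof -
  obtain r where eval_r: "\<And>p. eval r [p] (of_bool (\<not> P (fst_decode p) (snd_decode p)))"
    using decidable_not[OF decidable_P] unfolding decidable_def computable_def by blast
  let ?r = "Cn r [Cn recf_pair [Id 1, Id 0]]"
  have test: "eval ?r [i, e] (of_bool (\<not> P e i))" for i e
    by (rule eval_Cn_unary[OF eval_Cn_binary[OF eval_Id_nth eval_Id_nth eval_pair]])
      (use eval_r[of "prod_encode (e, i)"] in auto)
  have "eval (Mn ?r) [e] (LEAST i. P e i)" for e
  proof (rule eval_Mn)
    show "eval ?r [LEAST i. P e i, e] 0"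
      using test[of "LEAST i. P e i" e] LeastI_ex[OF exists_P[of e]] by simp
    show "\<forall>i<LEAST i. P e i. \<exists>y. eval ?r [i, e] y \<and> 0 < y"
      using test[of _ e] not_less_Least by (metis of_bool_eq(2) zero_less_one)
  qed
  then show ?thesis unfolding computable_def by blast
qed

lemma computable_power [computable_intros]:
  assumes "computable f" "computable g" shows "computable (\<lambda>e. f e ^ g e)"
proof -
  have "a ^ n = rec_nat 1 (\<lambda>i y. a * y) n" for a n :: nat by (induction n) auto
  then show ?thesis by (simp only:) (intro computable_intros assms[THEN computable_compose])
qed

lemma computable_div [computable_intros]:
  assumes "computable f" "computable g" shows "computable (\<lambda>e. f e div g e)"
proof -
  have "a div b = (LEAST q. b = 0 \<or> a < Suc q * b)" for a b :: nat
  proof (rule Least_equality[symmetric])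
    show "b = 0 \<or> a < Suc (a div b) * b" using dividend_less_div_times[of b a] by auto
    show "a div b \<le> q" if "b = 0 \<or> a < Suc q * b" for q
      using that less_mult_imp_div_less[of a "Suc q" b] by auto
  qed
  moreover have "\<exists>q. b = 0 \<or> a < Suc q * b" for a b :: nat
    by (rule exI[of _ "a div b"]) (use dividend_less_div_times[of b a] in auto)
  ultimately show ?thesis by (simp only:) (intro computable_intros assms[THEN computable_compose])
qed

lemma computable_mod [computable_intros]:
  assumes "computable f" "computable g" shows "computable (\<lambda>e. f e mod g e)"
proof -
  have "a mod b = a - (a div b) * b" for a b :: nat by (simp add: minus_div_mult_eq_mod)
  then show ?thesis using assms by (simp only:) (intro computable_intros)
qed

lemma decidable_odd [computable_intros]: assumes "computable f" shows "decidable (\<lambda>e. odd (f e))"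
  unfolding odd_iff_mod_2_eq_one using assms by (intro computable_intros)

lemma decidable_even [computable_intros]: assumes "computable f" shows "decidable (\<lambda>e. even (f e))"
  using decidable_not[OF decidable_odd[OF assms]] by simp

lemma decidable_mem_set_decode [computable_intros]:
  assumes "computable f" "computable g" shows "decidable (\<lambda>e. f e \<in> set_decode (g e))"
  unfolding set_decode_def mem_Collect_eq using assms by (intro computable_intros)

subsection \<open>Coded lists\<close>

abbreviation length_code :: "nat \<Rightarrow> nat" where "length_code c \<equiv> length (list_decode c)"
abbreviation nth_code :: "nat \<Rightarrow> nat \<Rightarrow> nat" where "nth_code c i \<equiv> nth_default 0 (list_decode c) i"

text \<open>The code \<open>0\<close> of the empty list needs no special treatment because \<open>prod_decode 0 = (0, 0)\<close>.\<close>

lemma prod_decode_0 [simp]: "prod_decode 0 = (0, 0)"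
  using prod_encode_inverse[of "(0, 0)"] by (simp add: prod_encode_def)

definition drop_code :: "nat \<Rightarrow> nat \<Rightarrow> nat" where
  "drop_code i c = rec_nat c (\<lambda>_ y. snd_decode (y - 1)) i"

lemma list_decode_drop_code: "list_decode (drop_code i c) = drop i (list_decode c)"
proof -
  have "list_decode (snd_decode (c - 1)) = tl (list_decode c)" for c
    by (cases c) (auto split: prod.split)
  then show ?thesis by (induction i) (auto simp: drop_code_def drop_Suc tl_drop)
qed

lemma nth_code_eq: "nth_code c i = fst_decode (drop_code i c - 1)"
proof -
  have "fst_decode (c - 1) = nth_code c 0" for c
    by (cases c) (auto split: prod.split)
  then show ?thesis by (simp add: list_decode_drop_code nth_default_def hd_drop_conv_nth)
qed

lemma list_decode_eq_Nil_iff: "list_decode c = [] \<longleftrightarrow> c = 0"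
  by (metis list_decode.simps(1) list_decode_inverse list_encode.simps(1))

lemma length_code_eq: "length_code c = (LEAST i. drop_code i c = 0)"
proof -
  have "drop_code i c = 0 \<longleftrightarrow> length_code c \<le> i" for i
    unfolding list_decode_eq_Nil_iff[symmetric] list_decode_drop_code by simp
  then show ?thesis by (auto intro!: Least_equality[symmetric])
qed

lemma computable_drop_code [computable_intros]:
  "computable f \<Longrightarrow> computable g \<Longrightarrow> computable (\<lambda>e. drop_code (f e) (g e))"
  unfolding drop_code_def by (intro computable_intros)

lemma computable_nth_code [computable_intros]:
  "computable f \<Longrightarrow> computable g \<Longrightarrow> computable (\<lambda>e. nth_code (f e) (g e))"
  unfolding nth_code_eq by (intro computable_intros)

lemma computable_length_code [computable_intros]:
  assumes "computable f" shows "computable (\<lambda>e. length_code (f e))"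
proof -
  have "drop_code (length_code c) c = 0" for c
    unfolding list_decode_eq_Nil_iff[symmetric] list_decode_drop_code by simp
  then show ?thesis
    unfolding length_code_eq by (intro computable_intros assms[THEN computable_compose]) blast
qed

lemma bex_list_decode: "(\<exists>x\<in>set (list_decode c). P x) \<longleftrightarrow> (\<exists>i<length_code c. P (nth_code c i))"
  unfolding set_conv_nth by (auto simp: nth_default_def)

lemma decidable_bex_list_decode [computable_intros]:
  assumes "decidable (\<lambda>p. P (fst_decode p) (snd_decode p))" "computable f"
  shows "decidable (\<lambda>e. \<exists>x\<in>set (list_decode (f e)). P e x)"
  unfolding bex_list_decode
  by (intro decidable_curry[OF assms(1)] computable_intros assms(2)[THEN computable_compose])

lemma decidable_ball_list_decode [computable_intros]:
  assumes "decidable (\<lambda>p. P (fst_decode p) (snd_decode p))" "computable f"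
  shows "decidable (\<lambda>e. \<forall>x\<in>set (list_decode (f e)). P e x)"
  using decidable_not[OF decidable_bex_list_decode[OF decidable_not[OF assms(1)] assms(2)]] by simp

lemma decidable_mem_list_decode [computable_intros]:
  assumes "computable f" "computable g" shows "decidable (\<lambda>e. f e \<in> set (list_decode (g e)))"
proof -
  have "x \<in> A \<longleftrightarrow> (\<exists>y\<in>A. y = x)" for x :: nat and A by blast
  then show ?thesis by (simp only:) (intro computable_intros assms[THEN computable_compose])
qed

lemma list_encode_eq_iff_nth_code:
  "list_encode xs = c \<longleftrightarrow> length_code c = length xs \<and> (\<forall>i<length xs. nth_code c i = xs ! i)"
proof -
  have "list_encode xs = c \<longleftrightarrow> list_decode c = xs" by auto
  then show ?thesis by (auto simp: list_eq_iff_nth_eq nth_default_def)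
qed

lemma less_list_encode_of_mem: "x \<in> set xs \<Longrightarrow> x < list_encode xs"
proof (induction xs)
  case (Cons y xs)
  then show ?case
    using le_prod_encode_1[of y "list_encode xs"] le_prod_encode_2[of "list_encode xs" y] by auto
qed simp

lemma nth_code_less: "0 < c \<Longrightarrow> nth_code c i < c"
  using less_list_encode_of_mem[of "list_decode c ! i" "list_decode c"]
  by (auto simp: nth_default_def)

lemma prod_encode_mono: "a \<le> a' \<Longrightarrow> b \<le> b' \<Longrightarrow> prod_encode (a, b) \<le> prod_encode (a', b')"
  unfolding prod_encode_def by (simp add: add_mono triangle_mono)

lemma list_encode_le_replicate:
  "length xs \<le> l \<Longrightarrow> \<forall>x\<in>set xs. x \<le> b \<Longrightarrow> list_encode xs \<le> list_encode (replicate l b)"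
proof (induction xs arbitrary: l)
  case (Cons x xs)
  then show ?case by (cases l) (auto intro: prod_encode_mono)
qed simp

lemma computable_list_encode_replicate [computable_intros]:
  assumes "computable f" "computable g" shows "computable (\<lambda>e. list_encode (replicate (f e) (g e)))"
proof -
  have "list_encode (replicate n b) = rec_nat 0 (\<lambda>i y. Suc (prod_encode (b, y))) n" for n b
    by (induction n) auto
  then show ?thesis by (simp only:) (intro computable_intros assms[THEN computable_compose])
qed

text \<open>Course-of-values recursion over codes: \<open>table e n\<close> codes the list of the truth values of
  \<open>P e c\<close> for \<open>c < n\<close>, latest first.\<close>

lemma decidable_code_recursion:
  assumes zero: "\<And>e. \<not> P e 0" and rec: "\<And>e c. P e c \<longleftrightarrow> Q e c (\<lambda>i. P e (nth_code c i))"
    and decidable_Q: "\<And>H. decidable (\<lambda>p. H (fst_decode p) (snd_decode p)) \<Longrightarrow>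
      decidable (\<lambda>p. Q (fst_decode p) (fst_decode (snd_decode p)) (H p))"
  shows "decidable (\<lambda>p. P (fst_decode p) (snd_decode p))"
proof -
  define looked_up where "looked_up y c i \<longleftrightarrow> nth_code y (c - Suc (nth_code c i)) = 1" for y c i
  define step where "step e c y \<longleftrightarrow> 0 < c \<and> Q e c (looked_up y c)" for e c y
  define table where
    "table e n = rec_nat 0 (\<lambda>c y. Suc (prod_encode (of_bool (step e c y), y))) n" for e n
  have "list_decode (table e n) = rev (map (\<lambda>c. of_bool (P e c)) [0..<n])" for e n
  proof (induction n)
    case (Suc n)
    have "looked_up (table e n) n i \<longleftrightarrow> P e (nth_code n i)" if "0 < n" for i
    proof -
      have "nth_code n i < n" using that by (rule nth_code_less)
      then show ?thesis unfolding looked_up_def Suc by (simp add: nth_default_nth rev_nth)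
    qed
    then have "0 < n \<Longrightarrow> looked_up (table e n) n = (\<lambda>i. P e (nth_code n i))" by blast
    then have "step e n (table e n) \<longleftrightarrow> P e n"
      using zero[of e] by (cases "n = 0") (simp_all add: step_def rec[of e n])
    moreover have "table e (Suc n) = Suc (prod_encode (of_bool (step e n (table e n)), table e n))"
      by (simp add: table_def)
    ultimately show ?case using Suc by simp
  qed (simp add: table_def)
  then have P_iff: "P e c \<longleftrightarrow> nth_code (table e (Suc c)) 0 = 1" for e c by simp
  have "decidable (\<lambda>p. Q (fst_decode p) (fst_decode (snd_decode p))
      (looked_up (snd_decode (snd_decode p)) (fst_decode (snd_decode p))))"
    by (rule decidable_Q) (unfold looked_up_def, intro computable_intros)
  from decidable_compose[OF this] have decidable_Q_looked_up:
    "decidable (\<lambda>e. Q (f e) (g e) (looked_up (h e) (g e)))"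
    if "computable f" "computable g" "computable h" for f g h
    using computable_prod_encode[OF that(1) computable_prod_encode[OF that(2,3)]] by fastforce
  show ?thesis
    unfolding P_iff table_def step_def by (intro computable_intros decidable_Q_looked_up)
qed

section \<open>Flagged graphs\<close>

subsection \<open>Rankings\<close>

type_synonym 'v flagged_graph = "('v \<times> bool \<times> 'v) set"

definition edges :: "'v flagged_graph \<Rightarrow> ('v \<times> 'v) set" where
  "edges E = {(v, v'). \<exists>c. (v, c, v') \<in> E}"

definition flagged_edges :: "'v flagged_graph \<Rightarrow> ('v \<times> 'v) set" where
  "flagged_edges E = {(v, v'). (v, True, v') \<in> E}"

definition finitely_flagged :: "'v flagged_graph \<Rightarrow> 'v set \<Rightarrow> bool" where
  "finitely_flagged E I \<longleftrightarrow>
    (\<forall>f c. f 0 \<in> I \<longrightarrow> (\<forall>i. (f i, c i, f (Suc i)) \<in> E) \<longrightarrow> \<not> (\<exists>\<^sub>\<infinity>i. c i))"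

text \<open>Rank \<open>\<infinity>\<close> imposes no constraint; it is meant for the vertices that play no role.\<close>

definition ranking :: "'v flagged_graph \<Rightarrow> ('v \<Rightarrow> enat) \<Rightarrow> bool" where
  "ranking E b \<longleftrightarrow> (\<forall>(v, c, v') \<in> E. b v' + of_bool c \<le> b v)"

lemma rankingD: "ranking E b \<Longrightarrow> (v, c, v') \<in> E \<Longrightarrow> b v' + of_bool c \<le> b v"
  by (auto simp: ranking_def)

lemma not_finitely_flaggedI:
  "f 0 \<in> I \<Longrightarrow> (\<And>i. (f i, c i, f (Suc i)) \<in> E) \<Longrightarrow> \<exists>\<^sub>\<infinity>i. c i \<Longrightarrow> \<not> finitely_flagged E I"
  unfolding finitely_flagged_def by blast

lemma not_finitely_flaggedE:
  assumes "\<not> finitely_flagged E I"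
  obtains f c where "f 0 \<in> I" "\<And>i. (f i, c i, f (Suc i)) \<in> E" "\<exists>\<^sub>\<infinity>i. c i"
  using assms unfolding finitely_flagged_def by metis

lemma finitely_flagged_subset: "finitely_flagged E I \<Longrightarrow> E' \<subseteq> E \<Longrightarrow> finitely_flagged E' I"
  unfolding finitely_flagged_def by blast

lemma edges_of_flagged_edges: "(v, v') \<in> flagged_edges E \<Longrightarrow> (v, v') \<in> edges E"
  by (auto simp: edges_def flagged_edges_def)

lemma eventually_constant_if_decreasing:
  fixes A :: "nat \<Rightarrow> 'a :: wellorder"
  assumes "\<forall>\<^sub>\<infinity>t. A (Suc t) \<le> A t"
  shows "\<exists>a. \<forall>\<^sub>\<infinity>t. A t = a"
proof -
  obtain t\<^sub>0 where decreasing: "A (Suc t) \<le> A t" if "t\<^sub>0 \<le> t" for t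
    using assms by (auto simp: MOST_nat_le)
  define a where "a = (LEAST a. \<exists>t\<ge>t\<^sub>0. A t = a)"
  have least: "a \<le> A t" if "t\<^sub>0 \<le> t" for t unfolding a_def by (rule Least_le) (use that in blast)
  have "\<exists>t\<ge>t\<^sub>0. A t = a" unfolding a_def by (rule LeastI_ex) blast
  then obtain t\<^sub>1 where attained: "t\<^sub>0 \<le> t\<^sub>1" "A t\<^sub>1 = a" by blast
  have "A t = a" if "t\<^sub>1 \<le> t" for t
    using that
  proof (induction t rule: dec_induct)
    case (step t)
    then show ?case using decreasing[of t] least[of "Suc t"] attained(1) by simp
  qed (use attained in simp)
  then show ?thesis unfolding MOST_nat_le by blast
qed

lemma finitely_flagged_if_ranking:
  assumes ranking: "ranking E b" and finite_initial: "\<forall>v\<in>I. b v \<noteq> \<infinity>"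
  shows "finitely_flagged E I"
  unfolding finitely_flagged_def
proof (intro allI impI)
  fix f c assume start: "f 0 \<in> I" and path: "\<forall>i. (f i, c i, f (Suc i)) \<in> E"
  have step: "b (f (Suc i)) + of_bool (c i) \<le> b (f i)" for i
    using rankingD[OF ranking] path by blast
  then have decreasing: "b (f (Suc i)) \<le> b (f i)" for i
    by (rule order_trans[rotated]) simp
  have "b (f i) \<le> b (f 0)" for i by (induction i) (use decreasing order_trans in auto)
  then have finite: "b (f i) \<noteq> \<infinity>" for i using finite_initial start by (metis enat_ord_simps(5))
  obtain a where limit: "\<forall>\<^sub>\<infinity>i. b (f i) = a"
    using eventually_constant_if_decreasing[of "\<lambda>i. b (f i)"] decreasing by auto
  have "\<forall>\<^sub>\<infinity>i. \<not> c i"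
    using limit MOST_SucI[OF limit]
  proof eventually_elim
    case (elim i)
    then show ?case using step[of i] finite[of i] by (cases "b (f i)") (auto simp: one_enat_def)
  qed
  then show "\<not> (\<exists>\<^sub>\<infinity>i. c i)" by simp
qed

lemma rtrancl_distance_exists:
  obtains dist :: "'a \<Rightarrow> nat" where "\<And>v. (v, w) \<in> r\<^sup>* \<Longrightarrow> v \<noteq> w \<Longrightarrow>
    \<exists>v'. (v, v') \<in> r \<and> (v', w) \<in> r\<^sup>* \<and> dist v' < dist v"
proof
  define dist where "dist v = (LEAST n. (v, w) \<in> r ^^ n)" for v
  fix v assume "(v, w) \<in> r\<^sup>*" and "v \<noteq> w"
  then have "\<exists>n. (v, w) \<in> r ^^ n" by (simp add: rtrancl_power)
  then have walk: "(v, w) \<in> r ^^ dist v" unfolding dist_def by (rule LeastI_ex)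
  with \<open>v \<noteq> w\<close> obtain n where dist_v: "dist v = Suc n" by (cases "dist v") auto
  obtain v' where step: "(v, v') \<in> r" and rest: "(v', w) \<in> r ^^ n"
    using walk unfolding dist_v by (rule relpow_Suc_E2)
  have "dist v' \<le> n" unfolding dist_def using rest by (rule Least_le)
  then show "\<exists>v'. (v, v') \<in> r \<and> (v', w) \<in> r\<^sup>* \<and> dist v' < dist v"
    using step relpow_imp_rtrancl[OF rest] dist_v by auto
qed

lemma infinitely_often_if_decreasing_otherwise:
  fixes g :: "nat \<Rightarrow> 'a :: wellorder"
  assumes closer: "\<And>n. \<not> P n \<Longrightarrow> g (Suc n) < g n"
  shows "\<exists>\<^sub>\<infinity>n. P n"
  unfolding INFM_nat_le
proof
  show "\<exists>n\<ge>m. P n" for m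
  proof (induction "g m" arbitrary: m rule: less_induct)
    case less
    show ?case
    proof (cases "P m")
      case False
      from less[OF closer[OF this]] show ?thesis using Suc_leD by blast
    qed blast
  qed
qed

lemma not_finitely_flagged_if_cycle:
  assumes reachable: "s \<in> I" "(s, w) \<in> (edges E)\<^sup>*" and flag: "(w, w') \<in> flagged_edges E"
    and return: "(w', w) \<in> (edges E)\<^sup>*"
  shows "\<not> finitely_flagged E I"
proof -
  obtain dist :: "'a \<Rightarrow> nat" where dist: "\<And>v. (v, w) \<in> (edges E)\<^sup>* \<Longrightarrow> v \<noteq> w \<Longrightarrow>
      \<exists>v'. (v, v') \<in> edges E \<and> (v', w) \<in> (edges E)\<^sup>* \<and> dist v' < dist v"
    using rtrancl_distance_exists[of w "edges E"] by blast
  have towards_w: "\<exists>v'. (v', w) \<in> (edges E)\<^sup>* \<and>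
      (\<exists>c. (v, c, v') \<in> E \<and> (if v = w then c else dist v' < dist v))"
    if "(v, w) \<in> (edges E)\<^sup>*" for v
  proof (cases "v = w")
    case True
    then show ?thesis using flag return by (auto simp: flagged_edges_def)
  next
    case False
    with dist[OF that] show ?thesis by (auto simp: edges_def)
  qed
  have "\<exists>f. \<forall>n. ((f n, w) \<in> (edges E)\<^sup>* \<and> (n = 0 \<longrightarrow> f n = s)) \<and>
      (\<exists>c. (f n, c, f (Suc n)) \<in> E \<and> (if f n = w then c else dist (f (Suc n)) < dist (f n)))"
  proof (rule dependent_nat_choice)
    have "(s, w) \<in> (edges E)\<^sup>*" by (rule reachable(2))
    then show "\<exists>v. (v, w) \<in> (edges E)\<^sup>* \<and> (0 = 0 \<longrightarrow> v = s)" by blast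
  qed (use towards_w in blast)
  then obtain f where start: "f 0 = s" and "\<forall>n. \<exists>c. (f n, c, f (Suc n)) \<in> E \<and>
      (if f n = w then c else dist (f (Suc n)) < dist (f n))" by blast
  then obtain c where edge: "\<And>n. (f n, c n, f (Suc n)) \<in> E \<and>
      (if f n = w then c n else dist (f (Suc n)) < dist (f n))" unfolding choice_iff by blast
  have "dist (f (Suc n)) < dist (f n)" if "f n \<noteq> w" for n using edge[of n] that by simp
  then have "\<exists>\<^sub>\<infinity>n. f n = w" by (rule infinitely_often_if_decreasing_otherwise)
  then have "\<exists>\<^sub>\<infinity>n. c n" by (rule INFM_mono) (use edge in metis)
  then show ?thesis using start reachable(1) edge by (intro not_finitely_flaggedI[of f I c]) auto
qed

definition flag_targets :: "'v flagged_graph \<Rightarrow> 'v \<Rightarrow> 'v set" where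
  "flag_targets E v = flagged_edges E `` (edges E)\<^sup>* `` {v}"

lemma flag_targets_mono: "(v, v') \<in> edges E \<Longrightarrow> flag_targets E v' \<subseteq> flag_targets E v"
  by (auto simp: flag_targets_def intro: converse_rtrancl_into_rtrancl)

lemma flag_targets_psubset:
  assumes "finitely_flagged E I" "s \<in> I" "(s, v') \<in> (edges E)\<^sup>*" and edge: "(v, True, v') \<in> E"
  shows "flag_targets E v' \<subset> flag_targets E v"
proof -
  have "v' \<notin> flag_targets E v'"
  proof
    assume "v' \<in> flag_targets E v'"
    then obtain w where "(v', w) \<in> (edges E)\<^sup>*" "(w, v') \<in> flagged_edges E"
      by (auto simp: flag_targets_def)
    then show False
      using not_finitely_flagged_if_cycle[OF assms(2)] rtrancl_trans[OF assms(3)] assms(1) by blast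
  qed
  moreover have "v' \<in> flag_targets E v" using edge by (auto simp: flag_targets_def flagged_edges_def)
  moreover have "flag_targets E v' \<subseteq> flag_targets E v"
    using edge by (intro flag_targets_mono) (auto simp: edges_def)
  ultimately show ?thesis by blast
qed

text \<open>A vertex is ranked by the number of targets of flagged edges reachable from it; without
  flagged cycles, taking a flagged edge loses its target.\<close>

lemma ranking_exists:
  assumes "finite V" "E \<subseteq> V \<times> UNIV \<times> V" and finitely_flagged: "finitely_flagged E I"
  obtains b where "ranking E b" "\<And>v. b v \<le> enat (card V) \<or> b v = \<infinity>" "\<forall>v\<in>I. b v \<noteq> \<infinity>"
proof
  define b where
    "b v = (if v \<in> (edges E)\<^sup>* `` I then enat (card (flag_targets E v)) else \<infinity>)" for v
  have targets_V: "flag_targets E v \<subseteq> V" for v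
    using assms(2) by (auto simp: flag_targets_def flagged_edges_def)
  then have finite_targets: "finite (flag_targets E v)" for v using assms(1) by (rule finite_subset)
  have "card (flag_targets E v) \<le> card V" for v using assms(1) targets_V by (rule card_mono)
  then show "b v \<le> enat (card V) \<or> b v = \<infinity>" for v by (simp add: b_def)
  show "\<forall>v\<in>I. b v \<noteq> \<infinity>" by (auto simp: b_def)
  show "ranking E b"
    unfolding ranking_def
  proof clarify
    fix v c v' assume in_E: "(v, c, v') \<in> E"
    then have edge: "(v, v') \<in> edges E" by (auto simp: edges_def)
    show "b v' + of_bool c \<le> b v"
    proof (cases "v \<in> (edges E)\<^sup>* `` I")
      case True
      then obtain s where reachable: "s \<in> I" "(s, v') \<in> (edges E)\<^sup>*"
        using edge by (auto intro: rtrancl_into_rtrancl)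
      have "card (flag_targets E v') + of_bool c \<le> card (flag_targets E v)"
      proof (cases c)
        case True
        then have "flag_targets E v' \<subset> flag_targets E v"
          using flag_targets_psubset[OF finitely_flagged reachable] in_E by simp
        then show ?thesis using True psubset_card_mono[OF finite_targets] by (simp add: Suc_le_eq)
      qed (use card_mono[OF finite_targets flag_targets_mono[OF edge]] in simp)
      moreover have "v' \<in> (edges E)\<^sup>* `` I" using reachable by blast
      ultimately show ?thesis using True by (cases c) (simp_all add: b_def one_enat_def)
    qed (simp add: b_def)
  qed
qed

subsection \<open>Tracking the paths with infinitely many flags\<close>

text \<open>A tracking state is a list of pairs \<open>(S, U)\<close> in order of age: \<open>S\<close> is propagated along the
  edges, \<open>U \<subseteq> S\<close> collects the vertices reached through a flag since the last flash, and a flash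
  (\<open>U = S\<close>) empties \<open>U\<close>. Each \<open>U\<close> is also spawned as a new first component at every step, and only
  the oldest of equal first components is kept. This weak form of Safra's determinisation
  detects every path with infinitely many flags.\<close>

type_synonym 'v tracking_state = "('v set \<times> 'v set) list"

definition marked :: "'v flagged_graph \<Rightarrow> 'v set \<times> 'v set \<Rightarrow> 'v set" where
  "marked T n = edges T `` snd n \<union> flagged_edges T `` fst n"

definition flash :: "'v flagged_graph \<Rightarrow> 'v set \<times> 'v set \<Rightarrow> bool" where
  "flash T n \<longleftrightarrow> marked T n = edges T `` fst n"

definition advance :: "'v flagged_graph \<Rightarrow> 'v set \<times> 'v set \<Rightarrow> 'v set \<times> 'v set" where
  "advance T n = (edges T `` fst n, if flash T n then {} else marked T n)"

definition successors :: "'v flagged_graph \<Rightarrow> 'v tracking_state \<Rightarrow> 'v tracking_state" where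
  "successors T d = map (advance T) d @ map (\<lambda>n. (marked T n, {})) d"

definition track :: "'v flagged_graph \<Rightarrow> 'v tracking_state \<Rightarrow> 'v tracking_state" where
  "track T d = AList.clearjunk (AList.delete {} (successors T d))"

lemma marked_subset: "snd n \<subseteq> fst n \<Longrightarrow> marked T n \<subseteq> edges T `` fst n"
  by (auto simp: marked_def dest: edges_of_flagged_edges)

lemma filter_nth_position:
  assumes "p < length xs" "P (xs ! p)"
  obtains q where "q \<le> p" "q < length (filter P xs)" "filter P xs ! q = xs ! p"
    "q = p \<Longrightarrow> take (Suc p) (filter P xs) = take (Suc p) xs"
proof
  let ?q = "length (filter P (take p xs))"
  have split: "filter P xs = filter P (take p xs) @ xs ! p # filter P (drop (Suc p) xs)"
    using assms by (subst id_take_nth_drop[OF assms(1)]) simp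
  show "?q \<le> p" using length_filter_le[of P "take p xs"] by simp
  show "?q < length (filter P xs)" "filter P xs ! ?q = xs ! p" by (simp_all add: split)
  assume "?q = p"
  then have "filter P (take p xs) = take p xs"
    using assms(1) by (intro filter_True)
      (metis length_filter_less length_take less_imp_le_nat less_irrefl min.absorb2)
  then show "take (Suc p) (filter P xs) = take (Suc p) xs"
    using assms(1) split by (simp add: take_Suc_conv_app_nth)
qed

lemma clearjunk_nth_position:
  "p < length ns \<Longrightarrow> \<exists>q\<le>p. q < length (AList.clearjunk ns) \<and>
      fst (AList.clearjunk ns ! q) = fst (ns ! p) \<and>
    (q = p \<longrightarrow> take (Suc p) (AList.clearjunk ns) = take (Suc p) ns)"
proof (induction ns arbitrary: p rule: AList.clearjunk.induct)
  case (2 n ns)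
  show ?case
  proof (cases "fst ((n # ns) ! p) = fst n")
    case True
    then show ?thesis by (intro exI[of _ 0]) auto
  next
    case False
    then obtain r where p_eq: "p = Suc r" by (cases p) auto
    with False 2 obtain r' where after_delete: "r' \<le> r" "r' < length (AList.delete (fst n) ns)"
      "AList.delete (fst n) ns ! r' = ns ! r"
      "r' = r \<Longrightarrow> take (Suc r) (AList.delete (fst n) ns) = take (Suc r) ns"
      using filter_nth_position[of r ns "\<lambda>(k, _). fst n \<noteq> k"]
      by (auto simp: AList.delete_eq split_beta)
    with "2.IH"[of r'] obtain q where "q \<le> r'"
      "q < length (AList.clearjunk (AList.delete (fst n) ns))"
      "fst (AList.clearjunk (AList.delete (fst n) ns) ! q) = fst (ns ! r)"
      "q = r' \<longrightarrow> take (Suc r') (AList.clearjunk (AList.delete (fst n) ns)) =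
        take (Suc r') (AList.delete (fst n) ns)"
      by auto
    then show ?thesis using p_eq after_delete by (intro exI[of _ "Suc q"]) auto
  qed
qed simp

lemma track_nth_position:
  assumes "p < length d" "edges T `` fst (d ! p) \<noteq> {}"
  shows "\<exists>q\<le>p. q < length (track T d) \<and> fst (track T d ! q) = edges T `` fst (d ! p) \<and>
    (q = p \<longrightarrow> take (Suc p) (track T d) = map (advance T) (take (Suc p) d))"
proof -
  have succ: "successors T d ! p = advance T (d ! p)"
    "take (Suc p) (successors T d) = map (advance T) (take (Suc p) d)"
    using assms(1) by (auto simp: successors_def nth_append take_map)
  obtain r where after_delete: "r \<le> p" "r < length (AList.delete {} (successors T d))"
    "AList.delete {} (successors T d) ! r = advance T (d ! p)"
    "r = p \<Longrightarrow> take (Suc p) (AList.delete {} (successors T d)) = take (Suc p) (successors T d)"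
    using filter_nth_position[of p "successors T d" "\<lambda>(k, _). {} \<noteq> k"] assms succ(1)
    by (auto simp: AList.delete_eq successors_def advance_def split_beta)
  from clearjunk_nth_position[OF after_delete(2)] show ?thesis
    using after_delete succ(2) by (auto simp: track_def advance_def intro: order_trans)
qed

lemma fst_track: "fst ` set (track T d) = fst ` set (successors T d) - {{}}"
  by (auto simp: track_def AList.dom_clearjunk AList.delete_eq image_iff)

lemma distinct_track: "distinct (map fst (track T d))"
  by (simp add: track_def)

lemma set_track: "set (track T d) \<subseteq> set (successors T d)"
proof -
  have "set (AList.clearjunk ns) \<subseteq> set ns" for ns :: "'a tracking_state"
    by (induction ns rule: AList.clearjunk.induct) (auto simp: AList.delete_eq)
  then show ?thesis unfolding track_def by (force simp: AList.delete_eq)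
qed

lemma mem_track:
  assumes "n \<in> set (track T d)" and subset: "\<forall>n\<in>set d. snd n \<subseteq> fst n"
  shows "fst n \<noteq> {}" "snd n \<subseteq> fst n" "\<exists>n'\<in>set d. fst n \<subseteq> edges T `` fst n'"
proof -
  show "fst n \<noteq> {}" using fst_track[of T d] imageI[OF assms(1), of fst] by blast
  obtain n' where parent: "n' \<in> set d" "n = advance T n' \<or> n = (marked T n', {})"
    using set_track assms(1) by (fastforce simp: successors_def)
  then have "marked T n' \<subseteq> edges T `` fst n'" using subset by (intro marked_subset) blast
  then show "snd n \<subseteq> fst n" "\<exists>n'\<in>set d. fst n \<subseteq> edges T `` fst n'"
    using parent by (elim disjE; simp add: advance_def; blast)+
qed

lemma marked_mem_track:
  assumes "n \<in> set d" "marked T n \<noteq> {}" shows "marked T n \<in> fst ` set (track T d)"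
  using assms by (force simp: fst_track successors_def)

locale tracked_path =
  fixes T :: "nat \<Rightarrow> 'v flagged_graph" and d :: "nat \<Rightarrow> 'v tracking_state" and N :: nat
    and s :: "nat \<Rightarrow> 'v" and c :: "nat \<Rightarrow> bool"
  assumes d_Suc: "d (Suc t) = track (T t) (d t)"
    and length_d: "length (d t) \<le> N"
    and snd_subset_fst: "n \<in> set (d t) \<Longrightarrow> snd n \<subseteq> fst n"
    and path: "(s t, c t, s (Suc t)) \<in> T t"
    and infinitely_many_flags: "\<exists>\<^sub>\<infinity>t. c t"
    and start: "\<exists>n\<in>set (d 0). s 0 \<in> fst n"
begin

definition stable :: "nat \<Rightarrow> nat \<Rightarrow> bool" where
  "stable t j \<longleftrightarrow> j < length (d t) \<and>
      take (Suc j) (d (Suc t)) = map (advance (T t)) (take (Suc j) (d t))"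

definition permanent :: "nat \<Rightarrow> bool" where
  "permanent j \<longleftrightarrow> (\<forall>\<^sub>\<infinity>t. stable t j \<and> s t \<in> fst (d t ! j))"

lemma stable_nth: "stable t j \<Longrightarrow> d (Suc t) ! j = advance (T t) (d t ! j)"
  unfolding stable_def by (metis lessI length_take min_less_iff_conj nth_map nth_take)

lemma stable_mem: "stable t j \<Longrightarrow> d t ! j \<in> set (d t)"
  by (simp add: stable_def)

lemma path_Image: "s t \<in> A \<Longrightarrow> s (Suc t) \<in> edges (T t) `` A"
  using path[of t] by (auto simp: edges_def)

text \<open>A set of vertices met by the path is propagated forever, and its position can only decrease.\<close>

lemma thread_permanent:
  assumes X_start: "X t\<^sub>0 \<in> fst ` set (d t\<^sub>0)" "s t\<^sub>0 \<in> X t\<^sub>0"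
    and X_Suc: "\<And>t. t\<^sub>0 \<le> t \<Longrightarrow> X (Suc t) = edges (T t) `` X t"
  shows "\<exists>j. permanent j \<and> (\<forall>\<^sub>\<infinity>t. fst (d t ! j) = X t)"
proof -
  define located where "located t p \<longleftrightarrow> p < length (d t) \<and> fst (d t ! p) = X t" for t p
  have path_in_X: "s t \<in> X t" if "t\<^sub>0 \<le> t" for t
    using that by (induction t rule: dec_induct) (use X_start X_Suc path_Image in auto)
  have step: "\<exists>q\<le>p. located (Suc t) q \<and> (q = p \<longrightarrow> stable t p)" if "t\<^sub>0 \<le> t" "located t p" for t p
    using track_nth_position[of p "d t" "T t"] that path_in_X[of "Suc t"] X_Suc[of t]
    unfolding located_def stable_def d_Suc by auto
  have located_exists: "\<exists>p. located t p" if "t\<^sub>0 \<le> t" for t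
    using that
  proof (induction t rule: dec_induct)
    case base
    then show ?case using X_start(1) unfolding located_def by (metis imageE in_set_conv_nth)
  qed (use step in blast)
  define pos where "pos t = (LEAST p. located t p)" for t
  have located_pos: "located t (pos t)" if "t\<^sub>0 \<le> t" for t
    unfolding pos_def using located_exists[OF that] by (rule LeastI_ex)
  have pos_le: "pos t \<le> p" if "located t p" for t p unfolding pos_def using that by (rule Least_le)
  have "\<forall>\<^sub>\<infinity>t. pos (Suc t) \<le> pos t"
    unfolding MOST_nat_le using step located_pos pos_le by (meson order_trans)
  then obtain j where limit: "\<forall>\<^sub>\<infinity>t. pos t = j" using eventually_constant_if_decreasing by blast
  have "\<forall>\<^sub>\<infinity>t. stable t j \<and> s t \<in> fst (d t ! j) \<and> fst (d t ! j) = X t"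
    using limit MOST_SucI[OF limit] MOST_ge_nat[of t\<^sub>0]
  proof eventually_elim
    case (elim t)
    then obtain q where "q \<le> j" "located (Suc t) q" "q = j \<longrightarrow> stable t j"
      using step located_pos by blast
    moreover have "j \<le> q" using pos_le[OF \<open>located (Suc t) q\<close>] elim(2) by simp
    ultimately show ?case using located_pos[of t] path_in_X[of t] elim by (simp add: located_def)
  qed
  then show ?thesis unfolding permanent_def MOST_conj_distrib by blast
qed

lemma thread_exists: obtains X where "X t\<^sub>0 = A" "\<And>t. t\<^sub>0 \<le> t \<Longrightarrow> X (Suc t) = edges (T t) `` X t"
  by (rule that[of "\<lambda>t. rec_nat A (\<lambda>i B. edges (T (t\<^sub>0 + i)) `` B) (t - t\<^sub>0)"])
    (simp_all add: Suc_diff_le)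

lemma permanent_exists: "\<exists>j. permanent j"
proof -
  obtain n where initial: "n \<in> set (d 0)" "s 0 \<in> fst n" using start by blast
  obtain X where "X 0 = fst n" "\<And>t. 0 \<le> t \<Longrightarrow> X (Suc t) = edges (T t) `` X t"
    using thread_exists[of 0] by metis
  with initial show ?thesis using thread_permanent[of X 0] by auto
qed

lemma finite_permanent: "finite {j. permanent j}"
proof (rule finite_subset)
  show "{j. permanent j} \<subseteq> {..<N}"
  proof
    fix j assume "j \<in> {j. permanent j}"
    then obtain t where "stable t j" unfolding permanent_def MOST_nat_le by blast
    then show "j \<in> {..<N}" using length_d[of t] by (simp add: stable_def)
  qed
qed simp

lemma d_Suc_nth_if_not_flash:
  assumes "stable t q" "\<not> flash (T t) (d t ! q)"
  shows "d (Suc t) ! q = (edges (T t) `` fst (d t ! q), marked (T t) (d t ! q))"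
  using stable_nth assms by (simp add: advance_def)

lemma snd_psubset_fst_if_not_flash:
  assumes "stable t q" "\<not> flash (T t) (d t ! q)"
  shows "snd (d (Suc t) ! q) \<subset> fst (d (Suc t) ! q)"
proof -
  have "marked (T t) (d t ! q) \<subseteq> edges (T t) `` fst (d t ! q)"
    using snd_subset_fst[OF stable_mem[OF assms(1)]] by (rule marked_subset)
  then show ?thesis
    using d_Suc_nth_if_not_flash[OF assms] assms(2) by (simp add: flash_def psubset_eq)
qed

text \<open>If a permanent position stops flashing, the set spawned from it at a later flag has a
  permanent position as well, and it stays inside the marked part, which is a proper subset.\<close>

lemma smaller_permanent:
  assumes permanent_q: "permanent q" and no_flash: "\<not> (\<exists>\<^sub>\<infinity>t. flash (T t) (d t ! q))"
  shows "\<exists>q'. permanent q' \<and> (\<forall>\<^sub>\<infinity>t. fst (d t ! q') \<subset> fst (d t ! q))"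
proof -
  have "\<forall>\<^sub>\<infinity>t. stable t q \<and> s t \<in> fst (d t ! q) \<and> \<not> flash (T t) (d t ! q)"
    using permanent_q no_flash by (auto simp: permanent_def MOST_conj_distrib)
  then obtain t\<^sub>1 where settled: "stable t q" "s t \<in> fst (d t ! q)"
    "\<not> flash (T t) (d t ! q)" if "t\<^sub>1 \<le> t" for t
    unfolding MOST_nat_le by blast
  have d_Suc_q: "d (Suc t) ! q = (edges (T t) `` fst (d t ! q), marked (T t) (d t ! q))"
    if "t\<^sub>1 \<le> t" for t
    using settled(1,3)[OF that] by (rule d_Suc_nth_if_not_flash)
  obtain t\<^sub>2 where later_flag: "t\<^sub>1 \<le> t\<^sub>2" "c t\<^sub>2"
    using infinitely_many_flags unfolding INFM_nat_le by blast
  have spawned: "s (Suc t\<^sub>2) \<in> marked (T t\<^sub>2) (d t\<^sub>2 ! q)"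
    using path[of t\<^sub>2] later_flag settled(2)[OF later_flag(1)]
    by (auto simp: marked_def flagged_edges_def)
  obtain X where thread: "X (Suc t\<^sub>2) = marked (T t\<^sub>2) (d t\<^sub>2 ! q)"
    "\<And>t. Suc t\<^sub>2 \<le> t \<Longrightarrow> X (Suc t) = edges (T t) `` X t"
    using thread_exists[of "Suc t\<^sub>2"] by metis
  have "X (Suc t\<^sub>2) \<in> fst ` set (d (Suc t\<^sub>2))"
    unfolding d_Suc thread(1)
    by (rule marked_mem_track) (use stable_mem settled(1)[OF later_flag(1)] spawned in auto)
  then obtain q' where follows_thread: "permanent q'" "\<forall>\<^sub>\<infinity>t. fst (d t ! q') = X t"
    using thread_permanent[of X "Suc t\<^sub>2"] spawned thread by metis
  have X_subset: "X t \<subseteq> snd (d t ! q)" if "Suc t\<^sub>2 \<le> t" for t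
    using that
  proof (induction t rule: dec_induct)
    case (step t)
    then show ?case using d_Suc_q[of t] later_flag thread(2)[of t] by (auto simp: marked_def)
  qed (use d_Suc_q[OF later_flag(1)] thread(1) in simp)
  have snd_psubset: "snd (d t ! q) \<subset> fst (d t ! q)" if "Suc t\<^sub>1 \<le> t" for t
    using snd_psubset_fst_if_not_flash[OF settled(1,3), of "t - 1"] that by (cases t) auto
  have "\<forall>\<^sub>\<infinity>t. fst (d t ! q') \<subset> fst (d t ! q)"
    using follows_thread(2) MOST_ge_nat[of "Suc t\<^sub>2"] MOST_ge_nat[of "Suc t\<^sub>1"]
    by eventually_elim (use X_subset snd_psubset in blast)
  with follows_thread(1) show ?thesis by blast
qed

theorem infinitely_many_flashes: "\<exists>j. (\<forall>\<^sub>\<infinity>t. stable t j) \<and> (\<exists>\<^sub>\<infinity>t. flash (T t) (d t ! j))"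
proof (rule ccontr)
  assume no_flashes: "\<not> ?thesis"
  define R where "R = {(q', q). permanent q' \<and> permanent q \<and> (\<forall>\<^sub>\<infinity>t. fst (d t ! q') \<subset> fst (d t ! q))}"
  have "trans R"
  proof (rule transI)
    fix q\<^sub>1 q\<^sub>2 q\<^sub>3 assume in_R: "(q\<^sub>1, q\<^sub>2) \<in> R" "(q\<^sub>2, q\<^sub>3) \<in> R"
    then have "\<forall>\<^sub>\<infinity>t. fst (d t ! q\<^sub>1) \<subset> fst (d t ! q\<^sub>2)" "\<forall>\<^sub>\<infinity>t. fst (d t ! q\<^sub>2) \<subset> fst (d t ! q\<^sub>3)"
      by (simp_all add: R_def)
    then have "\<forall>\<^sub>\<infinity>t. fst (d t ! q\<^sub>1) \<subset> fst (d t ! q\<^sub>3)" by eventually_elim (rule psubset_trans)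
    with in_R show "(q\<^sub>1, q\<^sub>3) \<in> R" by (simp add: R_def)
  qed
  moreover have "irrefl R" by (simp add: R_def irrefl_def)
  ultimately have "acyclic R" by (simp add: acyclic_irrefl trancl_id)
  moreover have "finite R"
    by (rule finite_subset[OF _ finite_cartesian_product[OF finite_permanent finite_permanent]])
      (simp add: R_def subset_iff)
  ultimately have "wf R" by (intro finite_acyclic_wf)
  obtain j where "permanent j" using permanent_exists by blast
  then have "j \<in> {j. permanent j}" by simp
  with \<open>wf R\<close> obtain q where minimal: "q \<in> {j. permanent j}"
    "\<And>q'. (q', q) \<in> R \<Longrightarrow> q' \<notin> {j. permanent j}"
    by (rule wfE_min) (rule that)
  then have "\<forall>\<^sub>\<infinity>t. stable t q" by (simp add: permanent_def MOST_conj_distrib)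
  then have "\<not> (\<exists>\<^sub>\<infinity>t. flash (T t) (d t ! q))" using no_flashes by blast
  then obtain q' where "permanent q'" "\<forall>\<^sub>\<infinity>t. fst (d t ! q') \<subset> fst (d t ! q)"
    using smaller_permanent minimal(1) by blast
  then have "(q', q) \<in> R" "q' \<in> {j. permanent j}" using minimal(1) by (simp_all add: R_def)
  then show False using minimal(2) by blast
qed

end

section \<open>Finite-memory strategies\<close>

text \<open>In each round Player I picks \<open>x\<close>, Player II answers with \<open>y\<close>, and a path then follows an edge
  of \<open>letter x y\<close>; before that it may follow any number of \<open>silent\<close> edges, which neither player
  sees. Player II has to prevent the paths with infinitely many flags.\<close>

locale flagged_game =
  fixes Q :: "'q set" and silent :: "('q \<times> 'q) set" and letter :: "'x \<Rightarrow> 'y \<Rightarrow> 'q flagged_graph"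
    and initial :: "'q set" and Xs :: "'x set" and Ys :: "'y set"
  assumes finite_Q: "finite Q"
    and silent_Q: "silent \<subseteq> Q \<times> Q"
    and letter_Q: "letter x y \<subseteq> Q \<times> UNIV \<times> Q"
    and initial_Q: "initial \<subseteq> Q"
begin

definition strategy :: "'l set \<Rightarrow> 'l \<Rightarrow> ('l \<Rightarrow> 'x \<Rightarrow> 'l \<times> 'y) \<Rightarrow> bool" where
  "strategy L l\<^sub>0 \<delta> \<longleftrightarrow> finite L \<and> l\<^sub>0 \<in> L \<and> (\<forall>l\<in>L. \<forall>x\<in>Xs. \<delta> l x \<in> L \<times> Ys)"

definition strategy_graph :: "'l set \<Rightarrow> ('l \<Rightarrow> 'x \<Rightarrow> 'l \<times> 'y) \<Rightarrow> ('l \<times> 'q) flagged_graph" where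
  "strategy_graph L \<delta> = {((l, s), c, (l', s')). l \<in> L \<and>
    (\<not> c \<and> l' = l \<and> (s, s') \<in> silent \<or> (\<exists>x\<in>Xs. \<exists>y. \<delta> l x = (l', y) \<and> (s, c, s') \<in> letter x y))}"

definition winning :: "'l set \<Rightarrow> 'l \<Rightarrow> ('l \<Rightarrow> 'x \<Rightarrow> 'l \<times> 'y) \<Rightarrow> bool" where
  "winning L l\<^sub>0 \<delta> \<longleftrightarrow> strategy L l\<^sub>0 \<delta> \<and> finitely_flagged (strategy_graph L \<delta>) ({l\<^sub>0} \<times> initial)"

definition moves :: "'x \<Rightarrow> 'y \<Rightarrow> 'q flagged_graph" where
  "moves x y = {(s, c, s'). \<exists>s\<^sub>1. (s, s\<^sub>1) \<in> silent\<^sup>* \<and> (s\<^sub>1, c, s') \<in> letter x y}"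

definition move_graph :: "'l set \<Rightarrow> ('l \<Rightarrow> 'x \<Rightarrow> 'l \<times> 'y) \<Rightarrow> ('l \<times> 'q) flagged_graph" where
  "move_graph L \<delta> =
    {((l, s), c, (l', s')). l \<in> L \<and> (\<exists>x\<in>Xs. \<exists>y. \<delta> l x = (l', y) \<and> (s, c, s') \<in> moves x y)}"

lemma moves_Q: "moves x y \<subseteq> Q \<times> UNIV \<times> Q"
proof -
  have "s \<in> Q" if "(s, s\<^sub>1) \<in> silent\<^sup>*" "s\<^sub>1 \<in> Q" for s s\<^sub>1
    using that silent_Q by (induction rule: converse_rtrancl_induct) auto
  then show ?thesis using letter_Q by (fastforce simp: moves_def)
qed

lemma strategy_graph_subset: "strategy L l\<^sub>0 \<delta> \<Longrightarrow> strategy_graph L \<delta> \<subseteq> (L \<times> Q) \<times> UNIV \<times> (L \<times> Q)"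
  using silent_Q letter_Q unfolding strategy_graph_def strategy_def by fastforce

lemma move_graph_subset: "strategy L l\<^sub>0 \<delta> \<Longrightarrow> move_graph L \<delta> \<subseteq> (L \<times> Q) \<times> UNIV \<times> (L \<times> Q)"
  using moves_Q unfolding move_graph_def strategy_def by fastforce

lemma ranking_moves:
  assumes ranking: "ranking (strategy_graph L \<delta>) b" and mem: "l \<in> L" "x \<in> Xs"
    and move: "(s, c, s') \<in> moves x (snd (\<delta> l x))"
  shows "b (fst (\<delta> l x), s') + of_bool c \<le> b (l, s)"
proof -
  obtain s\<^sub>1 where silent_then_letter: "(s, s\<^sub>1) \<in> silent\<^sup>*" "(s\<^sub>1, c, s') \<in> letter x (snd (\<delta> l x))"
    using move by (auto simp: moves_def)
  have "((l, s\<^sub>1), c, (fst (\<delta> l x), s')) \<in> strategy_graph L \<delta>"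
    using mem silent_then_letter(2)
    by (auto simp: strategy_graph_def intro!: bexI[of _ x] exI[of _ "snd (\<delta> l x)"])
  then have "b (fst (\<delta> l x), s') + of_bool c \<le> b (l, s\<^sub>1)" by (rule rankingD[OF ranking])
  also have "b (l, s\<^sub>1) \<le> b (l, s)"
    using silent_then_letter(1)
  proof (induction rule: rtrancl_induct)
    case (step s\<^sub>2 s\<^sub>3)
    then have "((l, s\<^sub>2), False, (l, s\<^sub>3)) \<in> strategy_graph L \<delta>"
      using mem(1) by (simp add: strategy_graph_def)
    from rankingD[OF ranking this] show ?case using step.IH by simp
  qed simp
  finally show ?thesis .
qed

lemma winning_reindex:
  assumes "winning L l\<^sub>0 \<delta>" and reindex: "\<And>x. x \<in> Xs \<Longrightarrow> r x \<in> Xs \<and> letter (r x) = letter x"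
  shows "winning L l\<^sub>0 (\<lambda>l x. \<delta> l (r x))"
proof -
  have "\<exists>x\<in>Xs. \<exists>y. \<delta> l x = (l', y) \<and> (s, c, s') \<in> letter x y"
    if "x \<in> Xs" "\<delta> l (r x) = (l', y)" "(s, c, s') \<in> letter x y" for l l' s s' c x y
    using reindex[OF that(1)] that(2,3) by (intro bexI[of _ "r x"] exI[of _ y]) simp_all
  then have "strategy_graph L (\<lambda>l x. \<delta> l (r x)) \<subseteq> strategy_graph L \<delta>"
    by (auto simp: strategy_graph_def)
  then have "finitely_flagged (strategy_graph L (\<lambda>l x. \<delta> l (r x))) ({l\<^sub>0} \<times> initial)"
    using assms(1) finitely_flagged_subset unfolding winning_def by blast
  then show ?thesis using assms(1) reindex by (simp add: winning_def strategy_def)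
qed

end

subsection \<open>Bounding the memory\<close>

lemma list_le_if_list_all2: "list_all2 (\<le>) xs ys \<Longrightarrow> xs \<le> (ys :: 'a :: linorder list)"
  by (induction rule: list_all2_induct) (auto simp: Cons_le_Cons list_all2_lengthD less_le)

lemma take_le_take_if_le:
  "length xs = length ys \<Longrightarrow> xs \<le> ys \<Longrightarrow> take p xs \<le> take p (ys :: 'a :: linorder list)"
proof (induction xs ys arbitrary: p rule: list_induct2)
  case (Cons x xs y ys)
  then show ?case by (cases p) (auto simp: Cons_le_Cons)
qed simp

lemma SUP_add_le_enat:
  fixes h :: "'a \<Rightarrow> enat"
  assumes "A \<noteq> {}" and bound: "\<And>x. x \<in> A \<Longrightarrow> h x + c \<le> w"
  shows "(SUP x\<in>A. h x) + c \<le> w"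
proof (cases w)
  case (enat k)
  obtain x where "x \<in> A" using assms(1) by blast
  then obtain j where c_eq: "c = enat j" "j \<le> k"
    using bound[of x] enat by (cases "h x"; cases c) auto
  have "h x \<le> enat (k - j)" if "x \<in> A" for x
    using bound[OF that] enat c_eq by (cases "h x") auto
  then have "(SUP x\<in>A. h x) \<le> enat (k - j)" by (rule SUP_least)
  then show ?thesis using enat c_eq by (cases "SUP x\<in>A. h x") auto
qed simp

lemma INF_le_or_infinity:
  fixes h :: "'a \<Rightarrow> enat"
  assumes "\<And>z. h z \<le> w \<or> h z = \<infinity>"
  shows "(INF z\<in>A. h z) \<le> w \<or> (INF z\<in>A. h z) = \<infinity>"
proof (cases "\<exists>z\<in>A. h z \<noteq> \<infinity>")
  case True
  then show ?thesis using assms by (metis INF_lower2)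
qed (auto simp: top_enat_def[symmetric])

definition weight :: "('q \<Rightarrow> enat) \<Rightarrow> 'q set \<times> 'q set \<Rightarrow> enat" where
  "weight f n = (SUP s\<in>fst n. f s + of_bool (s \<in> snd n))"

lemma marked_value_le_weight:
  assumes successor: "s' \<in> edges T `` fst n" and subset: "snd n \<subseteq> fst n"
    and mono: "\<And>s c s'. s \<in> fst n \<Longrightarrow> (s, c, s') \<in> T \<Longrightarrow> g s' + of_bool c \<le> f s"
  shows "g s' + of_bool (s' \<in> marked T n) \<le> weight f n"
proof -
  have weight_ge: "f s + of_bool (s \<in> snd n) \<le> weight f n" if "s \<in> fst n" for s
    unfolding weight_def using that by (rule SUP_upper)
  have value_le: "f s \<le> weight f n" if "s \<in> fst n" for s
    using weight_ge[OF that] by (rule order_trans[rotated]) simp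
  obtain s c where predecessor: "s \<in> fst n" "(s, c, s') \<in> T"
    using successor by (auto simp: edges_def)
  consider (carried) u where "u \<in> snd n" "(u, s') \<in> edges T"
    | (flagged) u where "u \<in> fst n" "(u, s') \<in> flagged_edges T"
    | (unmarked) "s' \<notin> marked T n" by (auto simp: marked_def)
  then show ?thesis
  proof cases
    case (carried u)
    then obtain c where "(u, c, s') \<in> T" by (auto simp: edges_def)
    then have "g s' + of_bool c \<le> f u" using mono carried subset by blast
    then have "g s' \<le> f u" by (rule order_trans[rotated]) simp
    then have "g s' + of_bool (s' \<in> marked T n) \<le> f u + of_bool (u \<in> snd n)"
      using carried by (intro add_mono) auto
    also have "\<dots> \<le> weight f n" using weight_ge carried subset by blast
    finally show ?thesis .
  next
    case (flagged u)
    then have "g s' + of_bool (s' \<in> marked T n) \<le> g s' + of_bool True" by (intro add_left_mono) simp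
    also have "\<dots> \<le> f u" using mono[of u True s'] flagged by (simp add: flagged_edges_def)
    also have "\<dots> \<le> weight f n" using flagged(1) by (rule value_le)
    finally show ?thesis .
  next
    case unmarked
    then have "g s' + of_bool (s' \<in> marked T n) \<le> g s' + of_bool c" by simp
    also have "\<dots> \<le> f s" by (rule mono[OF predecessor])
    also have "\<dots> \<le> weight f n" using predecessor(1) by (rule value_le)
    finally show ?thesis .
  qed
qed

lemma weight_advance:
  assumes nonempty: "edges T `` fst n \<noteq> {}" and subset: "snd n \<subseteq> fst n"
    and mono: "\<And>s c s'. s \<in> fst n \<Longrightarrow> (s, c, s') \<in> T \<Longrightarrow> g s' + of_bool c \<le> f s"
  shows "weight g (advance T n) + of_bool (flash T n) \<le> weight f n"
proof -
  have "g s' + of_bool (s' \<in> snd (advance T n)) + of_bool (flash T n) \<le> weight f n"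
    if "s' \<in> edges T `` fst n" for s'
    using marked_value_le_weight[OF that subset mono] that
    by (cases "flash T n") (auto simp: advance_def flash_def)
  then show ?thesis
    unfolding weight_def[of g] using nonempty by (intro SUP_add_le_enat) (simp_all add: advance_def)
qed

lemma card_lists_length_le_power:
  assumes "finite A"
  shows "card {xs. set xs \<subseteq> A \<and> length xs \<le> N} \<le> (card A + 1) ^ N"
proof -
  have "(\<Sum>i\<le>N. card A ^ i) \<le> (\<Sum>i\<le>N. (N choose i) * card A ^ i)"
    by (intro sum_mono) (auto simp: Suc_leI zero_less_binomial_iff)
  also have "\<dots> = (card A + 1) ^ N" using binomial[of "card A" 1 N] by simp
  finally show ?thesis using card_lists_length_le[OF assms] by simp
qed

text \<open>\<open>(4 ^ n + 1) ^ 2 ^ n\<close> bounds the number of tracking states over \<open>n\<close> vertices.\<close>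

definition memory_bound :: "nat \<Rightarrow> nat" where
  "memory_bound n = (4 ^ n + 1) ^ (2 ^ n)"

text \<open>The memory of the new strategy is the tracking state \<open>d\<close> itself. It moves like the given
  strategy in the memory state, among those that can occur together with \<open>d\<close>, whose list of
  weights is lexicographically minimal. On a stable position and all older ones the weights never
  increase, and they drop whenever that position flashes.\<close>

locale ranked_strategy = flagged_game Q silent letter initial Xs Ys
  for Q :: "'q set" and silent and letter :: "'x \<Rightarrow> 'y \<Rightarrow> 'q flagged_graph" and initial Xs Ys +
  fixes L :: "'l set" and l\<^sub>0 :: 'l and \<delta> :: "'l \<Rightarrow> 'x \<Rightarrow> 'l \<times> 'y"
    and b :: "'l \<Rightarrow> 'q \<Rightarrow> enat" and K :: nat
  assumes strategy: "strategy L l\<^sub>0 \<delta>"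
    and rank_step: "\<And>l x s c s'. l \<in> L \<Longrightarrow> x \<in> Xs \<Longrightarrow> (s, c, s') \<in> moves x (snd (\<delta> l x)) \<Longrightarrow>
      b (fst (\<delta> l x)) s' + of_bool c \<le> b l s"
    and rank_initial: "\<And>s. s \<in> initial \<Longrightarrow> b l\<^sub>0 s \<le> enat K"
begin

definition initial_tracking :: "'q tracking_state" where
  "initial_tracking = AList.delete {} [(initial, {})]"

inductive_set joint :: "('q tracking_state \<times> 'l) set" where
  start: "(initial_tracking, l\<^sub>0) \<in> joint"
| step: "(d, l) \<in> joint \<Longrightarrow> x \<in> Xs \<Longrightarrow> (track (moves x (snd (\<delta> l x))) d, fst (\<delta> l x)) \<in> joint"

definition tracking_states :: "'q tracking_state set" where
  "tracking_states = fst ` joint"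

definition signature :: "'l \<Rightarrow> 'q tracking_state \<Rightarrow> enat list" where
  "signature l d = map (weight (b l)) d"

definition best :: "'q tracking_state \<Rightarrow> 'l" where
  "best d = (SOME l. (d, l) \<in> joint \<and> (\<forall>l'. (d, l') \<in> joint \<longrightarrow> signature l d \<le> signature l' d))"

definition best_move :: "'q tracking_state \<Rightarrow> 'x \<Rightarrow> 'q tracking_state \<times> 'y" where
  "best_move d x = (track (moves x (snd (\<delta> (best d) x))) d, snd (\<delta> (best d) x))"

lemma delta_mem: "l \<in> L \<Longrightarrow> x \<in> Xs \<Longrightarrow> fst (\<delta> l x) \<in> L \<and> snd (\<delta> l x) \<in> Ys"
  using strategy by (auto simp: strategy_def mem_Times_iff)

lemma joint_memory: "(d, l) \<in> joint \<Longrightarrow> l \<in> L"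
  by (induction rule: joint.induct) (use strategy delta_mem in \<open>auto simp: strategy_def\<close>)

lemma joint_distinct: "(d, l) \<in> joint \<Longrightarrow> distinct (map fst d)"
  by (induction rule: joint.induct) (simp_all add: initial_tracking_def distinct_track)

lemma joint_mem:
  "(d, l) \<in> joint \<Longrightarrow> n \<in> set d \<Longrightarrow>
    fst n \<noteq> {} \<and> snd n \<subseteq> fst n \<and> fst n \<subseteq> Q \<and> (\<forall>s\<in>fst n. b l s \<le> enat K)"
proof (induction arbitrary: n rule: joint.induct)
  case start
  then show ?case using rank_initial initial_Q by (auto simp: initial_tracking_def split: if_splits)
next
  case (step d l x)
  let ?T = "moves x (snd (\<delta> l x))"
  have subset: "\<forall>n\<in>set d. snd n \<subseteq> fst n" using step.IH by blast
  obtain n' where parent: "n' \<in> set d" "fst n \<subseteq> edges ?T `` fst n'"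
    using mem_track(3)[OF step.prems subset] by blast
  have "s' \<in> Q \<and> b (fst (\<delta> l x)) s' \<le> enat K" if mem_n: "s' \<in> fst n" for s'
  proof -
    obtain s c where predecessor: "s \<in> fst n'" "(s, c, s') \<in> ?T"
      using parent(2) mem_n by (auto simp: edges_def)
    have "b (fst (\<delta> l x)) s' \<le> b (fst (\<delta> l x)) s' + of_bool c" by simp
    also have "\<dots> \<le> b l s"
      using joint_memory[OF step.hyps(1)] step.hyps(2) predecessor(2) by (rule rank_step)
    also have "\<dots> \<le> enat K" using step.IH[OF parent(1)] predecessor(1) by blast
    finally show ?thesis using moves_Q predecessor(2) by blast
  qed
  then show ?case using mem_track(1,2)[OF step.prems subset] by blast
qed

lemma tracking_states_subset:
  "tracking_states \<subseteq> {d. set d \<subseteq> Pow Q \<times> Pow Q \<and> length d \<le> 2 ^ card Q}"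
proof
  fix d assume "d \<in> tracking_states"
  then obtain l where joint: "(d, l) \<in> joint" by (auto simp: tracking_states_def)
  have mem: "set d \<subseteq> Pow Q \<times> Pow Q"
  proof
    fix n assume "n \<in> set d"
    then show "n \<in> Pow Q \<times> Pow Q" using joint_mem[OF joint, of n] by (simp add: mem_Times_iff) blast
  qed
  have "length d = card (fst ` set d)" using distinct_card[OF joint_distinct[OF joint]] by simp
  also have "\<dots> \<le> card (Pow Q)" using mem finite_Q by (intro card_mono) fastforce+
  finally show "d \<in> {d. set d \<subseteq> Pow Q \<times> Pow Q \<and> length d \<le> 2 ^ card Q}"
    using mem by (simp add: card_Pow[OF finite_Q])
qed

lemma finite_tracking_states: "finite tracking_states"
  by (rule finite_subset[OF tracking_states_subset finite_lists_length_le]) (simp add: finite_Q)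

lemma card_tracking_states: "card tracking_states \<le> memory_bound (card Q)"
proof -
  have finite_pairs: "finite (Pow Q \<times> Pow Q)" using finite_Q by simp
  have "card tracking_states \<le> (card (Pow Q \<times> Pow Q) + 1) ^ (2 ^ card Q)"
    using card_mono[OF finite_lists_length_le[OF finite_pairs] tracking_states_subset]
      card_lists_length_le_power[OF finite_pairs] by (rule order_trans)
  also have "card (Pow Q \<times> Pow Q) = 4 ^ card Q"
    by (simp add: card_cartesian_product card_Pow[OF finite_Q] power_mult_distrib[symmetric])
  finally show ?thesis by (simp add: memory_bound_def)
qed

lemma joint_best:
  assumes "d \<in> tracking_states"
  shows "(d, best d) \<in> joint" "(d, l') \<in> joint \<Longrightarrow> signature (best d) d \<le> signature l' d"
proof -
  define a where "a = (LEAST a. \<exists>l. (d, l) \<in> joint \<and> signature l d = a)"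
  have "\<exists>l. (d, l) \<in> joint \<and> signature l d = a"
    unfolding a_def by (rule LeastI_ex) (use assms in \<open>auto simp: tracking_states_def\<close>)
  moreover have "a \<le> signature l' d" if "(d, l') \<in> joint" for l'
    unfolding a_def by (rule Least_le) (use that in blast)
  ultimately have "\<exists>l. (d, l) \<in> joint \<and> (\<forall>l'. (d, l') \<in> joint \<longrightarrow> signature l d \<le> signature l' d)"
    by blast
  from someI_ex[OF this] show "(d, best d) \<in> joint"
    "(d, l') \<in> joint \<Longrightarrow> signature (best d) d \<le> signature l' d"
    unfolding best_def by blast+
qed

lemma joint_best_move:
  "d \<in> tracking_states \<Longrightarrow> x \<in> Xs \<Longrightarrow> (fst (best_move d x), fst (\<delta> (best d) x)) \<in> joint"
  using joint.step joint_best(1) by (simp add: best_move_def)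

lemma strategy_best_move: "strategy tracking_states initial_tracking best_move"
  unfolding strategy_def
proof (intro conjI ballI)
  show "finite tracking_states" by (rule finite_tracking_states)
  show "initial_tracking \<in> tracking_states" using joint.start unfolding tracking_states_def by force
  fix d x assume dx_mem: "d \<in> tracking_states" "x \<in> Xs"
  have "snd (best_move d x) \<in> Ys"
    using delta_mem[OF joint_memory[OF joint_best(1)[OF dx_mem(1)]] dx_mem(2)]
    by (simp add: best_move_def)
  moreover have "fst (best_move d x) \<in> tracking_states"
    using joint_best_move[OF dx_mem] unfolding tracking_states_def by force
  ultimately show "best_move d x \<in> tracking_states \<times> Ys" by (simp add: mem_Times_iff)
qed

lemma weight_ne_infinity:
  assumes "(d, l) \<in> joint" "n \<in> set d"
  shows "weight (b l) n \<noteq> \<infinity>"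
proof -
  have "b l s + of_bool (s \<in> snd n) \<le> enat (Suc K)" if "s \<in> fst n" for s
  proof -
    have "b l s \<le> enat K" using joint_mem[OF assms] that by blast
    then have "b l s + of_bool (s \<in> snd n) \<le> enat K + 1" by (intro add_mono) auto
    then show ?thesis by (simp add: one_enat_def)
  qed
  then have "weight (b l) n \<le> enat (Suc K)" unfolding weight_def by (rule SUP_least)
  then show ?thesis by (metis infinity_ileE)
qed

lemma weight_step:
  assumes joint: "(d, l) \<in> joint" and x_mem: "x \<in> Xs" and T_eq: "T = moves x (snd (\<delta> l x))"
    and n_mem: "n \<in> set d" and kept: "advance T n \<in> set (track T d)"
  shows "weight (b (fst (\<delta> l x))) (advance T n) + of_bool (flash T n) \<le> weight (b l) n"
proof (rule weight_advance)
  show "snd n \<subseteq> fst n" using joint_mem[OF joint n_mem] by blast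
  have "(track T d, fst (\<delta> l x)) \<in> joint" using joint.step[OF joint x_mem] by (simp add: T_eq)
  from joint_mem[OF this kept] show "edges T `` fst n \<noteq> {}" by (simp add: advance_def)
  show "b (fst (\<delta> l x)) s' + of_bool c \<le> b l s" if "(s, c, s') \<in> T" for s c s'
    using joint_memory[OF joint] x_mem that[unfolded T_eq] by (rule rank_step)
qed

lemma signature_step:
  assumes joint: "(d, l) \<in> joint" and x_mem: "x \<in> Xs" and T_eq: "T = moves x (snd (\<delta> l x))"
    and j_less: "j < length d"
    and stable: "take (Suc j) (track T d) = map (advance T) (take (Suc j) d)"
  defines "l' \<equiv> fst (\<delta> l x)"
  shows "take (Suc j) (signature l' (track T d)) \<le> take (Suc j) (signature l d)"
    and "flash T (d ! j) \<Longrightarrow> take (Suc j) (signature l' (track T d)) \<noteq> take (Suc j) (signature l d)"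
proof -
  have after: "take (Suc j) (signature l' (track T d)) =
      map (\<lambda>n. weight (b l') (advance T n)) (take (Suc j) d)"
    by (simp add: signature_def take_map[symmetric] stable comp_def)
      (simp add: take_map stable comp_def)
  have before: "take (Suc j) (signature l d) = map (weight (b l)) (take (Suc j) d)"
    by (simp add: signature_def take_map)
  have step: "weight (b l') (advance T n) + of_bool (flash T n) \<le> weight (b l) n"
    if "n \<in> set (take (Suc j) d)" for n
  proof -
    have "advance T n \<in> set (take (Suc j) (track T d))" unfolding stable using that by simp
    from weight_step[OF joint x_mem T_eq in_set_takeD[OF that] in_set_takeD[OF this]]
    show ?thesis unfolding l'_def .
  qed
  have "weight (b l') (advance T n) \<le> weight (b l) n" if "n \<in> set (take (Suc j) d)" for n
    using step[OF that] by (rule order_trans[rotated]) simp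
  then show "take (Suc j) (signature l' (track T d)) \<le> take (Suc j) (signature l d)"
    unfolding after before
    by (intro list_le_if_list_all2) (simp add: list.rel_map list.rel_refl_strong)
  have j_mem: "d ! j \<in> set (take (Suc j) d)" using j_less by (auto simp: in_set_conv_nth)
  have "weight (b l) (d ! j) \<noteq> \<infinity>" by (rule weight_ne_infinity[OF joint nth_mem[OF j_less]])
  then have "weight (b l') (advance T (d ! j)) \<noteq> weight (b l) (d ! j)" if "flash T (d ! j)"
    using step[OF j_mem] that by (cases "weight (b l) (d ! j)") (auto simp: one_enat_def)
  then show "flash T (d ! j) \<Longrightarrow>
      take (Suc j) (signature l' (track T d)) \<noteq> take (Suc j) (signature l d)"
    unfolding after before using j_mem by auto
qed

lemma signature_best_step:
  assumes d_mem: "d \<in> tracking_states" and x_mem: "x \<in> Xs"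
    and T_eq: "T = moves x (snd (best_move d x))"
    and j_less: "j < length d"
    and stable: "take (Suc j) (track T d) = map (advance T) (take (Suc j) d)"
  defines "a \<equiv> take (Suc j) (signature (best d) d)"
    and "a' \<equiv> take (Suc j) (signature (best (track T d)) (track T d))"
  shows "a' \<le> a" "flash T (d ! j) \<Longrightarrow> a' \<noteq> a"
proof -
  have T_eq_best: "T = moves x (snd (\<delta> (best d) x))" by (simp add: T_eq best_move_def)
  have "(track T d, fst (\<delta> (best d) x)) \<in> joint"
    using joint_best_move[OF d_mem x_mem] by (simp add: best_move_def T_eq)
  moreover from this have "track T d \<in> tracking_states" unfolding tracking_states_def by force
  ultimately have "signature (best (track T d)) (track T d) \<le>
      signature (fst (\<delta> (best d) x)) (track T d)"
    using joint_best(2) by blast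
  then have "a' \<le> take (Suc j) (signature (fst (\<delta> (best d) x)) (track T d))"
    unfolding a'_def by (intro take_le_take_if_le) (simp_all add: signature_def)
  moreover note signature_step[OF joint_best(1)[OF d_mem] x_mem T_eq_best j_less stable]
  ultimately show "a' \<le> a" "flash T (d ! j) \<Longrightarrow> a' \<noteq> a" unfolding a_def by auto
qed

lemma finitely_flagged_best_move:
  "finitely_flagged (move_graph tracking_states best_move) ({initial_tracking} \<times> initial)"
  unfolding finitely_flagged_def
proof (intro allI impI notI)
  fix f c assume start: "f 0 \<in> {initial_tracking} \<times> initial" and infinitely_many: "\<exists>\<^sub>\<infinity>i. c i"
    and path: "\<forall>i. (f i, c i, f (Suc i)) \<in> move_graph tracking_states best_move"
  define d s where "d i = fst (f i)" and "s i = snd (f i)" for i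
  have "\<exists>x\<in>Xs. d i \<in> tracking_states \<and> d (Suc i) = fst (best_move (d i) x) \<and>
      (s i, c i, s (Suc i)) \<in> moves x (snd (best_move (d i) x))" for i
    using path[rule_format, of i] by (force simp: move_graph_def d_def s_def)
  then obtain x where x_mem: "\<And>i. x i \<in> Xs" and d_mem: "\<And>i. d i \<in> tracking_states"
    and d_Suc: "\<And>i. d (Suc i) = fst (best_move (d i) (x i))"
    and s_Suc: "\<And>i. (s i, c i, s (Suc i)) \<in> moves (x i) (snd (best_move (d i) (x i)))" by metis
  define T where "T i = moves (x i) (snd (best_move (d i) (x i)))" for i
  have track: "d (Suc t) = track (T t) (d t)" for t by (simp add: d_Suc T_def best_move_def)
  interpret tracked_path T d "2 ^ card Q" s c
  proof
    show "d (Suc t) = track (T t) (d t)" for t by (rule track)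
    show "length (d t) \<le> 2 ^ card Q" for t using d_mem[of t] tracking_states_subset by blast
    show "snd n \<subseteq> fst n" if "n \<in> set (d t)" for n t
      using joint_mem[OF joint_best(1)[OF d_mem]] that by blast
    show "(s t, c t, s (Suc t)) \<in> T t" for t using s_Suc by (simp add: T_def)
    show "\<exists>n\<in>set (d 0). s 0 \<in> fst n" using start by (auto simp: d_def s_def initial_tracking_def)
  qed (rule infinitely_many)
  obtain j where stable: "\<forall>\<^sub>\<infinity>t. stable t j" and flashes: "\<exists>\<^sub>\<infinity>t. flash (T t) (d t ! j)"
    using infinitely_many_flashes by blast
  define a where "a t = take (Suc j) (signature (best (d t)) (d t))" for t
  have step: "a (Suc t) \<le> a t" "flash (T t) (d t ! j) \<Longrightarrow> a (Suc t) \<noteq> a t" if "stable t j" for t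
    using signature_best_step[OF d_mem[of t] x_mem[of t] T_def[of t], of j] that
    unfolding a_def stable_def track by blast+
  have "\<forall>\<^sub>\<infinity>t. a (Suc t) \<le> a t" using stable by eventually_elim (rule step)
  then obtain k where limit: "\<forall>\<^sub>\<infinity>t. a t = k" using eventually_constant_if_decreasing by blast
  have "\<not> (\<exists>\<^sub>\<infinity>t. flash (T t) (d t ! j))"
    unfolding not_INFM using stable limit MOST_SucI[OF limit] by eventually_elim (use step in auto)
  then show False using flashes by contradiction
qed

end

subsection \<open>Budget families\<close>

text \<open>A budget bounds the number of flags that can still be met from each vertex; \<open>\<infinity>\<close> means that
  the vertex need not be considered. Player II wins by moving within a family of budgets.\<close>

context flagged_game
begin

definition budget_family :: "('q \<Rightarrow> enat) set \<Rightarrow> bool" where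
  "budget_family W \<longleftrightarrow>
    (\<exists>\<beta>\<in>W. \<forall>s\<in>initial. \<beta> s \<noteq> \<infinity>) \<and>
    (\<forall>\<beta>\<in>W. \<forall>(s, s')\<in>silent. \<beta> s' \<le> \<beta> s) \<and>
    (\<forall>\<beta>\<in>W. \<forall>x\<in>Xs. \<exists>y\<in>Ys. \<exists>\<beta>'\<in>W. \<forall>(s, c, s')\<in>letter x y. \<beta>' s' + of_bool c \<le> \<beta> s)"

definition small_family :: "('q \<Rightarrow> enat) set \<Rightarrow> bool" where
  "small_family W \<longleftrightarrow> finite W \<and> card W \<le> memory_bound (card Q) \<and>
    (\<forall>\<beta>\<in>W. \<forall>s. \<beta> s \<le> enat (memory_bound (card Q) * card Q) \<or> \<beta> s = \<infinity>)"

lemma budget_family_of_ranking: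
  assumes strategy: "strategy L l\<^sub>0 \<delta>" and ranking: "ranking (move_graph L \<delta>) r"
    and initial: "\<And>s. s \<in> initial \<Longrightarrow> r (l\<^sub>0, s) \<noteq> \<infinity>"
  shows "budget_family ((\<lambda>l s. INF z\<in>{z. (z, s) \<in> silent\<^sup>*}. r (l, z)) ` L)"
    (is "budget_family (?\<beta> ` L)")
  unfolding budget_family_def
proof (intro conjI)
  have "?\<beta> l\<^sub>0 s \<le> r (l\<^sub>0, s)" for s by (rule INF_lower) simp
  then have "\<forall>s\<in>initial. ?\<beta> l\<^sub>0 s \<noteq> \<infinity>" using initial by (metis enat_ord_simps(5))
  then show "\<exists>\<beta>\<in>?\<beta> ` L. \<forall>s\<in>initial. \<beta> s \<noteq> \<infinity>" using strategy by (auto simp: strategy_def)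
  have "?\<beta> l s' \<le> ?\<beta> l s" if "(s, s') \<in> silent" for l s s'
    by (rule INF_superset_mono) (use that in \<open>auto intro: rtrancl_into_rtrancl\<close>)
  then show "\<forall>\<beta>\<in>?\<beta> ` L. \<forall>(s, s')\<in>silent. \<beta> s' \<le> \<beta> s" by auto
  have "\<exists>y\<in>Ys. \<exists>\<beta>'\<in>?\<beta> ` L. \<forall>(s, c, s')\<in>letter x y. \<beta>' s' + of_bool c \<le> ?\<beta> l s"
    if mem_lx: "l \<in> L" "x \<in> Xs" for l x
  proof -
    obtain l' y where move: "\<delta> l x = (l', y)" by fastforce
    have "\<delta> l x \<in> L \<times> Ys" using strategy mem_lx by (simp add: strategy_def)
    then have mem: "l' \<in> L" "y \<in> Ys" using move by simp_all
    have "?\<beta> l' s' + of_bool c \<le> ?\<beta> l s" if edge: "(s, c, s') \<in> letter x y" for s c s'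
    proof (rule INF_greatest)
      fix z assume "z \<in> {z. (z, s) \<in> silent\<^sup>*}"
      then have "((l, z), c, (l', s')) \<in> move_graph L \<delta>"
        using edge mem_lx move by (auto simp: move_graph_def moves_def)
      from rankingD[OF ranking this] have "r (l', s') + of_bool c \<le> r (l, z)" .
      moreover have "?\<beta> l' s' \<le> r (l', s')" by (rule INF_lower) simp
      ultimately show "?\<beta> l' s' + of_bool c \<le> r (l, z)" by (meson add_right_mono order_trans)
    qed
    then show ?thesis using mem by (intro bexI[of _ y] bexI[of _ "?\<beta> l'"]) auto
  qed
  then show "\<forall>\<beta>\<in>?\<beta> ` L. \<forall>x\<in>Xs. \<exists>y\<in>Ys. \<exists>\<beta>'\<in>?\<beta> ` L. \<forall>(s, c, s')\<in>letter x y. \<beta>' s' + of_bool c \<le> \<beta> s"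
    by blast
qed

lemma budget_family_restrict:
  assumes "budget_family W"
  shows "budget_family ((\<lambda>\<beta> s. if s \<in> Q then \<beta> s else \<infinity>) ` W)" (is "budget_family (?r ` W)")
  unfolding budget_family_def
proof (intro conjI)
  obtain \<beta> where "\<beta> \<in> W" "\<forall>s\<in>initial. \<beta> s \<noteq> \<infinity>" using assms by (auto simp: budget_family_def)
  then show "\<exists>\<beta>\<in>?r ` W. \<forall>s\<in>initial. \<beta> s \<noteq> \<infinity>"
    using initial_Q by (intro bexI[of _ "?r \<beta>"]) auto
  show "\<forall>\<beta>\<in>?r ` W. \<forall>(s, s')\<in>silent. \<beta> s' \<le> \<beta> s"
    using assms silent_Q by (fastforce simp: budget_family_def)
  have "\<exists>y\<in>Ys. \<exists>\<beta>'\<in>?r ` W. \<forall>(s, c, s')\<in>letter x y. \<beta>' s' + of_bool c \<le> ?r \<beta> s"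
    if mem: "\<beta> \<in> W" "x \<in> Xs" for \<beta> x
  proof -
    obtain y \<beta>' where answer: "y \<in> Ys" "\<beta>' \<in> W" "\<forall>(s, c, s')\<in>letter x y. \<beta>' s' + of_bool c \<le> \<beta> s"
      using assms mem unfolding budget_family_def by meson
    have "\<forall>(s, c, s')\<in>letter x y. ?r \<beta>' s' + of_bool c \<le> ?r \<beta> s"
      using answer(3) letter_Q by fastforce
    then show ?thesis using answer(1,2) by (intro bexI[of _ y] bexI[of _ "?r \<beta>'"]) auto
  qed
  then show "\<forall>\<beta>\<in>?r ` W. \<forall>x\<in>Xs. \<exists>y\<in>Ys. \<exists>\<beta>'\<in>?r ` W. \<forall>(s, c, s')\<in>letter x y. \<beta>' s' + of_bool c \<le> \<beta> s"
    by (auto simp only: ball_simps)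
qed

theorem small_budget_family_if_winning:
  assumes win: "winning L l\<^sub>0 \<delta>"
  shows "\<exists>W. budget_family W \<and> small_family W"
proof -
  have strategy: "strategy L l\<^sub>0 \<delta>" and finite_L: "finite (L \<times> Q)"
    using win finite_Q by (auto simp: winning_def strategy_def)
  obtain b where ranking: "ranking (strategy_graph L \<delta>) b" "\<And>v. b v \<le> enat (card (L \<times> Q)) \<or> b v = \<infinity>"
    "\<forall>v\<in>{l\<^sub>0} \<times> initial. b v \<noteq> \<infinity>"
    using ranking_exists[OF finite_L strategy_graph_subset[OF strategy]] win
    unfolding winning_def by metis
  interpret ranked_strategy Q silent letter initial Xs Ys L l\<^sub>0 \<delta> "\<lambda>l s. b (l, s)" "card (L \<times> Q)"
  proof unfold_locales
    show "b (l\<^sub>0, s) \<le> enat (card (L \<times> Q))" if "s \<in> initial" for s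
      using ranking(2)[of "(l\<^sub>0, s)"] ranking(3) that by auto
  qed (use strategy ranking_moves[OF ranking(1)] in auto)
  have finite_states: "finite (tracking_states \<times> Q)" using finite_tracking_states finite_Q by simp
  obtain r where new_ranking: "ranking (move_graph tracking_states best_move) r"
    "\<And>v. r v \<le> enat (card (tracking_states \<times> Q)) \<or> r v = \<infinity>" "\<forall>v\<in>{initial_tracking} \<times> initial. r v \<noteq> \<infinity>"
    using ranking_exists[OF finite_states move_graph_subset[OF strategy_best_move]
        finitely_flagged_best_move] by metis
  define \<beta> where "\<beta> = (\<lambda>d s. INF z\<in>{z. (z, s) \<in> silent\<^sup>*}. r (d, z))"
  have "budget_family (\<beta> ` tracking_states)"
    unfolding \<beta>_def using strategy_best_move new_ranking(1)
    by (rule budget_family_of_ranking) (use new_ranking(3) in auto)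
  moreover have "card (\<beta> ` tracking_states) \<le> memory_bound (card Q)"
    using card_image_le[OF finite_tracking_states] card_tracking_states by (rule order_trans)
  moreover have "\<beta> d s \<le> enat (memory_bound (card Q) * card Q) \<or> \<beta> d s = \<infinity>" for d s
  proof -
    have "card (tracking_states \<times> Q) \<le> memory_bound (card Q) * card Q"
      using card_tracking_states by (simp add: card_cartesian_product)
    then have "r v \<le> enat (memory_bound (card Q) * card Q) \<or> r v = \<infinity>" for v
      using new_ranking(2)[of v] by (meson enat_ord_simps(1) order_trans)
    then show ?thesis unfolding \<beta>_def by (rule INF_le_or_infinity)
  qed
  ultimately have "budget_family (\<beta> ` tracking_states) \<and> small_family (\<beta> ` tracking_states)"
    using finite_tracking_states by (simp add: small_family_def del: not_infinity_eq enat_ord_simps)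
  then show ?thesis by blast
qed

theorem winning_if_budget_family:
  assumes family: "budget_family W" and "finite W"
  obtains L l\<^sub>0 \<delta> where "winning (L :: nat set) l\<^sub>0 \<delta>"
proof -
  obtain h where bij_h: "bij_betw h {..<card W} W"
    using ex_bij_betw_nat_finite[OF \<open>finite W\<close>] by (auto simp: atLeast0LessThan)
  define N where "N = card W"
  have W_eq: "W = h ` {..<N}" using bij_h by (simp add: bij_betw_def N_def)
  obtain l\<^sub>0 where start: "l\<^sub>0 < N" "\<forall>s\<in>initial. h l\<^sub>0 s \<noteq> \<infinity>"
    using family by (auto simp: budget_family_def W_eq)
  have silent: "h l s' \<le> h l s" if "l < N" "(s, s') \<in> silent" for l s s'
    using family that by (auto simp: budget_family_def W_eq)
  have "\<exists>z. z \<in> {..<N} \<times> Ys \<and> (\<forall>(s, c, s')\<in>letter x (snd z). h (fst z) s' + of_bool c \<le> h l s)"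
    if mem: "l < N" "x \<in> Xs" for l x
  proof -
    have "h l \<in> W" using mem(1) by (simp add: W_eq)
    then obtain y \<beta> where "y \<in> Ys" "\<beta> \<in> W" "\<forall>(s, c, s')\<in>letter x y. \<beta> s' + of_bool c \<le> h l s"
      using family mem(2) unfolding budget_family_def by meson
    moreover from this obtain l' where "l' < N" "\<beta> = h l'" by (auto simp: W_eq)
    ultimately show ?thesis by (intro exI[of _ "(l', y)"]) simp
  qed
  then obtain \<delta> where answers: "\<And>l x. l < N \<Longrightarrow> x \<in> Xs \<Longrightarrow> \<delta> l x \<in> {..<N} \<times> Ys \<and>
      (\<forall>(s, c, s')\<in>letter x (snd (\<delta> l x)). h (fst (\<delta> l x)) s' + of_bool c \<le> h l s)" by metis
  have "ranking (strategy_graph {..<N} \<delta>) (\<lambda>(l, s). h l s)"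
    unfolding ranking_def strategy_graph_def using silent answers by fastforce
  then have "winning {..<N} l\<^sub>0 \<delta>"
    unfolding winning_def strategy_def using start answers
    by (auto intro!: finitely_flagged_if_ranking)
  then show thesis by (rule that)
qed

end

section \<open>Regions and grid points\<close>

subsection \<open>Region equivalence\<close>

lemma region_equiv_refl [simp]: "region_equiv X M v v"
  by (simp add: region_equiv_def)

lemma region_equiv_sym: "region_equiv X M v v' \<Longrightarrow> region_equiv X M v' v"
  by (simp add: region_equiv_def)

lemma region_equiv_trans [trans]:
  "region_equiv X M v v' \<Longrightarrow> region_equiv X M v' v'' \<Longrightarrow> region_equiv X M v v''"
  by (simp add: region_equiv_def)

lemma region_of_eq_iff: "region_of X M v = region_of X M v' \<longleftrightarrow> region_equiv X M v v'"
  unfolding region_of_def using region_equiv_refl region_equiv_sym region_equiv_trans by blast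

text \<open>Index \<open>C\<close> plays the role of a clock that is constantly \<open>0\<close>, which makes all constraints
  diagonal.\<close>

definition zero_ext :: "nat \<Rightarrow> (nat \<Rightarrow> 'a :: zero) \<Rightarrow> nat \<Rightarrow> 'a" where
  "zero_ext C v x = (if x < C then v x else 0)"

lemma region_equivD:
  assumes equiv: "region_equiv {0..<C} M v v'" and x_le: "x \<le> C" and y_le: "y \<le> C"
    and z_le: "\<bar>z\<bar> \<le> int M"
  shows "zero_ext C v x - zero_ext C v y < of_int z \<longleftrightarrow> zero_ext C v' x - zero_ext C v' y < of_int z"
proof -
  have sat: "sat \<phi> v \<longleftrightarrow> sat \<phi> v'" if "cc_over {0..<C} M \<phi>" for \<phi>
    using equiv that by (simp add: region_equiv_def)
  have neg: "- a < of_int z \<longleftrightarrow> of_int (- z) < a" for a :: real by auto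
  consider "x < C" "y < C" | "x < C" "y = C" | "x = C" "y < C" | "x = C" "y = C"
    using x_le y_le by linarith
  then show ?thesis
    by cases (use z_le sat[of "CDiff x y CLt z"] sat[of "CAtom x CLt z"] sat[of "CAtom y CGt (- z)"]
      in \<open>simp_all add: zero_ext_def neg del: of_int_minus\<close>)
qed

lemma cmp_sem_cong:
  assumes "a < b \<longleftrightarrow> a' < b" "a \<le> b \<longleftrightarrow> a' \<le> b"
  shows "cmp_sem r a b \<longleftrightarrow> cmp_sem r a' b"
  using assms by (cases r) auto

lemma region_equiv_iff:
  "region_equiv {0..<C} M v v' \<longleftrightarrow> (\<forall>x\<le>C. \<forall>y\<le>C. \<forall>z. \<bar>z\<bar> \<le> int M \<longrightarrow>
    (zero_ext C v x - zero_ext C v y < of_int z \<longleftrightarrow> zero_ext C v' x - zero_ext C v' y < of_int z))"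
  (is "_ \<longleftrightarrow> ?R")
proof
  assume ?R
  then have less: "zero_ext C v x - zero_ext C v y < of_int z \<longleftrightarrow>
      zero_ext C v' x - zero_ext C v' y < of_int z"
    if "x \<le> C" "y \<le> C" "\<bar>z\<bar> \<le> int M" for x y z using that by blast
  have cmp: "cmp_sem r (zero_ext C v x - zero_ext C v y) (of_int z) \<longleftrightarrow>
      cmp_sem r (zero_ext C v' x - zero_ext C v' y) (of_int z)"
    if "x \<le> C" "y \<le> C" "\<bar>z\<bar> \<le> int M" for r x y z
  proof (rule cmp_sem_cong)
    have "a - b \<le> of_int z \<longleftrightarrow> \<not> b - a < of_int (- z)" for a b :: real by auto
    then show "zero_ext C v x - zero_ext C v y \<le> of_int z \<longleftrightarrow>
        zero_ext C v' x - zero_ext C v' y \<le> of_int z"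
      using less[of y x "- z"] that by simp
  qed (rule less[OF that])
  have "sat \<phi> v \<longleftrightarrow> sat \<phi> v'" if "cc_over {0..<C} M \<phi>" for \<phi>
    using that
  proof (induction \<phi>)
    case (CAtom x r z)
    then show ?case using cmp[of x C z r] by (simp add: zero_ext_def)
  next
    case (CDiff x y r z)
    then show ?case using cmp[of x y z r] by (simp add: zero_ext_def)
  qed auto
  then show "region_equiv {0..<C} M v v'" by (simp add: region_equiv_def)
qed (use region_equivD in blast)

text \<open>Resetting, forgetting and renaming clocks all amount to a substitution of indices.\<close>

lemma region_equiv_reindex:
  assumes "region_equiv {0..<C} M v v'" "M' \<le> M" "\<And>x. x \<le> C' \<Longrightarrow> h x \<le> C"
    "\<And>x. x \<le> C' \<Longrightarrow> zero_ext C' w x = zero_ext C v (h x)"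
    "\<And>x. x \<le> C' \<Longrightarrow> zero_ext C' w' x = zero_ext C v' (h x)"
  shows "region_equiv {0..<C'} M' w w'"
  using assms by (simp add: region_equiv_iff)

lemma region_equiv_reset:
  assumes "region_equiv {0..<C} M v v'"
  shows "region_equiv {0..<C} M (reset Y v) (reset Y v')"
  by (rule region_equiv_reindex[OF assms, of M C "\<lambda>x. if x \<in> Y then C else x"])
    (auto simp: zero_ext_def reset_def)

lemma region_equiv_shift:
  assumes "region_equiv {0..<n + k} M v v'" "m \<le> M"
  shows "region_equiv {0..<k} m (\<lambda>x. v (n + x)) (\<lambda>x. v' (n + x))"
  by (rule region_equiv_reindex[OF assms, of k "\<lambda>x. n + x"]) (auto simp: zero_ext_def)

lemma finite_regions: "finite (regions {0..<C} M)"
proof -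
  define less_table where "less_table v = {(x, y, z). x \<le> C \<and> y \<le> C \<and> \<bar>z\<bar> \<le> int M \<and>
    zero_ext C v x - zero_ext C v y < of_int z}" for v :: valuation
  have "region_equiv {0..<C} M v v' \<longleftrightarrow> less_table v = less_table v'" for v v'
    unfolding region_equiv_iff less_table_def set_eq_iff by auto
  then have "region_of {0..<C} M v = {v'. less_table v = less_table v'}" for v
    by (simp add: region_of_def)
  then have "regions {0..<C} M = (\<lambda>A. {v'. A = less_table v'}) ` range less_table"
    by (auto simp: regions_def)
  moreover have "finite (range less_table)"
  proof (rule finite_subset)
    show "range less_table \<subseteq> Pow ({..C} \<times> {..C} \<times> {- int M..int M})" by (auto simp: less_table_def)
  qed simp
  ultimately show ?thesis by simp
qed

subsection \<open>Time elapse\<close>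

lemma separating_real_exists:
  fixes A B :: "real set"
  assumes "finite A" "finite B" "\<And>a b. a \<in> A \<Longrightarrow> b \<in> B \<Longrightarrow> a < b"
  obtains x where "\<And>a. a \<in> A \<Longrightarrow> a < x" "\<And>b. b \<in> B \<Longrightarrow> x < b"
proof -
  define A' where "A' = insert (Min (insert 0 B) - 1) A"
  define B' where "B' = insert (Max A' + 1) B"
  have fin: "finite A'" "A' \<noteq> {}" "finite B'" "B' \<noteq> {}"
    using assms(1,2) by (auto simp: A'_def B'_def)
  have "Min (insert 0 B) - 1 < b" if "b \<in> B" for b
  proof -
    have "Min (insert 0 B) \<le> b" using assms(2) that by (intro Min_le) auto
    then show ?thesis by linarith
  qed
  moreover have "a < Max A' + 1" if "a \<in> A'" for a using Max_ge[OF fin(1) that] by simp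
  ultimately have "a < b" if "a \<in> A'" "b \<in> B'" for a b
    using that assms(3) by (auto simp: A'_def B'_def)
  then have "Max A' < Min B'" using Max_in[OF fin(1,2)] Min_in[OF fin(3,4)] by blast
  then obtain x where "Max A' < x" "x < Min B'" using dense by blast
  then show thesis using that fin(1,3) by (auto simp: A'_def B'_def)
qed

lemma order_position_transfer:
  fixes p p' :: "'i \<Rightarrow> real"
  assumes finite_I: "finite I" and iso: "\<And>i j. i \<in> I \<Longrightarrow> j \<in> I \<Longrightarrow> p i < p j \<longleftrightarrow> p' i < p' j"
  shows "\<exists>d'. \<forall>i\<in>I. (p i < d \<longleftrightarrow> p' i < d') \<and> (d < p i \<longleftrightarrow> d' < p' i)"
proof (cases "\<exists>i\<in>I. p i = d")
  case True
  then show ?thesis using iso by blast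
next
  case False
  obtain d' where "\<And>a. a \<in> p' ` {i \<in> I. p i < d} \<Longrightarrow> a < d'" "\<And>b. b \<in> p' ` {i \<in> I. d < p i} \<Longrightarrow> d' < b"
  proof (rule separating_real_exists)
    fix a b assume "a \<in> p' ` {i \<in> I. p i < d}" "b \<in> p' ` {i \<in> I. d < p i}"
    then obtain i j where "i \<in> I" "j \<in> I" "p i < p j" "a = p' i" "b = p' j" by force
    then show "a < b" using iso by simp
  qed (use finite_I in auto)
  then have "(p i < d \<longrightarrow> p' i < d') \<and> (d < p i \<longrightarrow> d' < p' i)" if "i \<in> I" for i using that by blast
  then show ?thesis using False by (intro exI[of _ d'] ballI) (metis less_asym linorder_less_linear)
qed

lemma region_equiv_delayI:
  assumes equiv: "region_equiv {0..<C} M v v'"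
    and nonneg: "\<And>x. 0 \<le> v x" "\<And>x. 0 \<le> v' x" "0 \<le> d" "0 \<le> d'"
    and cmp: "\<And>x z. x < C \<Longrightarrow> z \<le> M \<Longrightarrow>
      (v x + d < real z \<longleftrightarrow> v' x + d' < real z) \<and> (v x + d \<le> real z \<longleftrightarrow> v' x + d' \<le> real z)"
  shows "region_equiv {0..<C} M (delay v d) (delay v' d')"
  unfolding region_equiv_iff
proof (intro allI impI)
  fix x y z assume bounds: "x \<le> C" "y \<le> C" "\<bar>z\<bar> \<le> int M"
  have upper: "v x + d < of_int z \<longleftrightarrow> v' x + d' < of_int z" if "x < C" for x
  proof (cases "0 \<le> z")
    case True
    then show ?thesis using cmp[OF that, of "nat z"] bounds(3) by simp
  next
    case False
    then have "real_of_int z < 0" by simp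
    then show ?thesis using nonneg(1,2)[of x] nonneg(3,4) by linarith
  qed
  have lower: "- (v y + d) < of_int z \<longleftrightarrow> - (v' y + d') < of_int z" if "y < C" for y
  proof (cases "z \<le> 0")
    case True
    then have "real_of_int z = - real (nat (- z))" "nat (- z) \<le> M" using bounds(3) by auto
    then show ?thesis using cmp[OF that, of "nat (- z)"] by linarith
  next
    case False
    then have "0 < real_of_int z" by simp
    then show ?thesis using nonneg(1,2)[of y] nonneg(3,4) by linarith
  qed
  show "zero_ext C (delay v d) x - zero_ext C (delay v d) y < of_int z \<longleftrightarrow>
      zero_ext C (delay v' d') x - zero_ext C (delay v' d') y < of_int z"
    using region_equivD[OF equiv bounds] upper[of x] lower[of y]
    by (cases "x < C"; cases "y < C") (simp_all add: zero_ext_def delay_def)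
qed

lemma region_equiv_delay:
  assumes equiv: "region_equiv {0..<C} M v v'" and nonneg: "\<And>x. 0 \<le> v x" "\<And>x. 0 \<le> v' x" "0 \<le> d"
  shows "\<exists>d'\<ge>0. region_equiv {0..<C} M (delay v d) (delay v' d')"
proof -
  let ?I = "{..C} \<times> {..M}"
  define p where "p w i = real (snd i) - zero_ext C w (fst i)" for w :: valuation and i :: "nat \<times> nat"
  have iso: "p v i < p v j \<longleftrightarrow> p v' i < p v' j" if "i \<in> ?I" "j \<in> ?I" for i j
  proof -
    have "p w i < p w j \<longleftrightarrow>
        zero_ext C w (fst j) - zero_ext C w (fst i) < of_int (int (snd j) - int (snd i))" for w
      by (simp add: p_def) linarith
    moreover have "fst i \<le> C" "fst j \<le> C" "\<bar>int (snd j) - int (snd i)\<bar> \<le> int M"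
      using that by (auto simp: mem_Times_iff)
    ultimately show ?thesis using region_equivD[OF equiv] by blast
  qed
  obtain d' where same_position: "\<And>i. i \<in> ?I \<Longrightarrow>
      (p v i < d \<longleftrightarrow> p v' i < d') \<and> (d < p v i \<longleftrightarrow> d' < p v' i)"
    using order_position_transfer[of ?I "p v" "p v'" d, OF _ iso] by auto
  have "0 \<le> d'" using same_position[of "(C, 0)"] nonneg(3) by (auto simp: p_def zero_ext_def)
  moreover have "(v x + d < real z \<longleftrightarrow> v' x + d' < real z) \<and> (v x + d \<le> real z \<longleftrightarrow> v' x + d' \<le> real z)"
    if "x < C" "z \<le> M" for x z
    using same_position[of "(x, z)"] that by (auto simp: p_def zero_ext_def)
  ultimately show ?thesis using region_equiv_delayI[OF equiv nonneg(1,2) nonneg(3)] by blast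
qed

subsection \<open>Grid points\<close>

text \<open>A grid point for \<open>C\<close> clocks has coordinates that are multiples of \<open>1 / (C + 1)\<close>, coded as a
  list of numerators; delays are multiples of half of that.\<close>

definition delayed_grid_point :: "nat \<Rightarrow> nat \<Rightarrow> nat \<Rightarrow> valuation" where
  "delayed_grid_point C u j x = real (2 * nth_code u x + j) / real (2 * Suc C)"

abbreviation grid_point :: "nat \<Rightarrow> nat \<Rightarrow> valuation" where
  "grid_point C u \<equiv> delayed_grid_point C u 0"

lemma grid_point_eq: "grid_point C u x = real (nth_code u x) / real (Suc C)"
  by (simp add: delayed_grid_point_def field_simps)

lemma delayed_grid_point_nonneg: "0 \<le> delayed_grid_point C u j x"
  by (simp add: delayed_grid_point_def)

lemma delay_grid_point:
  "delay (grid_point C u) (real j / real (2 * Suc C)) = delayed_grid_point C u j"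
  by (simp add: delay_def delayed_grid_point_def fun_eq_iff add_divide_distrib)

lemma order_ranks_exist:
  fixes f :: "'i \<Rightarrow> 'a :: linorder"
  assumes "finite I"
  obtains r :: "'i \<Rightarrow> nat" where "\<And>i. i \<in> I \<Longrightarrow> r i < card I"
    "\<And>i j. i \<in> I \<Longrightarrow> j \<in> I \<Longrightarrow> r i < r j \<longleftrightarrow> f i < f j"
    "\<And>i. \<forall>j\<in>I. f i \<le> f j \<Longrightarrow> r i = 0"
proof
  define r where "r i = card {t \<in> f ` I. t < f i}" for i
  have fin: "finite {t \<in> f ` I. t < f i}" for i using assms by simp
  show "r i < card I" if "i \<in> I" for i
  proof -
    have "r i < card (f ` I)" unfolding r_def using assms that by (intro psubset_card_mono) auto
    also have "\<dots> \<le> card I" using assms by (rule card_image_le)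
    finally show ?thesis .
  qed
  have mono: "r i < r j" if "f i < f j" "i \<in> I" for i j
    unfolding r_def using that by (intro psubset_card_mono[OF fin]) auto
  show "r i < r j \<longleftrightarrow> f i < f j" if "i \<in> I" "j \<in> I" for i j
    using mono[of i j] mono[of j i] that
    by (cases "f i" "f j" rule: linorder_cases) (auto simp: r_def)
  show "r i = 0" if "\<forall>j\<in>I. f i \<le> f j" for i
    using that assms by (auto simp: r_def card_eq_0_iff not_less[symmetric])
qed

lemma less_iff_floor_frac:
  fixes a b :: real
  shows "a < b \<longleftrightarrow> \<lfloor>a\<rfloor> < \<lfloor>b\<rfloor> \<or> \<lfloor>a\<rfloor> = \<lfloor>b\<rfloor> \<and> frac a < frac b"
  unfolding frac_def by linarith

lemma region_equivI_floor_frac: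
  assumes floor: "\<And>x. x \<le> C \<Longrightarrow> \<lfloor>zero_ext C v x\<rfloor> = \<lfloor>zero_ext C v' x\<rfloor>"
    and frac: "\<And>x y. x \<le> C \<Longrightarrow> y \<le> C \<Longrightarrow>
      frac (zero_ext C v x) < frac (zero_ext C v y) \<longleftrightarrow>
      frac (zero_ext C v' x) < frac (zero_ext C v' y)"
  shows "region_equiv {0..<C} M v v'"
  unfolding region_equiv_iff
proof (intro allI impI)
  fix x y z assume "x \<le> C" "y \<le> C"
  moreover have "a - b < of_int z \<longleftrightarrow> \<lfloor>a\<rfloor> < \<lfloor>b\<rfloor> + z \<or> \<lfloor>a\<rfloor> = \<lfloor>b\<rfloor> + z \<and> frac a < frac b" for a b :: real
    using less_iff_floor_frac[of a "b + of_int z"]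
    by (simp add: frac_def less_diff_eq diff_less_eq add.commute)
  ultimately show "zero_ext C v x - zero_ext C v y < of_int z \<longleftrightarrow>
      zero_ext C v' x - zero_ext C v' y < of_int z"
    using floor frac by simp
qed

text \<open>Keep the integer parts and replace each fractional part by its rank divided by \<open>C + 1\<close>.\<close>

lemma grid_point_exists:
  assumes nonneg: "\<And>x. 0 \<le> v x"
  obtains u where "region_equiv {0..<C} M v (grid_point C u)"
proof -
  let ?v = "zero_ext C v"
  obtain r where r_less: "\<And>x. x \<in> {..C} \<Longrightarrow> r x < card {..C}"
    and r_iff: "\<And>x y. x \<in> {..C} \<Longrightarrow> y \<in> {..C} \<Longrightarrow> r x < r y \<longleftrightarrow> frac (?v x) < frac (?v y)"
    and r_0: "\<And>x. \<forall>y\<in>{..C}. frac (?v x) \<le> frac (?v y) \<Longrightarrow> r x = (0 :: nat)"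
    using order_ranks_exist[of "{..C}" "\<lambda>x. frac (?v x)"] by auto
  have "r C = 0" by (rule r_0) (simp add: zero_ext_def)
  define u where "u = list_encode (map (\<lambda>x. nat \<lfloor>v x\<rfloor> * Suc C + r x) [0..<C])"
  have grid_point_u: "zero_ext C (grid_point C u) x = of_int \<lfloor>?v x\<rfloor> + real (r x) / real (Suc C)"
    if "x \<le> C" for x
  proof (cases "x < C")
    case True
    then have "grid_point C u x = real (nat \<lfloor>v x\<rfloor> * Suc C + r x) / real (Suc C)"
      by (simp add: grid_point_eq u_def nth_default_nth del: of_nat_Suc)
    also have "\<dots> = of_int \<lfloor>v x\<rfloor> + real (r x) / real (Suc C)"
      using nonneg[of x] by (simp add: add_divide_distrib del: of_nat_Suc mult_Suc_right)
    finally show ?thesis using True by (simp add: zero_ext_def)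
  qed (use that \<open>r C = 0\<close> in \<open>simp add: zero_ext_def\<close>)
  have bounds: "0 \<le> real (r x) / real (Suc C)" "real (r x) / real (Suc C) < 1" if "x \<le> C" for x
    using r_less[of x] that by auto
  have floor: "\<lfloor>zero_ext C (grid_point C u) x\<rfloor> = \<lfloor>?v x\<rfloor>" if "x \<le> C" for x
    unfolding grid_point_u[OF that] using bounds[OF that] by linarith
  have frac: "frac (zero_ext C (grid_point C u) x) = real (r x) / real (Suc C)" if "x \<le> C" for x
    unfolding frac_def floor[OF that] unfolding grid_point_u[OF that] by simp
  have "region_equiv {0..<C} M v (grid_point C u)"
  proof (rule region_equivI_floor_frac)
    show "frac (?v x) < frac (?v y) \<longleftrightarrow>
        frac (zero_ext C (grid_point C u) x) < frac (zero_ext C (grid_point C u) y)"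
      if "x \<le> C" "y \<le> C" for x y
      using r_iff[of x y] that by (simp add: frac divide_less_cancel del: of_nat_Suc)
  qed (simp add: floor)
  then show thesis by (rule that)
qed

lemma half_integer_same_position:
  fixes d :: real
  assumes "0 \<le> d"
  obtains j :: nat where "j \<le> 2 * N + 1" "\<And>t. t \<le> int N \<Longrightarrow>
    (d < of_int t \<longleftrightarrow> real j / 2 < of_int t) \<and> (d \<le> of_int t \<longleftrightarrow> real j / 2 \<le> of_int t)"
proof
  define i where "i = min (\<lfloor>d\<rfloor> + \<lceil>d\<rceil>) (2 * int N + 1)"
  have "0 \<le> i" using assms by (simp add: i_def)
  then have real_i: "real (nat i) = of_int i" by simp
  show "nat i \<le> 2 * N + 1" by (simp add: i_def)
  fix t assume "t \<le> int N"
  moreover have "\<lfloor>d\<rfloor> \<le> \<lceil>d\<rceil>" "\<lceil>d\<rceil> \<le> \<lfloor>d\<rfloor> + 1" by linarith+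
  ultimately have "(\<lfloor>d\<rfloor> < t \<longleftrightarrow> i < 2 * t) \<and> (\<lceil>d\<rceil> \<le> t \<longleftrightarrow> i \<le> 2 * t)" unfolding i_def by linarith
  moreover have "real (nat i) / 2 < of_int t \<longleftrightarrow> i < 2 * t" "real (nat i) / 2 \<le> of_int t \<longleftrightarrow> i \<le> 2 * t"
    unfolding real_i by linarith+
  ultimately show "(d < of_int t \<longleftrightarrow> real (nat i) / 2 < of_int t) \<and>
      (d \<le> of_int t \<longleftrightarrow> real (nat i) / 2 \<le> of_int t)"
    by (simp add: floor_less_iff ceiling_le_iff)
qed

definition max_delay :: "nat \<Rightarrow> nat \<Rightarrow> nat" where
  "max_delay C M = 2 * (M * Suc C) + 1"

lemma discretize_delay:
  assumes nonneg: "0 \<le> d"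
  obtains j where "j \<le> max_delay C M"
    "region_equiv {0..<C} M (delay (grid_point C u) d) (delayed_grid_point C u j)"
proof -
  let ?D = "real (Suc C)"
  have pos: "0 < ?D" by simp
  obtain j where j_le: "j \<le> max_delay C M" and cmp: "\<And>t. t \<le> int (M * Suc C) \<Longrightarrow>
      (d * ?D < of_int t \<longleftrightarrow> real j / 2 < of_int t) \<and> (d * ?D \<le> of_int t \<longleftrightarrow> real j / 2 \<le> of_int t)"
    using half_integer_same_position[of "d * ?D" "M * Suc C"] nonneg by (auto simp: max_delay_def)
  have "region_equiv {0..<C} M (delay (grid_point C u) d)
      (delay (grid_point C u) (real j / real (2 * Suc C)))"
  proof (rule region_equiv_delayI)
    fix x z assume "z \<le> M"
    define t where "t = int (z * Suc C) - int (nth_code u x)"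
    have t_le: "t \<le> int (M * Suc C)"
      using mult_le_mono1[OF \<open>z \<le> M\<close>, of "Suc C"] unfolding t_def by linarith
    have scale: "grid_point C u x + e < real z \<longleftrightarrow> e * ?D < of_int t"
      "grid_point C u x + e \<le> real z \<longleftrightarrow> e * ?D \<le> of_int t" for e
      unfolding grid_point_eq t_def using pos
      by (simp_all add: field_simps del: of_nat_Suc mult_Suc_right)
    have half: "real j / real (2 * Suc C) * ?D = real j / 2" by (simp add: field_simps)
    show "(grid_point C u x + d < real z \<longleftrightarrow> grid_point C u x + real j / real (2 * Suc C) < real z) \<and>
        (grid_point C u x + d \<le> real z \<longleftrightarrow> grid_point C u x + real j / real (2 * Suc C) \<le> real z)"
      unfolding scale half by (rule cmp[OF t_le])
  qed (use nonneg in \<open>simp_all add: delayed_grid_point_nonneg\<close>)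
  with j_le show thesis unfolding delay_grid_point by (rule that)
qed

definition grid_closed :: "nat \<Rightarrow> nat \<Rightarrow> nat \<Rightarrow> bool" where
  "grid_closed C M U \<longleftrightarrow> 0 < U \<and> (\<forall>u<U. \<forall>j\<le>max_delay C M. \<forall>Y<2 ^ C. \<exists>u'<U.
    region_equiv {0..<C} M (reset (set_decode Y) (delayed_grid_point C u j)) (grid_point C u'))"

lemma grid_closed_exists: "\<exists>U. grid_closed C M U"
proof -
  let ?region = "\<lambda>u. region_of {0..<C} M (grid_point C u)"
  have "finite (range ?region)"
    by (rule finite_subset[OF _ finite_regions]) (auto simp: regions_def)
  then obtain R where representatives: "finite R" "range ?region = ?region ` R"
    using finite_subset_image[of "range ?region" ?region UNIV] by auto
  obtain U where representatives_less: "\<forall>u\<in>R. u < U"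
    using representatives(1) finite_nat_set_iff_bounded by blast
  have "\<exists>u'<Suc U. region_equiv {0..<C} M (reset Y (delayed_grid_point C u j)) (grid_point C u')"
    for Y u j
  proof -
    let ?v = "reset Y (delayed_grid_point C u j)"
    have "0 \<le> ?v x" for x by (simp add: reset_def delayed_grid_point_nonneg)
    then obtain u\<^sub>0 where grid_equiv: "region_equiv {0..<C} M ?v (grid_point C u\<^sub>0)"
      using grid_point_exists by blast
    obtain u' where representative: "u' \<in> R" "?region u\<^sub>0 = ?region u'"
      using representatives(2) by blast
    have "region_equiv {0..<C} M ?v (grid_point C u')"
      using grid_equiv representative(2) region_equiv_trans unfolding region_of_eq_iff by blast
    moreover have "u' < Suc U" using representatives_less representative(1) by (simp add: less_SucI)
    ultimately show ?thesis by blast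
  qed
  then have "grid_closed C M (Suc U)" by (simp add: grid_closed_def)
  then show ?thesis ..
qed

section \<open>Plays and runs of the product of automaton and controller\<close>

type_synonym controller = "nat \<Rightarrow> nat \<Rightarrow> valuation set \<Rightarrow> nat \<times> nat \<times> clock set"

record config =
  location :: nat
  automaton_clocks :: valuation
  memory :: nat
  controller_clocks :: valuation

text \<open>Runs of the product are given by their delays instead of their time stamps; the controller
  idles on silent transitions.\<close>

locale controlled_automaton =
  fixes k m na :: nat and T :: ta and l\<^sub>0 :: nat and \<delta> :: controller
begin

definition control_choice :: "letter option \<Rightarrow> nat \<Rightarrow> valuation set \<Rightarrow> nat \<Rightarrow> clock set \<Rightarrow> bool" where
  "control_choice \<sigma> l r l' B \<longleftrightarrow>
     (case \<sigma> of None \<Rightarrow> l' = l \<and> B = {} | Some (a, b) \<Rightarrow> a < na \<and> \<delta> l a r = (l', b, B))"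

definition control_step :: "letter option \<Rightarrow> nat \<Rightarrow> valuation \<Rightarrow> nat \<Rightarrow> valuation \<Rightarrow> bool" where
  "control_step \<sigma> l \<nu> l' \<mu>' \<longleftrightarrow>
      (\<exists>B. control_choice \<sigma> l (region_of {0..<k} m \<nu>) l' B \<and> \<mu>' = reset B \<nu>)"

definition automaton_step :: "letter option \<Rightarrow> nat \<Rightarrow> valuation \<Rightarrow> nat \<Rightarrow> valuation \<Rightarrow> bool" where
  "automaton_step \<sigma> p \<nu> p' v' \<longleftrightarrow> (\<exists>\<phi> Y. (p, \<sigma>, \<phi>, Y, p') \<in> set (ta_rules T) \<and>
     set Y \<subseteq> {0..<ta_clocks T} \<and> sat \<phi> \<nu> \<and> v' = reset (set Y) \<nu>)"

definition product_step :: "real \<Rightarrow> letter option \<Rightarrow> config \<Rightarrow> config \<Rightarrow> bool" where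
  "product_step d \<sigma> p q \<longleftrightarrow> 0 \<le> d \<and>
     automaton_step \<sigma> (location p) (delay (automaton_clocks p) d) (location q) (automaton_clocks q) \<and>
     control_step \<sigma> (memory p) (delay (controller_clocks p) d) (memory q) (controller_clocks q)"

definition initial_config :: "config \<Rightarrow> bool" where
  "initial_config p \<longleftrightarrow> location p \<in> set (ta_init T) \<and> automaton_clocks p = (\<lambda>_. 0) \<and>
     memory p = l\<^sub>0 \<and> controller_clocks p = (\<lambda>_. 0)"

definition product_run :: "(nat \<Rightarrow> config) \<Rightarrow> (nat \<Rightarrow> real) \<Rightarrow> (nat \<Rightarrow> letter option) \<Rightarrow> bool" where
  "product_run p d \<sigma> \<longleftrightarrow> initial_config (p 0) \<and> (\<forall>i. product_step (d i) (\<sigma> i) (p i) (p (Suc i))) \<and>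
     (\<exists>\<^sub>\<infinity>i. location (p i) \<in> set (ta_final T)) \<and> (\<exists>\<^sub>\<infinity>i. \<sigma> i \<noteq> None)"

lemma control_step_None [simp]: "control_step None l \<nu> l' \<mu>' \<longleftrightarrow> l' = l \<and> \<mu>' = \<nu>"
  by (auto simp: control_step_def control_choice_def reset_def)

lemma consistent_play_iff:
  "consistent_play k m {0..<na} l\<^sub>0 \<delta> w \<longleftrightarrow> timed_word w \<and> (\<exists>ls \<mu>s. ls 0 = l\<^sub>0 \<and> \<mu>s 0 = (\<lambda>_. 0) \<and>
     (\<forall>n. control_step (Some (fst (w n))) (ls n) (delay (\<mu>s n) (snd (w n) - prev_time w n))
       (ls (Suc n)) (\<mu>s (Suc n))))"
proof -
  have step: "fst (fst (w n)) \<in> {0..<na} \<and> (let \<nu> = delay (\<mu>s n) (snd (w n) - prev_time w n);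
        (l', b, Y) = \<delta> (ls n) (fst (fst (w n))) (region_of {0..<k} m \<nu>)
      in ls (Suc n) = l' \<and> snd (fst (w n)) = b \<and> \<mu>s (Suc n) = reset Y \<nu>) \<longleftrightarrow>
    control_step (Some (fst (w n))) (ls n) (delay (\<mu>s n) (snd (w n) - prev_time w n))
      (ls (Suc n)) (\<mu>s (Suc n))"
    for n ls \<mu>s
    by (cases "fst (w n)") (auto simp: control_step_def control_choice_def Let_def split: prod.splits)
  show ?thesis unfolding consistent_play_def step[symmetric] by blast
qed

lemma accepting_run_iff:
  "accepting_run T w ls vs \<longleftrightarrow> ls 0 \<in> set (ta_init T) \<and> vs 0 = (\<lambda>_. 0) \<and>
     (\<forall>i. automaton_step (fst (w i)) (ls i) (delay (vs i) (snd (w i) - prev_time w i))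
       (ls (Suc i)) (vs (Suc i))) \<and>
     (\<exists>\<^sub>\<infinity>i. ls i \<in> set (ta_final T))"
  unfolding accepting_run_def automaton_step_def frequently_cofinite ..

end

lemma delay_delay: "delay (delay v d) d' = delay v (d + d')"
  by (auto simp: delay_def)

lemma delay_0 [simp]: "delay v 0 = v"
  by (simp add: delay_def)

subsection \<open>From plays to runs\<close>

definition letter_count :: "(nat \<Rightarrow> 's option \<times> real) \<Rightarrow> nat \<Rightarrow> nat" where
  "letter_count w i = card {j. j < i \<and> fst (w j) \<noteq> None}"

lemma letter_count_0 [simp]: "letter_count w 0 = 0"
  by (simp add: letter_count_def)

lemma letter_count_Suc: "letter_count w (Suc i) = letter_count w i + of_bool (fst (w i) \<noteq> None)"
proof -
  have "{j. j < Suc i \<and> fst (w j) \<noteq> None} =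
      {j. j < i \<and> fst (w j) \<noteq> None} \<union> (if fst (w i) \<noteq> None then {i} else {})"
    by (auto simp: less_Suc_eq)
  then show ?thesis by (simp add: letter_count_def card_Un_disjoint)
qed

lemma erase_letter_count:
  assumes "erase w w'" and letter: "fst (w i) = Some a"
  shows "w' (letter_count w i) = (a, snd (w i))"
proof -
  obtain h where letters: "strict_mono h" "range h = {i. fst (w i) \<noteq> None}"
    and erased: "\<And>j. w' j = (the (fst (w (h j))), snd (w (h j)))"
    using assms(1) by (auto simp: erase_def)
  have "i \<in> range h" using letter by (simp add: letters(2))
  then obtain c where i_eq: "i = h c" by blast
  have "{j. j < h c \<and> fst (w j) \<noteq> None} = {j \<in> range h. j < h c}" by (auto simp: letters(2))
  also have "\<dots> = h ` {..<c}" using letters(1) by (auto simp: strict_mono_less)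
  finally have "letter_count w i = c"
    using strict_mono_imp_inj_on[OF letters(1)]
    by (simp add: letter_count_def i_eq card_image inj_on_subset)
  then show ?thesis using erased letter by (simp add: i_eq)
qed

lemma erase_infinitely_many_letters: "erase w w' \<Longrightarrow> \<exists>\<^sub>\<infinity>i. fst (w i) \<noteq> None"
  unfolding erase_def frequently_cofinite
  by (metis finite_imageD infinite_UNIV_nat strict_mono_imp_inj_on)

lemma prev_time_le: "timed_word w \<Longrightarrow> prev_time w i \<le> snd (w i)"
  by (cases i) (auto simp: prev_time_def timed_word_def)

context controlled_automaton
begin

lemma product_run_of_play:
  assumes play: "consistent_play k m {0..<na} l\<^sub>0 \<delta> w'" and "w' \<in> timed_lang T"
  shows "\<exists>p d \<sigma>. product_run p d \<sigma>"
proof -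
  obtain w ls vs where timed: "timed_word w" and run: "accepting_run T w ls vs"
    and erase: "erase w w'"
    using assms(2) by (auto simp: timed_lang_def)
  obtain ms \<mu>s where start: "ms 0 = l\<^sub>0" "\<mu>s 0 = (\<lambda>_. 0)"
    and control: "\<And>n. control_step (Some (fst (w' n))) (ms n)
      (delay (\<mu>s n) (snd (w' n) - prev_time w' n)) (ms (Suc n)) (\<mu>s (Suc n))"
    using play unfolding consistent_play_iff by blast
  let ?c = "letter_count w"
  define d where "d i = snd (w i) - prev_time w i" for i
  define \<mu> where "\<mu> i = delay (\<mu>s (?c i)) (prev_time w i - prev_time w' (?c i))" for i
  define p where "p i = \<lparr>location = ls i, automaton_clocks = vs i,
    memory = ms (?c i), controller_clocks = \<mu> i\<rparr>" for i
  have delay_\<mu>: "delay (\<mu> i) (d i) = delay (\<mu>s (?c i)) (snd (w i) - prev_time w' (?c i))" for i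
    by (simp add: \<mu>_def d_def delay_delay)
  have "control_step (fst (w i)) (ms (?c i)) (delay (\<mu> i) (d i)) (ms (?c (Suc i))) (\<mu> (Suc i))" for i
  proof (cases "fst (w i)")
    case None
    then show ?thesis
      unfolding delay_\<mu> by (simp add: letter_count_Suc \<mu>_def prev_time_def)
  next
    case (Some a)
    then have "w' (?c i) = (a, snd (w i))" by (rule erase_letter_count[OF erase])
    moreover have "\<mu> (Suc i) = \<mu>s (Suc (?c i))"
      using Some calculation by (simp add: \<mu>_def letter_count_Suc prev_time_def)
    ultimately show ?thesis
      using control[of "?c i"] Some unfolding delay_\<mu> by (simp add: letter_count_Suc)
  qed
  then have "product_step (d i) (fst (w i)) (p i) (p (Suc i))" for i
    using run prev_time_le[OF timed] by (simp add: product_step_def p_def accepting_run_iff d_def)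
  moreover have "initial_config (p 0)"
    using run start by (simp add: initial_config_def p_def accepting_run_iff \<mu>_def prev_time_def)
  ultimately have "product_run p d (\<lambda>i. fst (w i))"
    using run erase_infinitely_many_letters[OF erase]
    by (simp add: product_run_def accepting_run_iff p_def)
  then show ?thesis by blast
qed

end

subsection \<open>From runs to plays\<close>

definition elapsed :: "(nat \<Rightarrow> real) \<Rightarrow> nat \<Rightarrow> real" where
  "elapsed d i = (\<Sum>j<i. d j)"

definition letter_index :: "(nat \<Rightarrow> 's option) \<Rightarrow> nat \<Rightarrow> nat" where
  "letter_index \<sigma> = enumerate {i. \<sigma> i \<noteq> None}"

definition after_letter :: "(nat \<Rightarrow> 's option) \<Rightarrow> nat \<Rightarrow> nat" where
  "after_letter \<sigma> j = (case j of 0 \<Rightarrow> 0 | Suc j' \<Rightarrow> Suc (letter_index \<sigma> j'))"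

definition play_of :: "(nat \<Rightarrow> real) \<Rightarrow> (nat \<Rightarrow> 's option) \<Rightarrow> nat \<Rightarrow> 's \<times> real" where
  "play_of d \<sigma> j = (the (\<sigma> (letter_index \<sigma> j)), elapsed d (Suc (letter_index \<sigma> j)))"

lemma elapsed_Suc: "elapsed d (Suc i) = elapsed d i + d i"
  by (simp add: elapsed_def)

lemma elapsed_mono: "(\<And>i. 0 \<le> d i) \<Longrightarrow> i \<le> j \<Longrightarrow> elapsed d i \<le> elapsed d j"
  unfolding elapsed_def by (intro sum_mono2) auto

lemma elapsed_nonneg: "(\<And>i. 0 \<le> d i) \<Longrightarrow> 0 \<le> elapsed d i"
  by (simp add: elapsed_def sum_nonneg)

lemma prev_time_elapsed: "prev_time (\<lambda>i. (\<sigma> i, elapsed d (Suc i))) i = elapsed d i"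
  by (cases i) (simp_all add: prev_time_def elapsed_def)

lemma prev_time_play_of: "prev_time (play_of d \<sigma>) j = elapsed d (after_letter \<sigma> j)"
  by (cases j) (simp_all add: prev_time_def after_letter_def play_of_def elapsed_def)

context
  fixes \<sigma> :: "nat \<Rightarrow> 's option"
  assumes inf: "\<exists>\<^sub>\<infinity>i. \<sigma> i \<noteq> None"
begin

lemma strict_mono_letter_index: "strict_mono (letter_index \<sigma>)"
  using inf unfolding letter_index_def frequently_cofinite by (rule strict_mono_enumerate)

lemma range_letter_index: "range (letter_index \<sigma>) = {i. \<sigma> i \<noteq> None}"
  using inf unfolding letter_index_def frequently_cofinite by (rule range_enumerate)

lemma after_letter_le: "after_letter \<sigma> j \<le> letter_index \<sigma> j"
  using strict_mono_letter_index
  by (cases j) (simp_all add: after_letter_def Suc_le_eq strict_mono_less)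

lemma silent_before_letter:
  assumes "after_letter \<sigma> j \<le> i" "i < letter_index \<sigma> j" shows "\<sigma> i = None"
proof (rule ccontr)
  assume "\<sigma> i \<noteq> None"
  then have "i \<in> range (letter_index \<sigma>)" by (simp add: range_letter_index)
  then obtain c where i_eq: "i = letter_index \<sigma> c" by blast
  then have "c < j" using assms(2) strict_mono_letter_index by (simp add: strict_mono_less)
  then obtain j' where "j = Suc j'" "c \<le> j'" by (cases j) auto
  then show False
    using assms(1) i_eq strict_mono_letter_index
    by (simp add: after_letter_def Suc_le_eq strict_mono_less)
qed

lemma erase_play_of: "erase (\<lambda>i. (\<sigma> i, elapsed d (Suc i))) (play_of d \<sigma>)"
  unfolding erase_def play_of_def using strict_mono_letter_index range_letter_index by auto

lemma timed_word_play_of: "(\<And>i. 0 \<le> d i) \<Longrightarrow> timed_word (play_of d \<sigma>)"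
  unfolding timed_word_def play_of_def using strict_mono_letter_index
  by (auto intro!: elapsed_nonneg elapsed_mono simp: strict_mono_less_eq)

end

context controlled_automaton
begin

lemma controller_idle:
  assumes run: "\<And>i. product_step (d i) (\<sigma> i) (p i) (p (Suc i))"
    and silent: "\<And>i. i\<^sub>0 \<le> i \<Longrightarrow> i < i\<^sub>1 \<Longrightarrow> \<sigma> i = None" and "i\<^sub>0 \<le> i\<^sub>1"
  shows "memory (p i\<^sub>1) = memory (p i\<^sub>0) \<and>
    controller_clocks (p i\<^sub>1) = delay (controller_clocks (p i\<^sub>0)) (elapsed d i\<^sub>1 - elapsed d i\<^sub>0)"
  using assms(3) silent
proof (induction i\<^sub>1 rule: dec_induct)
  case (step i)
  then show ?case
    using run[of i] by (simp add: product_step_def delay_delay elapsed_Suc algebra_simps)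
qed simp

lemma consistent_play_of_run:
  assumes run: "product_run p d \<sigma>"
  shows "consistent_play k m {0..<na} l\<^sub>0 \<delta> (play_of d \<sigma>)"
  unfolding consistent_play_iff
proof (intro conjI exI allI)
  have inf: "\<exists>\<^sub>\<infinity>i. \<sigma> i \<noteq> None" and steps: "\<And>i. product_step (d i) (\<sigma> i) (p i) (p (Suc i))"
    using run by (auto simp: product_run_def)
  show "timed_word (play_of d \<sigma>)"
    using steps by (intro timed_word_play_of[OF inf]) (simp add: product_step_def)
  let ?g = "after_letter \<sigma>" and ?h = "letter_index \<sigma>"
  show "memory (p (?g 0)) = l\<^sub>0" "controller_clocks (p (?g 0)) = (\<lambda>_. 0)"
    using run by (simp_all add: product_run_def initial_config_def after_letter_def)
  fix j
  have idle: "memory (p (?h j)) = memory (p (?g j))"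
    "controller_clocks (p (?h j)) =
      delay (controller_clocks (p (?g j))) (elapsed d (?h j) - elapsed d (?g j))"
    using controller_idle[of d \<sigma> p "?g j" "?h j",
        OF steps silent_before_letter[OF inf, of j] after_letter_le[OF inf]]
    by blast+
  have "\<sigma> (?h j) = Some (fst (play_of d \<sigma> j))"
    using range_letter_index[OF inf] rangeI[of ?h j] by (auto simp: play_of_def)
  moreover have "delay (controller_clocks (p (?h j))) (d (?h j)) =
      delay (controller_clocks (p (?g j))) (snd (play_of d \<sigma> j) - prev_time (play_of d \<sigma>) j)"
    unfolding idle prev_time_play_of
    by (simp add: play_of_def elapsed_Suc delay_delay algebra_simps)
  ultimately show "control_step (Some (fst (play_of d \<sigma> j))) (memory (p (?g j)))
      (delay (controller_clocks (p (?g j))) (snd (play_of d \<sigma> j) - prev_time (play_of d \<sigma>) j))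
      (memory (p (?g (Suc j)))) (controller_clocks (p (?g (Suc j))))"
    using steps[of "?h j"] by (simp add: product_step_def idle after_letter_def)
qed

lemma timed_lang_of_run:
  assumes run: "product_run p d \<sigma>"
  shows "play_of d \<sigma> \<in> timed_lang T"
proof -
  have nonneg: "0 \<le> d i" for i using run by (simp add: product_run_def product_step_def)
  let ?w = "\<lambda>i. (\<sigma> i, elapsed d (Suc i))"
  have "timed_word ?w" unfolding timed_word_def by (simp add: elapsed_nonneg elapsed_mono nonneg)
  moreover have "snd (?w i) - prev_time ?w i = d i" for i
    unfolding prev_time_elapsed by (simp add: elapsed_Suc)
  then have "accepting_run T ?w (\<lambda>i. location (p i)) (\<lambda>i. automaton_clocks (p i))"
    using run unfolding accepting_run_iff
    by (simp add: product_run_def product_step_def initial_config_def)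
  moreover have "erase ?w (play_of d \<sigma>)"
    using run by (intro erase_play_of) (simp add: product_run_def)
  ultimately show ?thesis unfolding timed_lang_def by blast
qed

theorem ex_play_in_timed_lang_iff_product_run:
  "(\<exists>w. consistent_play k m {0..<na} l\<^sub>0 \<delta> w \<and> w \<in> timed_lang T) \<longleftrightarrow> (\<exists>p d \<sigma>. product_run p d \<sigma>)"
  using product_run_of_play consistent_play_of_run timed_lang_of_run by blast

end

section \<open>The finite game of an instance\<close>

lemma set_encode_less:
  assumes "A \<subseteq> {..<C}" shows "set_encode A < 2 ^ C"
proof -
  have "set_encode A \<le> (\<Sum>i<C. 2 ^ i)"
    unfolding set_encode_def using assms by (intro sum_mono2) auto
  also have "\<dots> < 2 ^ C" by (induction C) auto
  finally show ?thesis .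
qed

lemma set_decode_subset_lessThan: assumes "Y < 2 ^ C" shows "set_decode Y \<subseteq> {..<C}"
proof
  fix x assume "x \<in> set_decode Y"
  then have "Y div 2 ^ x \<noteq> 0" unfolding set_decode_def by (intro notI) simp
  then have "2 ^ x \<le> Y" by (meson div_less not_le)
  then have "(2 :: nat) ^ x < 2 ^ C" using assms by (rule le_less_trans)
  then show "x \<in> {..<C}" by simp
qed

lemma cc_over_mono: "cc_over X M \<phi> \<Longrightarrow> X \<subseteq> X' \<Longrightarrow> M \<le> M' \<Longrightarrow> cc_over X' M' \<phi>"
  by (induction \<phi>) auto

lemma sat_cong: "cc_over X M \<phi> \<Longrightarrow> (\<And>x. x \<in> X \<Longrightarrow> v x = w x) \<Longrightarrow> sat \<phi> v \<longleftrightarrow> sat \<phi> w"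
  by (induction \<phi>) auto

text \<open>\<open>f\<close> remembers whether \<open>F\<close> has held since the last index outside \<open>N\<close>.\<close>

lemma infinitely_often_since_iff:
  assumes f_Suc: "\<And>i. f (Suc i) \<longleftrightarrow> F (Suc i) \<or> N i \<and> f i"
  shows "(\<exists>\<^sub>\<infinity>i. \<not> N i \<and> f i) \<longleftrightarrow> (\<exists>\<^sub>\<infinity>i. F i) \<and> (\<exists>\<^sub>\<infinity>i. \<not> N i)"
proof safe
  assume infinitely_often: "\<exists>\<^sub>\<infinity>i. \<not> N i \<and> f i"
  then show "\<exists>\<^sub>\<infinity>i. \<not> N i" by (rule INFM_mono) simp
  show "\<exists>\<^sub>\<infinity>i. F i"
  proof (rule ccontr)
    assume "\<not> (\<exists>\<^sub>\<infinity>i. F i)"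
    then obtain t where F_before: "\<not> F i" if "t \<le> i" for i by (auto simp: MOST_nat_le)
    obtain i\<^sub>1 where not_N: "t \<le> i\<^sub>1" "\<not> N i\<^sub>1" using infinitely_often by (auto simp: INFM_nat_le)
    have "\<not> f i" if "Suc i\<^sub>1 \<le> i" for i
      using that by (induction i rule: dec_induct) (use f_Suc F_before not_N in auto)
    then show False using infinitely_often by (auto simp: INFM_nat_le)
  qed
next
  assume infinitely_often: "\<exists>\<^sub>\<infinity>i. F i" "\<exists>\<^sub>\<infinity>i. \<not> N i"
  show "\<exists>\<^sub>\<infinity>i. \<not> N i \<and> f i"
    unfolding INFM_nat_le
  proof
    fix t
    obtain i where F_i: "t \<le> i" "F (Suc i)"
      using infinitely_often(1) unfolding INFM_nat_le by (metis Suc_le_D Suc_le_mono)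
    define j where "j = (LEAST j. Suc i \<le> j \<and> \<not> N j)"
    have not_N_exists: "\<exists>j. Suc i \<le> j \<and> \<not> N j" using infinitely_often(2) by (auto simp: INFM_nat_le)
    have first: "Suc i \<le> j" "\<not> N j" using LeastI_ex[OF not_N_exists] by (auto simp: j_def)
    have N_between: "N i'" if "Suc i \<le> i'" "i' < j" for i'
      using not_less_Least[OF that(2)[unfolded j_def]] that(1) by blast
    have "i' \<le> j \<longrightarrow> f i'" if "Suc i \<le> i'" for i'
      using that by (induction i' rule: dec_induct) (use f_Suc F_i N_between in auto)
    then show "\<exists>j\<ge>t. \<not> N j \<and> f j" using F_i(1) first by (intro exI[of _ j]) auto
  qed
qed

subsection \<open>The game graph\<close>

text \<open>A vertex codes a location, a flag that is set iff a final location has been visited since the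
  last letter, and a grid point.\<close>

definition vertex :: "nat \<Rightarrow> bool \<Rightarrow> nat \<Rightarrow> nat" where
  "vertex p f u = prod_encode (p, prod_encode (of_bool f, u))"

definition vertex_location :: "nat \<Rightarrow> nat" where "vertex_location s = fst_decode s"
definition vertex_flag :: "nat \<Rightarrow> bool" where "vertex_flag s \<longleftrightarrow> fst_decode (snd_decode s) = 1"
definition vertex_grid :: "nat \<Rightarrow> nat" where "vertex_grid s = snd_decode (snd_decode s)"

definition num_vertices :: "nat \<Rightarrow> nat \<Rightarrow> nat" where
  "num_vertices n U = Suc (vertex n True U)"

lemma vertex_simps [simp]:
  "vertex_location (vertex p f u) = p" "vertex_flag (vertex p f u) = f"
  "vertex_grid (vertex p f u) = u"
  by (simp_all add: vertex_def vertex_location_def vertex_flag_def vertex_grid_def)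

lemma vertex_less: "p \<le> n \<Longrightarrow> u \<le> U \<Longrightarrow> vertex p f u < num_vertices n U"
  unfolding num_vertices_def vertex_def by (auto simp: less_Suc_eq_le intro!: prod_encode_mono)

text \<open>\<open>n\<close> bounds all locations, clocks and constants of the automaton (later it is the code of the
  instance), so that it also serves as the number of clocks of the automaton. The clocks of the
  controller are placed after these.\<close>

locale instance_game =
  fixes k m na nb :: nat and T :: ta and n U :: nat
  assumes rules: "\<And>p \<sigma> \<phi> Y q. (p, \<sigma>, \<phi>, Y, q) \<in> set (ta_rules T) \<Longrightarrow>
      p < n \<and> q < n \<and> cc_over {0..<n} n \<phi>"
    and clocks: "ta_clocks T \<le> n"
    and init: "\<And>p. p \<in> set (ta_init T) \<Longrightarrow> p < n"
    and closed: "grid_closed (n + k) (n + m) U"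
begin

abbreviation C :: nat where "C \<equiv> n + k"
abbreviation M :: nat where "M \<equiv> n + m"

definition merge :: "valuation \<Rightarrow> valuation \<Rightarrow> valuation" where
  "merge v \<mu> x = (if x < n then v x else \<mu> (x - n))"

definition controller_region :: "nat \<Rightarrow> nat \<Rightarrow> valuation set" where
  "controller_region u j = region_of {0..<k} m (\<lambda>x. delayed_grid_point C u j (n + x))"

definition vertex_step :: "letter option \<Rightarrow> nat set \<Rightarrow> nat \<Rightarrow> nat \<Rightarrow> nat \<Rightarrow> bool" where
  "vertex_step \<sigma> B j s s' \<longleftrightarrow> (\<exists>\<phi> Y.
     (vertex_location s, \<sigma>, \<phi>, Y, vertex_location s') \<in> set (ta_rules T) \<and>
     set Y \<subseteq> {0..<ta_clocks T} \<and> sat \<phi> (delayed_grid_point C (vertex_grid s) j) \<and>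
     region_equiv {0..<C} M (reset (set Y \<union> (+) n ` B) (delayed_grid_point C (vertex_grid s) j))
       (grid_point C (vertex_grid s')))"

definition silent_edges :: "(nat \<times> nat) set" where
  "silent_edges = {(s, s'). s < num_vertices n U \<and> s' < num_vertices n U \<and>
     (vertex_flag s' \<longleftrightarrow> vertex_location s' \<in> set (ta_final T) \<or> vertex_flag s) \<and>
     (\<exists>j\<le>max_delay C M. vertex_step None {} j s s')}"

definition letter_edges :: "nat \<times> nat \<Rightarrow> nat \<times> nat \<Rightarrow> nat flagged_graph" where
  "letter_edges = (\<lambda>(a, \<rho>) (b, Y). {(s, c, s'). s < num_vertices n U \<and> s' < num_vertices n U \<and>
     c = vertex_flag s \<and> (vertex_flag s' \<longleftrightarrow> vertex_location s' \<in> set (ta_final T)) \<and>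
     (\<exists>j\<le>max_delay C M. vertex_step (Some (a, b)) (set_decode Y) j s s' \<and>
       controller_region (vertex_grid s) j = controller_region \<rho> 0)})"

definition initial_vertices :: "nat set" where
  "initial_vertices = (\<lambda>p. vertex p False 0) ` set (ta_init T)"

lemma U_pos: "0 < U" using closed by (simp add: grid_closed_def)

sublocale flagged_game "{..<num_vertices n U}" silent_edges letter_edges initial_vertices
  "{..<na} \<times> {..<U}" "{..<nb} \<times> {..<2 ^ k}"
proof
  show "initial_vertices \<subseteq> {..<num_vertices n U}"
  proof
    fix s assume "s \<in> initial_vertices"
    then obtain p where "p \<in> set (ta_init T)" "s = vertex p False 0"
      by (auto simp: initial_vertices_def)
    then show "s \<in> {..<num_vertices n U}" using init[of p] by (simp add: vertex_less)
  qed
  show "letter_edges x y \<subseteq> {..<num_vertices n U} \<times> UNIV \<times> {..<num_vertices n U}" for x y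
    by (cases x; cases y) (auto simp: letter_edges_def)
qed (auto simp: silent_edges_def)

subsection \<open>Simulation between configurations and vertices\<close>

definition represents :: "valuation \<Rightarrow> valuation \<Rightarrow> nat \<Rightarrow> bool" where
  "represents v \<mu> u \<longleftrightarrow>
      (\<forall>x. 0 \<le> v x) \<and> (\<forall>x. 0 \<le> \<mu> x) \<and> region_equiv {0..<C} M (merge v \<mu>) (grid_point C u)"

lemma delay_merge: "delay (merge v \<mu>) d = merge (delay v d) (delay \<mu> d)"
  by (auto simp: delay_def merge_def)

lemma reset_merge:
  assumes "A \<subseteq> {0..<n}"
  shows "reset (A \<union> (+) n ` B) (merge v \<mu>) = merge (reset A v) (reset B \<mu>)"
proof
  fix x
  have "x \<in> (+) n ` B \<longleftrightarrow> n \<le> x \<and> x - n \<in> B" by (force intro: image_eqI[of _ _ "x - n"])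
  then show "reset (A \<union> (+) n ` B) (merge v \<mu>) x = merge (reset A v) (reset B \<mu>) x"
    using assms by (auto simp: reset_def merge_def)
qed

lemma merge_nonneg: "\<forall>x. 0 \<le> v x \<Longrightarrow> \<forall>x. 0 \<le> \<mu> x \<Longrightarrow> 0 \<le> merge v \<mu> x"
  by (simp add: merge_def)

lemma represents_zero: "represents (\<lambda>_. 0) (\<lambda>_. 0) 0"
proof -
  have "merge (\<lambda>_. 0) (\<lambda>_. 0) = grid_point C 0" by (auto simp: merge_def grid_point_eq)
  then show ?thesis by (simp add: represents_def)
qed

lemma represents_reset:
  assumes "\<forall>x. 0 \<le> v x" "\<forall>x. 0 \<le> \<mu> x" and equiv: "region_equiv {0..<C} M (merge v \<mu>) w"
    and A_subset: "A \<subseteq> {0..<n}"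
    and grid_equiv: "region_equiv {0..<C} M (reset (A \<union> (+) n ` B) w) (grid_point C u)"
  shows "represents (reset A v) (reset B \<mu>) u"
  using assms(1,2) region_equiv_trans[OF region_equiv_reset[OF equiv] grid_equiv]
  by (simp add: represents_def reset_merge[OF A_subset]) (simp add: reset_def)

lemma sat_iff_if_region_equiv_merge:
  assumes "(p, \<sigma>, \<phi>, Y, q) \<in> set (ta_rules T)" and equiv: "region_equiv {0..<C} M (merge v \<mu>) w"
  shows "sat \<phi> v \<longleftrightarrow> sat \<phi> w"
proof -
  have cc_over_n: "cc_over {0..<n} n \<phi>" using rules[OF assms(1)] by simp
  have "sat \<phi> v \<longleftrightarrow> sat \<phi> (merge v \<mu>)" by (rule sat_cong[OF cc_over_n]) (simp add: merge_def)
  moreover have "cc_over {0..<C} M \<phi>" by (rule cc_over_mono[OF cc_over_n]) auto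
  ultimately show ?thesis using equiv by (simp add: region_equiv_def)
qed

lemma region_of_if_region_equiv_merge:
  assumes "region_equiv {0..<C} M (merge v \<mu>) w"
  shows "region_of {0..<k} m \<mu> = region_of {0..<k} m (\<lambda>x. w (n + x))"
  using region_equiv_shift[OF assms, of m] by (simp add: region_of_eq_iff merge_def)

lemma delay_to_grid:
  assumes repr: "represents v \<mu> u" and delay_nonneg: "0 \<le> d"
  obtains j where "j \<le> max_delay C M"
    "region_equiv {0..<C} M (merge (delay v d) (delay \<mu> d)) (delayed_grid_point C u j)"
proof -
  have nonneg: "0 \<le> merge v \<mu> x" for x
    using repr by (intro merge_nonneg) (simp_all add: represents_def)
  have "region_equiv {0..<C} M (merge v \<mu>) (grid_point C u)"
    using repr by (simp add: represents_def)
  from region_equiv_delay[OF this nonneg delayed_grid_point_nonneg delay_nonneg]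
  obtain d' where delayed: "0 \<le> d'"
    "region_equiv {0..<C} M (delay (merge v \<mu>) d) (delay (grid_point C u) d')" by blast
  obtain j where "j \<le> max_delay C M"
    "region_equiv {0..<C} M (delay (grid_point C u) d') (delayed_grid_point C u j)"
    using delayed(1) by (rule discretize_delay)
  then show thesis using that region_equiv_trans[OF delayed(2)] unfolding delay_merge by blast
qed

lemma delay_of_grid:
  assumes repr: "represents v \<mu> u"
  obtains d where "0 \<le> d"
    "region_equiv {0..<C} M (merge (delay v d) (delay \<mu> d)) (delayed_grid_point C u j)"
proof -
  have nonneg: "0 \<le> merge v \<mu> x" for x
    using repr by (intro merge_nonneg) (simp_all add: represents_def)
  have equiv: "region_equiv {0..<C} M (grid_point C u) (merge v \<mu>)"
    using repr by (simp add: represents_def region_equiv_sym)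
  have "0 \<le> real j / real (2 * Suc C)" by simp
  from region_equiv_delay[OF equiv delayed_grid_point_nonneg nonneg this]
  obtain d where delayed: "0 \<le> d"
    "region_equiv {0..<C} M (delay (grid_point C u) (real j / real (2 * Suc C)))
      (delay (merge v \<mu>) d)" by blast
  show thesis
    using delayed(1) region_equiv_sym[OF delayed(2)[unfolded delay_grid_point delay_merge]]
    by (rule that)
qed

lemma vertex_step_exists:
  assumes repr: "represents v \<mu> (vertex_grid s)" and grid_less: "vertex_grid s < U"
    and delay_nonneg: "0 \<le> d"
    and rule: "(vertex_location s, \<sigma>, \<phi>, Y, p') \<in> set (ta_rules T)" "set Y \<subseteq> {0..<ta_clocks T}"
      "sat \<phi> (delay v d)"
    and B_subset: "B \<subseteq> {0..<k}"
  obtains j u' where "j \<le> max_delay C M" "u' < U" "\<And>f. vertex_step \<sigma> B j s (vertex p' f u')"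
    "represents (reset (set Y) (delay v d)) (reset B (delay \<mu> d)) u'"
    "region_of {0..<k} m (delay \<mu> d) = controller_region (vertex_grid s) j"
proof -
  obtain j where j_le: "j \<le> max_delay C M"
    and equiv: "region_equiv {0..<C} M (merge (delay v d) (delay \<mu> d))
      (delayed_grid_point C (vertex_grid s) j)"
    using repr delay_nonneg by (rule delay_to_grid)
  let ?R = "set Y \<union> (+) n ` B"
  have Y_subset: "set Y \<subseteq> {0..<n}" using rule(2) clocks by auto
  have resets_subset: "?R \<subseteq> {..<C}" using Y_subset B_subset by auto
  have decode: "set_decode (set_encode ?R) = ?R"
    using finite_subset[OF resets_subset] by (intro set_encode_inverse) simp
  obtain u' where target: "u' < U"
    "region_equiv {0..<C} M (reset ?R (delayed_grid_point C (vertex_grid s) j)) (grid_point C u')"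
    using closed grid_less j_le set_encode_less[OF resets_subset]
    unfolding grid_closed_def by (metis decode)
  have "vertex_step \<sigma> B j s (vertex p' f u')" for f
    using rule target(2) sat_iff_if_region_equiv_merge[OF rule(1) equiv]
    by (auto simp: vertex_step_def)
  moreover have "represents (reset (set Y) (delay v d)) (reset B (delay \<mu> d)) u'"
    using repr delay_nonneg
    by (intro represents_reset[OF _ _ equiv Y_subset target(2)])
      (simp_all add: represents_def delay_def)
  moreover have "region_of {0..<k} m (delay \<mu> d) = controller_region (vertex_grid s) j"
    unfolding controller_region_def using equiv by (rule region_of_if_region_equiv_merge)
  ultimately show thesis using j_le target(1) that by blast
qed

lemma concrete_step_exists:
  assumes repr: "represents v \<mu> (vertex_grid s)" and step: "vertex_step \<sigma> B j s s'"
  obtains d \<phi> Y where "0 \<le> d" "(vertex_location s, \<sigma>, \<phi>, Y, vertex_location s') \<in> set (ta_rules T)"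
    "set Y \<subseteq> {0..<ta_clocks T}" "sat \<phi> (delay v d)"
    "represents (reset (set Y) (delay v d)) (reset B (delay \<mu> d)) (vertex_grid s')"
    "region_of {0..<k} m (delay \<mu> d) = controller_region (vertex_grid s) j"
proof -
  obtain \<phi> Y where rule: "(vertex_location s, \<sigma>, \<phi>, Y, vertex_location s') \<in> set (ta_rules T)"
    "set Y \<subseteq> {0..<ta_clocks T}" "sat \<phi> (delayed_grid_point C (vertex_grid s) j)"
    and target: "region_equiv {0..<C} M
      (reset (set Y \<union> (+) n ` B) (delayed_grid_point C (vertex_grid s) j))
      (grid_point C (vertex_grid s'))"
    using step by (auto simp: vertex_step_def)
  obtain d where delay_nonneg: "0 \<le> d"
    and equiv: "region_equiv {0..<C} M (merge (delay v d) (delay \<mu> d))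
      (delayed_grid_point C (vertex_grid s) j)"
    using repr by (rule delay_of_grid)
  have "set Y \<subseteq> {0..<n}" using rule(2) clocks by auto
  then have "represents (reset (set Y) (delay v d)) (reset B (delay \<mu> d)) (vertex_grid s')"
    using repr delay_nonneg
    by (intro represents_reset[OF _ _ equiv _ target]) (simp_all add: represents_def delay_def)
  moreover have "region_of {0..<k} m (delay \<mu> d) = controller_region (vertex_grid s) j"
    unfolding controller_region_def using equiv by (rule region_of_if_region_equiv_merge)
  moreover have "sat \<phi> (delay v d)"
    using rule(3) sat_iff_if_region_equiv_merge[OF rule(1) equiv] by simp
  ultimately show thesis using that delay_nonneg rule(1,2) by blast
qed

end

subsection \<open>Controllers as strategies of the finite game\<close>

locale instance_controller = instance_game k m na nb T n U
  for k m na nb :: nat and T :: ta and n U :: nat +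
  fixes L :: "nat set" and l\<^sub>0 :: nat and \<delta> :: controller
  assumes controller: "is_controller k m {0..<na} {0..<nb} L l\<^sub>0 \<delta>"
begin

sublocale controlled_automaton k m na T l\<^sub>0 \<delta> .

definition abstract_move :: "nat \<Rightarrow> nat \<times> nat \<Rightarrow> nat \<times> (nat \<times> nat)" where
  "abstract_move l x =
     (case \<delta> l (fst x) (controller_region (snd x) 0) of (l', b, Y) \<Rightarrow> (l', (b, set_encode Y)))"

lemma control_choice_mem:
  assumes l_mem: "l \<in> L" and choice: "control_choice \<sigma> l (region_of {0..<k} m \<nu>) l' B"
  shows "l' \<in> L" "B \<subseteq> {0..<k}"
proof -
  have "\<delta> l a (region_of {0..<k} m \<nu>) \<in> L \<times> {0..<nb} \<times> Pow {0..<k}" if "a < na" for a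
    using controller l_mem that by (simp add: is_controller_def regions_def)
  then show "l' \<in> L" "B \<subseteq> {0..<k}"
    using l_mem choice by (auto simp: control_choice_def split: option.splits) fastforce+
qed

lemma strategy_abstract_move: "strategy L l\<^sub>0 abstract_move"
  unfolding strategy_def
proof (intro conjI ballI)
  fix l x assume l_mem: "l \<in> L" and x_mem: "x \<in> {..<na} \<times> {..<U}"
  obtain l' b Y where \<delta>_eq: "\<delta> l (fst x) (controller_region (snd x) 0) = (l', b, Y)"
    using prod_cases3 by blast
  have "(l', b, Y) \<in> L \<times> {0..<nb} \<times> Pow {0..<k}"
    unfolding \<delta>_eq[symmetric] controller_region_def
    using controller l_mem x_mem by (simp add: is_controller_def regions_def mem_Times_iff)
  then show "abstract_move l x \<in> L \<times> ({..<nb} \<times> {..<2 ^ k})"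
    using \<delta>_eq set_encode_less[of Y k] by (simp add: abstract_move_def lessThan_atLeast0)
qed (use controller in \<open>simp_all add: is_controller_def\<close>)

definition at_vertex :: "config \<Rightarrow> nat \<Rightarrow> bool" where
  "at_vertex p s \<longleftrightarrow> memory p \<in> L \<and> vertex_location s = location p \<and>
     represents (automaton_clocks p) (controller_clocks p) (vertex_grid s)"

definition flag_step :: "letter option \<Rightarrow> nat \<Rightarrow> nat \<Rightarrow> bool" where
  "flag_step \<sigma> s s' \<longleftrightarrow>
      (vertex_flag s' \<longleftrightarrow> vertex_location s' \<in> set (ta_final T) \<or> \<sigma> = None \<and> vertex_flag s)"

lemma controller_region_representative:
  assumes "u < U" "j \<le> max_delay C M"
  obtains \<rho> where "\<rho> < U" "controller_region u j = controller_region \<rho> 0"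
proof -
  have "(0 :: nat) < 2 ^ C" by simp
  then obtain \<rho> where "\<rho> < U"
    and "region_equiv {0..<C} M (reset (set_decode 0) (delayed_grid_point C u j)) (grid_point C \<rho>)"
    using closed assms unfolding grid_closed_def by blast
  then have "region_equiv {0..<C} M (delayed_grid_point C u j) (grid_point C \<rho>)"
    by (simp add: reset_def)
  then have "controller_region u j = controller_region \<rho> 0"
    unfolding controller_region_def region_of_eq_iff by (rule region_equiv_shift) simp
  with \<open>\<rho> < U\<close> show thesis by (rule that)
qed

lemma strategy_edgeI:
  assumes l_mem: "l \<in> L" and vertices: "s < num_vertices n U" "s' < num_vertices n U"
    "vertex_grid s < U"
    and j_le: "j \<le> max_delay C M" and step: "vertex_step \<sigma> B j s s'" and flag: "flag_step \<sigma> s s'"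
    and choice: "control_choice \<sigma> l (controller_region (vertex_grid s) j) l' B"
    and B_subset: "B \<subseteq> {0..<k}"
  shows "((l, s), \<sigma> \<noteq> None \<and> vertex_flag s, (l', s')) \<in> strategy_graph L abstract_move"
proof (cases \<sigma>)
  case None
  then have "l' = l" "(s, s') \<in> silent_edges"
    using vertices j_le step flag choice
    by (auto simp: silent_edges_def flag_step_def control_choice_def)
  then show ?thesis using l_mem None by (simp add: strategy_graph_def)
next
  case (Some ab)
  obtain a b where ab_eq: "ab = (a, b)" by fastforce
  obtain \<rho> where representative: "\<rho> < U"
    "controller_region (vertex_grid s) j = controller_region \<rho> 0"
    using vertices(3) j_le by (rule controller_region_representative)
  have a_less: "a < na" and \<delta>_eq: "\<delta> l a (controller_region \<rho> 0) = (l', b, B)"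
    using choice by (simp_all add: control_choice_def Some ab_eq representative(2))
  have "set_decode (set_encode B) = B"
    using finite_subset[OF B_subset] by (intro set_encode_inverse) simp
  then have "(s, vertex_flag s, s') \<in> letter_edges (a, \<rho>) (b, set_encode B)"
    using vertices step j_le representative(2) flag
    by (auto simp: letter_edges_def flag_step_def Some ab_eq)
  moreover have "abstract_move l (a, \<rho>) = (l', (b, set_encode B))"
    by (simp add: abstract_move_def \<delta>_eq)
  ultimately show ?thesis
    using l_mem a_less representative(1) Some
    by (auto simp: strategy_graph_def intro!: bexI[of _ "(a, \<rho>)"])
qed

lemma strategy_edgeE:
  assumes edge: "((l, s), c, (l', s')) \<in> strategy_graph L abstract_move"
  obtains \<sigma> B j where "vertex_step \<sigma> B j s s'" "flag_step \<sigma> s s'" "c = (\<sigma> \<noteq> None \<and> vertex_flag s)"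
    "control_choice \<sigma> l (controller_region (vertex_grid s) j) l' B"
proof -
  have l_mem: "l \<in> L" using edge by (simp add: strategy_graph_def)
  consider (silent) "\<not> c" "l' = l" "(s, s') \<in> silent_edges"
    | (letter) a \<rho> b Y where "a < na" "abstract_move l (a, \<rho>) = (l', (b, Y))"
      "(s, c, s') \<in> letter_edges (a, \<rho>) (b, Y)"
    using edge by (auto simp: strategy_graph_def)
  then show thesis
  proof cases
    case silent
    then obtain j where "flag_step None s s'" "vertex_step None {} j s s'"
      by (auto simp: silent_edges_def flag_step_def)
    with silent show thesis by (intro that[of None "{}" j]) (simp_all add: control_choice_def)
  next
    case (letter a \<rho> b Y)
    obtain B where \<delta>_eq: "\<delta> l a (controller_region \<rho> 0) = (l', b, B)" and Y_eq: "Y = set_encode B"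
      using letter(2) by (auto simp: abstract_move_def split: prod.splits)
    have choice: "control_choice (Some (a, b)) l (controller_region \<rho> 0) l' B"
      using letter(1) \<delta>_eq by (simp add: control_choice_def)
    then have "B \<subseteq> {0..<k}"
      unfolding controller_region_def by (rule control_choice_mem(2)[OF l_mem])
    then have decode_Y: "set_decode Y = B"
      unfolding Y_eq using finite_subset by (intro set_encode_inverse) blast
    obtain j where "vertex_step (Some (a, b)) B j s s'"
      "controller_region (vertex_grid s) j = controller_region \<rho> 0"
      using letter(3) by (auto simp: letter_edges_def decode_Y)
    then show thesis
      using letter(3) choice
      by (intro that[of "Some (a, b)" B j]) (auto simp: letter_edges_def flag_step_def)
  qed
qed

lemma edge_of_product_step:
  assumes step: "product_step d \<sigma> p q" and at_s: "at_vertex p s"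
    and vertex: "s < num_vertices n U" "vertex_grid s < U"
  obtains s' where "at_vertex q s'" "s' < num_vertices n U" "vertex_grid s' < U" "flag_step \<sigma> s s'"
    "((memory p, s), \<sigma> \<noteq> None \<and> vertex_flag s, (memory q, s')) \<in> strategy_graph L abstract_move"
proof -
  let ?\<nu> = "delay (automaton_clocks p) d" and ?\<kappa> = "delay (controller_clocks p) d"
  have repr: "represents (automaton_clocks p) (controller_clocks p) (vertex_grid s)"
    and l_mem: "memory p \<in> L" using at_s by (simp_all add: at_vertex_def)
  obtain \<phi> Y where delay_nonneg: "0 \<le> d"
    and rule: "(vertex_location s, \<sigma>, \<phi>, Y, location q) \<in> set (ta_rules T)"
    "set Y \<subseteq> {0..<ta_clocks T}" "sat \<phi> ?\<nu>" "automaton_clocks q = reset (set Y) ?\<nu>"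
    using step at_s by (auto simp: product_step_def automaton_step_def at_vertex_def)
  obtain B where choice: "control_choice \<sigma> (memory p) (region_of {0..<k} m ?\<kappa>) (memory q) B"
    and controller_clocks_q: "controller_clocks q = reset B ?\<kappa>"
    using step by (auto simp: product_step_def control_step_def)
  note mem = control_choice_mem[OF l_mem choice]
  from repr vertex(2) delay_nonneg rule(1-3) mem(2) obtain j u where j_le: "j \<le> max_delay C M"
    and u_less: "u < U"
    and vertex_step: "\<And>f. vertex_step \<sigma> B j s (vertex (location q) f u)"
    and repr_after: "represents (reset (set Y) ?\<nu>) (reset B ?\<kappa>) u"
    and region: "region_of {0..<k} m ?\<kappa> = controller_region (vertex_grid s) j"
    by (rule vertex_step_exists) (rule that)
  define s' where
    "s' = vertex (location q) (location q \<in> set (ta_final T) \<or> \<sigma> = None \<and> vertex_flag s) u"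
  have flag: "flag_step \<sigma> s s'" by (simp add: flag_step_def s'_def)
  have "location q < n" using rules[OF rule(1)] by simp
  then have target: "s' < num_vertices n U" using u_less by (simp add: s'_def vertex_less)
  show thesis
  proof
    show "at_vertex q s'"
      using mem(1) repr_after by (simp add: at_vertex_def s'_def rule(4) controller_clocks_q)
    show "((memory p, s), \<sigma> \<noteq> None \<and> vertex_flag s, (memory q, s')) \<in> strategy_graph L abstract_move"
      using l_mem vertex(1) target vertex(2) j_le vertex_step flag choice[unfolded region] mem(2)
      unfolding s'_def by (rule strategy_edgeI)
  qed (use target flag u_less in \<open>simp_all add: s'_def\<close>)
qed

lemma product_step_of_edge:
  assumes edge: "((memory p, s), c, (l', s')) \<in> strategy_graph L abstract_move"
    and at_s: "at_vertex p s"
  obtains d \<sigma> q where "product_step d \<sigma> p q" "at_vertex q s'" "memory q = l'" "flag_step \<sigma> s s'"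
    "c = (\<sigma> \<noteq> None \<and> vertex_flag s)"
proof -
  let ?v = "automaton_clocks p" and ?\<mu> = "controller_clocks p"
  have repr: "represents ?v ?\<mu> (vertex_grid s)" and l_mem: "memory p \<in> L"
    using at_s by (simp_all add: at_vertex_def)
  from edge obtain \<sigma> B j where vertex_step: "vertex_step \<sigma> B j s s'" and flag: "flag_step \<sigma> s s'"
    and c_eq: "c = (\<sigma> \<noteq> None \<and> vertex_flag s)"
    and choice: "control_choice \<sigma> (memory p) (controller_region (vertex_grid s) j) l' B"
    by (rule strategy_edgeE)
  from repr vertex_step obtain d \<phi> Y where delay_nonneg: "0 \<le> d"
    and rule: "(vertex_location s, \<sigma>, \<phi>, Y, vertex_location s') \<in> set (ta_rules T)"
    "set Y \<subseteq> {0..<ta_clocks T}" "sat \<phi> (delay ?v d)"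
    and repr_after: "represents (reset (set Y) (delay ?v d)) (reset B (delay ?\<mu> d)) (vertex_grid s')"
    and region: "region_of {0..<k} m (delay ?\<mu> d) = controller_region (vertex_grid s) j"
    by (rule concrete_step_exists)
  define q where "q = \<lparr>location = vertex_location s', automaton_clocks = reset (set Y) (delay ?v d),
    memory = l', controller_clocks = reset B (delay ?\<mu> d)\<rparr>"
  have "l' \<in> L" using choice unfolding region[symmetric] by (rule control_choice_mem(1)[OF l_mem])
  then have "at_vertex q s'" using repr_after by (simp add: at_vertex_def q_def)
  moreover have "automaton_step \<sigma> (location p) (delay ?v d) (location q) (automaton_clocks q)"
    using rule at_s unfolding automaton_step_def by (auto simp: q_def at_vertex_def)
  moreover have "control_step \<sigma> (memory p) (delay ?\<mu> d) (memory q) (controller_clocks q)"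
    using choice unfolding control_step_def region by (auto simp: q_def)
  ultimately show thesis
    using delay_nonneg flag c_eq by (intro that[of d \<sigma> q]) (simp_all add: product_step_def q_def)
qed

lemma infinitely_many_flags_iff:
  assumes "\<And>i. flag_step (\<sigma> i) (s i) (s (Suc i))"
  shows "(\<exists>\<^sub>\<infinity>i. \<sigma> i \<noteq> None \<and> vertex_flag (s i)) \<longleftrightarrow>
    (\<exists>\<^sub>\<infinity>i. vertex_location (s i) \<in> set (ta_final T)) \<and> (\<exists>\<^sub>\<infinity>i. \<sigma> i \<noteq> None)"
  by (rule infinitely_often_since_iff) (use assms in \<open>simp add: flag_step_def\<close>)

lemma flagged_path_of_product_run:
  assumes run: "product_run p d \<sigma>"
  shows "\<not> finitely_flagged (strategy_graph L abstract_move) ({l\<^sub>0} \<times> initial_vertices)"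
proof -
  have start: "initial_config (p 0)" and step: "\<And>i. product_step (d i) (\<sigma> i) (p i) (p (Suc i))"
    and final: "\<exists>\<^sub>\<infinity>i. location (p i) \<in> set (ta_final T)" and letters: "\<exists>\<^sub>\<infinity>i. \<sigma> i \<noteq> None"
    using run by (auto simp: product_run_def)
  define P where "P i s \<longleftrightarrow> at_vertex (p i) s \<and> s < num_vertices n U \<and> vertex_grid s < U \<and>
    (i = 0 \<longrightarrow> s \<in> initial_vertices)" for i s
  define R where "R i s s' \<longleftrightarrow> flag_step (\<sigma> i) s s' \<and>
    ((memory (p i), s), \<sigma> i \<noteq> None \<and> vertex_flag s,
      (memory (p (Suc i)), s')) \<in> strategy_graph L abstract_move" for i s s'
  have "\<exists>s. \<forall>i. P i (s i) \<and> R i (s i) (s (Suc i))"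
  proof (rule dependent_nat_choice)
    have "location (p 0) \<in> set (ta_init T)" using start by (simp add: initial_config_def)
    moreover from this have "location (p 0) < n" by (rule init)
    ultimately have "P 0 (vertex (location (p 0)) False 0)"
      using start represents_zero U_pos controller
      by (auto simp: P_def at_vertex_def initial_config_def initial_vertices_def is_controller_def
          intro!: vertex_less)
    then show "\<exists>s. P 0 s" ..
    fix i s assume "P i s"
    then show "\<exists>s'. P (Suc i) s' \<and> R i s s'"
      using edge_of_product_step[OF step] unfolding P_def R_def by (metis old.nat.distinct(2))
  qed
  then obtain s where path: "\<And>i. P i (s i)" "\<And>i. R i (s i) (s (Suc i))" by blast
  then have flags: "\<exists>\<^sub>\<infinity>i. \<sigma> i \<noteq> None \<and> vertex_flag (s i)"
    using infinitely_many_flags_iff[of \<sigma> s] final letters by (simp add: P_def R_def at_vertex_def)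
  show ?thesis
  proof (rule not_finitely_flaggedI)
    show "(memory (p 0), s 0) \<in> {l\<^sub>0} \<times> initial_vertices"
      using path(1)[of 0] start by (simp add: P_def initial_config_def)
    show "((memory (p i), s i), \<sigma> i \<noteq> None \<and> vertex_flag (s i), (memory (p (Suc i)), s (Suc i)))
        \<in> strategy_graph L abstract_move" for i
      using path(2)[of i] by (simp only: R_def)
  qed (rule flags)
qed

lemma product_run_of_flagged_path:
  assumes "\<not> finitely_flagged (strategy_graph L abstract_move) ({l\<^sub>0} \<times> initial_vertices)"
  shows "\<exists>p d \<sigma>. product_run p d \<sigma>"
proof -
  obtain f c where initial: "f 0 \<in> {l\<^sub>0} \<times> initial_vertices"
    and path: "\<And>i. (f i, c i, f (Suc i)) \<in> strategy_graph L abstract_move" and flags: "\<exists>\<^sub>\<infinity>i. c i"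
    using assms by (rule not_finitely_flaggedE) (rule that)
  define s where "s i = snd (f i)" for i
  define P where "P i p \<longleftrightarrow>
      at_vertex p (s i) \<and> memory p = fst (f i) \<and> (i = 0 \<longrightarrow> initial_config p)" for i p
  define R where "R i p q \<longleftrightarrow> (\<exists>d \<sigma>. product_step d \<sigma> p q \<and> flag_step \<sigma> (s i) (s (Suc i)) \<and>
    c i = (\<sigma> \<noteq> None \<and> vertex_flag (s i)))" for i p q
  have "\<exists>p. \<forall>i. P i (p i) \<and> R i (p i) (p (Suc i))"
  proof (rule dependent_nat_choice)
    obtain p\<^sub>0 where "p\<^sub>0 \<in> set (ta_init T)" "s 0 = vertex p\<^sub>0 False 0"
      using initial by (auto simp: s_def initial_vertices_def)
    then have "P 0 \<lparr>location = p\<^sub>0, automaton_clocks = \<lambda>_. 0,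
        memory = l\<^sub>0, controller_clocks = \<lambda>_. 0\<rparr>"
      using initial represents_zero controller
      by (auto simp: P_def at_vertex_def initial_config_def is_controller_def)
    then show "\<exists>p. P 0 p" ..
    fix i p assume at_p: "P i p"
    then have "((memory p, s i), c i, (fst (f (Suc i)), s (Suc i))) \<in> strategy_graph L abstract_move"
      and "at_vertex p (s i)" using path[of i] by (simp_all add: P_def s_def)
    then obtain d \<sigma> q where "product_step d \<sigma> p q" "at_vertex q (s (Suc i))"
      "memory q = fst (f (Suc i))"
      "flag_step \<sigma> (s i) (s (Suc i))" "c i = (\<sigma> \<noteq> None \<and> vertex_flag (s i))"
      by (rule product_step_of_edge)
    then have "P (Suc i) q" "R i p q" unfolding P_def R_def by blast+
    then show "\<exists>q. P (Suc i) q \<and> R i p q" by blast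
  qed
  then obtain p where at_p: "\<And>i. P i (p i)" and "\<forall>i. R i (p i) (p (Suc i))" by blast
  then obtain d \<sigma> where step: "\<And>i. product_step (d i) (\<sigma> i) (p i) (p (Suc i))"
    and flag: "\<And>i. flag_step (\<sigma> i) (s i) (s (Suc i))"
    and c_eq: "\<And>i. c i = (\<sigma> i \<noteq> None \<and> vertex_flag (s i))"
    unfolding R_def by metis
  have "(\<exists>\<^sub>\<infinity>i. location (p i) \<in> set (ta_final T)) \<and> (\<exists>\<^sub>\<infinity>i. \<sigma> i \<noteq> None)"
    using infinitely_many_flags_iff[of \<sigma> s] flag flags at_p by (simp add: c_eq P_def at_vertex_def)
  then have "product_run p d \<sigma>" using step at_p[of 0] by (simp add: product_run_def P_def)
  then show ?thesis by blast
qed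

theorem winning_controller_iff:
  "winning_controller k m (na, nb, T) L l\<^sub>0 \<delta> \<longleftrightarrow> winning L l\<^sub>0 abstract_move"
  using controller strategy_abstract_move ex_play_in_timed_lang_iff_product_run
    flagged_path_of_product_run product_run_of_flagged_path
  by (auto simp: winning_controller_def winning_def)

end

context instance_game
begin

lemma has_winning_controller_if_winning:
  assumes win: "winning (L :: nat set) l\<^sub>0 \<tau>"
  shows "has_winning_controller k m (na, nb, T)"
proof -
  define rep where "rep r = (if \<exists>\<rho><U. controller_region \<rho> 0 = r
    then SOME \<rho>. \<rho> < U \<and> controller_region \<rho> 0 = r else 0)" for r
  have rep_less: "rep r < U" for r
    unfolding rep_def using someI_ex[of "\<lambda>\<rho>. \<rho> < U \<and> controller_region \<rho> 0 = r"] U_pos by auto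
  have rep_region: "controller_region (rep (controller_region \<rho> 0)) 0 = controller_region \<rho> 0"
    if "\<rho> < U" for \<rho>
    unfolding rep_def
    using someI_ex[of "\<lambda>\<rho>'. \<rho>' < U \<and> controller_region \<rho>' 0 = controller_region \<rho> 0"] that by auto
  define \<delta> where "\<delta> l a r = (case \<tau> l (a, rep r) of (l', b, Y) \<Rightarrow> (l', b, set_decode Y))" for l a r
  have \<tau>_mem: "\<tau> l (a, rep r) \<in> L \<times> ({..<nb} \<times> {..<2 ^ k})" if "l \<in> L" "a < na" for l a r
    using win that rep_less by (simp add: winning_def strategy_def)
  interpret instance_controller k m na nb T n U L l\<^sub>0 \<delta>
  proof
    have "\<delta> l a r \<in> L \<times> {0..<nb} \<times> Pow {0..<k}" if "l \<in> L" "a < na" for l a r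
    proof -
      obtain l' b Y where "\<tau> l (a, rep r) = (l', b, Y)" using prod_cases3 by blast
      then show ?thesis
        using \<tau>_mem[OF that, of r] set_decode_subset_lessThan[of Y k]
        by (simp add: \<delta>_def lessThan_atLeast0)
    qed
    then show "is_controller k m {0..<na} {0..<nb} L l\<^sub>0 \<delta>"
      using win by (simp add: is_controller_def winning_def strategy_def)
  qed
  define r where "r x = (fst x, rep (controller_region (snd x) 0))" for x :: "nat \<times> nat"
  have "winning L l\<^sub>0 (\<lambda>l x. \<tau> l (r x))"
    using win by (rule winning_reindex) (auto simp: r_def rep_less rep_region letter_edges_def)
  moreover have "abstract_move = (\<lambda>l x. \<tau> l (r x))"
    by (auto simp: abstract_move_def \<delta>_def r_def fun_eq_iff split: prod.splits)
  ultimately show ?thesis using winning_controller_iff by (auto simp: has_winning_controller_def)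
qed

theorem has_winning_controller_iff_budget_family:
  "has_winning_controller k m (na, nb, T) \<longleftrightarrow> (\<exists>W. budget_family W \<and> small_family W)"
proof
  assume "has_winning_controller k m (na, nb, T)"
  then obtain L l\<^sub>0 \<delta> where win: "winning_controller k m (na, nb, T) L l\<^sub>0 \<delta>"
    by (auto simp: has_winning_controller_def)
  then interpret instance_controller k m na nb T n U L l\<^sub>0 \<delta>
    by unfold_locales (simp add: winning_controller_def)
  show "\<exists>W. budget_family W \<and> small_family W"
    using win unfolding winning_controller_iff by (rule small_budget_family_if_winning)
next
  assume "\<exists>W. budget_family W \<and> small_family W"
  then obtain W where "budget_family W" "finite W" by (auto simp: small_family_def)
  then show "has_winning_controller k m (na, nb, T)"
    by (rule winning_if_budget_family) (rule has_winning_controller_if_winning)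
qed

end

section \<open>The decision procedure on codes\<close>

subsection \<open>Grid points\<close>

lemma computable_zero_ext [computable_intros]:
  assumes "computable (\<lambda>p. f (fst_decode p) (snd_decode p))" "computable c" "computable x"
  shows "computable (\<lambda>e. zero_ext (c e) (f e) (x e))"
  unfolding zero_ext_def by (intro computable_curry[OF assms(1)] computable_intros assms(2,3))

text \<open>Integer differences are split by sign to avoid negative numbers.\<close>

lemma region_equiv_of_nat_div_iff:
  fixes f g :: "nat \<Rightarrow> nat"
  assumes w_pos: "0 < w"
  shows "region_equiv {0..<C} M (\<lambda>x. real (f x) / real w) (\<lambda>x. real (g x) / real w) \<longleftrightarrow>
    (\<forall>x\<le>C. \<forall>y\<le>C. \<forall>z\<le>M.
      (zero_ext C f x < zero_ext C f y + w * z \<longleftrightarrow> zero_ext C g x < zero_ext C g y + w * z) \<and>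
      (zero_ext C f x + w * z < zero_ext C f y \<longleftrightarrow> zero_ext C g x + w * z < zero_ext C g y))"
proof -
  have ext: "zero_ext C (\<lambda>x. real (h x) / real w) x = real (zero_ext C h x) / real w" for h x
    by (simp add: zero_ext_def)
  have pos: "real a / real w - real b / real w < of_int (int z) \<longleftrightarrow> a < b + w * z" for a b z
  proof -
    have "real a / real w - real b / real w < of_int (int z) \<longleftrightarrow> real a < real (b + w * z)"
      using w_pos by (simp add: field_simps)
    then show ?thesis by (simp only: of_nat_less_iff)
  qed
  have neg: "real a / real w - real b / real w < of_int (- int z) \<longleftrightarrow> a + w * z < b" for a b z
  proof -
    have "real a / real w - real b / real w < of_int (- int z) \<longleftrightarrow> real (a + w * z) < real b"
      using w_pos by (simp add: field_simps)
    then show ?thesis by (simp only: of_nat_less_iff)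
  qed
  have split: "(\<forall>z. \<bar>z\<bar> \<le> int M \<longrightarrow> P z) \<longleftrightarrow> (\<forall>z\<le>M. P (int z) \<and> P (- int z))" for P
  proof (intro iffI allI impI)
    fix z assume "\<forall>z\<le>M. P (int z) \<and> P (- int z)" "\<bar>z\<bar> \<le> int M"
    then show "P z" by (cases z rule: int_cases2) auto
  qed auto
  show ?thesis unfolding region_equiv_iff split ext pos neg ..
qed

lemma decidable_region_equiv_of_nat_div:
  assumes "computable (\<lambda>p. f (fst_decode p) (snd_decode p))"
    "computable (\<lambda>p. g (fst_decode p) (snd_decode p))"
    and "computable w" and w_pos: "\<And>e. 0 < w e" and "computable c" "computable b"
  shows "decidable (\<lambda>e. region_equiv {0..<c e} (b e)
    (\<lambda>x. real (f e x) / real (w e)) (\<lambda>x. real (g e x) / real (w e)))"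
  unfolding region_equiv_of_nat_div_iff[OF w_pos]
  by (intro computable_intros computable_curry[OF assms(1)] computable_curry[OF assms(2)]
      assms(3,5,6)[THEN computable_compose])

lemma decidable_region_equiv_reset_grid [computable_intros]:
  assumes decidable_Y: "decidable (\<lambda>p. snd_decode p \<in> Y (fst_decode p))"
    and "computable c" "computable b" "computable u" "computable j" "computable u'" "computable j'"
  shows "decidable (\<lambda>e. region_equiv {0..<c e} (b e)
    (reset (Y e) (delayed_grid_point (c e) (u e) (j e))) (delayed_grid_point (c e) (u' e) (j' e)))"
proof -
  have "reset A (delayed_grid_point C u j) =
      (\<lambda>x. real (if x \<in> A then 0 else 2 * nth_code u x + j) / real (2 * Suc C))" for A C u j
    by (auto simp: reset_def delayed_grid_point_def)
  moreover have "delayed_grid_point C u j = (\<lambda>x. real (2 * nth_code u x + j) / real (2 * Suc C))"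
    for C u j
    by (auto simp: delayed_grid_point_def)
  ultimately show ?thesis
    by (simp only:) (intro decidable_region_equiv_of_nat_div computable_intros decidable_Y
        assms(2-)[THEN computable_compose], simp)
qed

lemma decidable_region_equiv_shifted_grid:
  assumes "computable n" "computable c" "computable u" "computable j" "computable u'"
    "computable j'"
  shows "decidable (\<lambda>e. region_equiv {0..<k} m (\<lambda>x. delayed_grid_point (c e) (u e) (j e) (n e + x))
    (\<lambda>x. delayed_grid_point (c e) (u' e) (j' e) (n e + x)))"
  unfolding delayed_grid_point_def
  by (intro decidable_region_equiv_of_nat_div computable_intros assms[THEN computable_compose]) simp

lemma computable_max_delay [computable_intros]:
  "computable f \<Longrightarrow> computable g \<Longrightarrow> computable (\<lambda>e. max_delay (f e) (g e))"
  unfolding max_delay_def by (intro computable_intros)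

lemma decidable_grid_closed [computable_intros]:
  assumes "computable c" "computable b" "computable f"
  shows "decidable (\<lambda>e. grid_closed (c e) (b e) (f e))"
  unfolding grid_closed_def by (intro computable_intros assms[THEN computable_compose])

subsection \<open>Clock constraints\<close>

lemma list_encode_eq_iff:
  "c = list_encode [a] \<longleftrightarrow> length_code c = 1 \<and> nth_code c 0 = a"
  "c = list_encode [a, b] \<longleftrightarrow> length_code c = 2 \<and> nth_code c 0 = a \<and> nth_code c 1 = b"
  "c = list_encode [a, b, x] \<longleftrightarrow>
      length_code c = 3 \<and> nth_code c 0 = a \<and> nth_code c 1 = b \<and> nth_code c 2 = x"
  "c = list_encode [a, b, x, y] \<longleftrightarrow> length_code c = 4 \<and> nth_code c 0 = a \<and> nth_code c 1 = b \<and>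
    nth_code c 2 = x \<and> nth_code c 3 = y"
  "c = list_encode [a, b, x, y, z] \<longleftrightarrow> length_code c = 5 \<and> nth_code c 0 = a \<and> nth_code c 1 = b \<and>
    nth_code c 2 = x \<and> nth_code c 3 = y \<and> nth_code c 4 = z"
  "c = list_encode [a, b, x, y, z, u] \<longleftrightarrow> length_code c = 6 \<and> nth_code c 0 = a \<and> nth_code c 1 = b \<and>
    nth_code c 2 = x \<and> nth_code c 3 = y \<and> nth_code c 4 = z \<and> nth_code c 5 = u"
  unfolding eq_commute[of c] list_encode_eq_iff_nth_code by (auto simp: All_less_Suc numeral_eq_Suc)

lemma ex_cmp_iff: "(\<exists>r. P r) \<longleftrightarrow> P CLt \<or> P CLe \<or> P CEq \<or> P CGe \<or> P CGt"
  by (metis cmp.exhaust)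

lemma ex_cc_iff:
  "(\<exists>\<phi>. P \<phi>) \<longleftrightarrow> P CTrue \<or> (\<exists>x r z. P (CAtom x r z)) \<or> (\<exists>x y r z. P (CDiff x y r z)) \<or>
    (\<exists>\<phi>. P (CNot \<phi>)) \<or> (\<exists>\<phi> \<psi>. P (CAnd \<phi> \<psi>)) \<or> (\<exists>\<phi> \<psi>. P (COr \<phi> \<psi>))"
  by (metis cc.exhaust)

lemma ex_int_encode_iff: "(\<exists>z. c = int_encode z \<and> P z) \<longleftrightarrow> P (int_decode c)"
  by (metis int_decode_inverse int_encode_inverse)

lemma enc_cmp_inject [simp]: "enc_cmp r = enc_cmp r' \<longleftrightarrow> r = r'"
  by (cases r; cases r') auto

lemma enc_cc_inject [simp]: "enc_cc \<phi> = enc_cc \<psi> \<longleftrightarrow> \<phi> = \<psi>"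
proof (induction \<phi> arbitrary: \<psi>)
  case CTrue
  then show ?case by (cases \<psi>) (auto simp: list_encode_eq simp del: list_encode.simps)
next
  case (CAtom x r z)
  then show ?case by (cases \<psi>) (auto simp: list_encode_eq int_encode_eq simp del: list_encode.simps)
next
  case (CDiff x y r z)
  then show ?case by (cases \<psi>) (auto simp: list_encode_eq int_encode_eq simp del: list_encode.simps)
next
  case (CNot \<phi>)
  then show ?case by (cases \<psi>) (auto simp: list_encode_eq simp del: list_encode.simps)
next
  case (CAnd \<phi>\<^sub>1 \<phi>\<^sub>2)
  then show ?case by (cases \<psi>) (auto simp: list_encode_eq simp del: list_encode.simps)
next
  case (COr \<phi>\<^sub>1 \<phi>\<^sub>2)
  then show ?case by (cases \<psi>) (auto simp: list_encode_eq simp del: list_encode.simps)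
qed

lemma enc_cc_pos: "0 < enc_cc \<phi>"
  by (cases \<phi>) auto

definition cc_code :: "nat \<Rightarrow> bool" where
  "cc_code c \<longleftrightarrow> (\<exists>\<phi>. c = enc_cc \<phi>)"

definition sat_code :: "valuation \<Rightarrow> nat \<Rightarrow> bool" where
  "sat_code v c \<longleftrightarrow> (\<exists>\<phi>. c = enc_cc \<phi> \<and> sat \<phi> v)"

lemma sat_code_enc_cc [simp]: "sat_code v (enc_cc \<phi>) \<longleftrightarrow> sat \<phi> v"
  by (simp add: sat_code_def)

definition cc_code_body :: "nat \<Rightarrow> (nat \<Rightarrow> bool) \<Rightarrow> bool" where
  "cc_code_body c h \<longleftrightarrow>
     length_code c = 1 \<and> nth_code c 0 = 0 \<or>
     length_code c = 4 \<and> nth_code c 0 = 1 \<and> nth_code c 2 < 5 \<or>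
     length_code c = 5 \<and> nth_code c 0 = 2 \<and> nth_code c 3 < 5 \<or>
     length_code c = 2 \<and> nth_code c 0 = 3 \<and> h 1 \<or>
     length_code c = 3 \<and> nth_code c 0 = 4 \<and> h 1 \<and> h 2 \<or>
     length_code c = 3 \<and> nth_code c 0 = 5 \<and> h 1 \<and> h 2"

lemma cc_code_rec: "cc_code c \<longleftrightarrow> cc_code_body c (\<lambda>i. cc_code (nth_code c i))"
proof -
  have cmp: "(\<exists>r. x = enc_cmp r) \<longleftrightarrow> x < 5" for x unfolding ex_cmp_iff by auto
  have int: "\<exists>z. x = int_encode z" for x by (metis int_decode_inverse)
  show ?thesis
    unfolding cc_code_def[of c] ex_cc_iff[of "\<lambda>\<phi>. c = enc_cc \<phi>"]
      enc_cc.simps list_encode_eq_iff cc_code_body_def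
    by (simp add: cc_code_def cmp int)
qed

text \<open>\<open>cmp_sem_code r a b\<close> is \<open>a \<sim> b\<close> for the comparison \<open>\<sim>\<close> coded by \<open>r\<close>; an integer coded by \<open>z\<close>
  is the difference of \<open>pos_part z\<close> and \<open>neg_part z\<close>.\<close>

definition cmp_sem_code :: "nat \<Rightarrow> nat \<Rightarrow> nat \<Rightarrow> bool" where
  "cmp_sem_code r a b \<longleftrightarrow>
     r = 0 \<and> a < b \<or> r = 1 \<and> a \<le> b \<or> r = 2 \<and> a = b \<or> r = 3 \<and> b \<le> a \<or> r = 4 \<and> b < a"

definition pos_part :: "nat \<Rightarrow> nat" where "pos_part z = (if even z then z div 2 else 0)"
definition neg_part :: "nat \<Rightarrow> nat" where "neg_part z = (if even z then 0 else Suc (z div 2))"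

lemma int_decode_eq_diff: "real_of_int (int_decode z) = real (pos_part z) - real (neg_part z)"
  by (simp add: int_decode_def sum_decode_def pos_part_def neg_part_def)

lemma ex_cmp_sem_iff_cmp_sem_code:
  assumes w_pos: "0 < w"
  shows "(\<exists>r'. r = enc_cmp r' \<and>
      cmp_sem r' (real a / real w - real b / real w) (of_int (int_decode z))) \<longleftrightarrow>
    cmp_sem_code r (a + neg_part z * w) (b + pos_part z * w)"
proof -
  define x y where "x = a + neg_part z * w" and "y = b + pos_part z * w"
  have "real a / real w - real b / real w = of_int (int_decode z) + (real x - real y) / real w"
    using w_pos by (simp add: int_decode_eq_diff x_def y_def field_simps)
  moreover have "cmp_sem r' (t + (real x - real y) / real w) t \<longleftrightarrow>
      cmp_sem r' (real x) (real y)" for r' t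
    using w_pos by (cases r')
      (auto simp: divide_less_0_iff divide_le_0_iff zero_less_divide_iff zero_le_divide_iff)
  ultimately show ?thesis
    unfolding x_def[symmetric] y_def[symmetric] ex_cmp_iff by (simp add: cmp_sem_code_def)
qed

definition sat_code_body :: "nat \<Rightarrow> (nat \<Rightarrow> nat) \<Rightarrow> nat \<Rightarrow> (nat \<Rightarrow> bool) \<Rightarrow> bool" where
  "sat_code_body w t c h \<longleftrightarrow>
     length_code c = 1 \<and> nth_code c 0 = 0 \<or>
     length_code c = 4 \<and> nth_code c 0 = 1 \<and>
       cmp_sem_code (nth_code c 2) (t (nth_code c 1) + neg_part (nth_code c 3) * w)
         (0 + pos_part (nth_code c 3) * w) \<or>
     length_code c = 5 \<and> nth_code c 0 = 2 \<and>
       cmp_sem_code (nth_code c 3) (t (nth_code c 1) + neg_part (nth_code c 4) * w)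
         (t (nth_code c 2) + pos_part (nth_code c 4) * w) \<or>
     length_code c = 2 \<and> nth_code c 0 = 3 \<and> cc_code (nth_code c 1) \<and> \<not> h 1 \<or>
     length_code c = 3 \<and> nth_code c 0 = 4 \<and> h 1 \<and> h 2 \<or>
     length_code c = 3 \<and> nth_code c 0 = 5 \<and> cc_code (nth_code c 1) \<and> cc_code (nth_code c 2) \<and>
       (h 1 \<or> h 2)"

lemma sat_code_rec:
  assumes w_pos: "0 < w" and v_eq: "\<And>x. v x = real (t x) / real w"
  shows "sat_code v c \<longleftrightarrow> sat_code_body w t c (\<lambda>i. sat_code v (nth_code c i))"
proof -
  have cmp: "(\<exists>r. r\<^sub>0 = enc_cmp r \<and> (\<exists>z. z\<^sub>0 = int_encode z \<and>
      cmp_sem r (real a / real w - real b / real w) (of_int z))) \<longleftrightarrow>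
      cmp_sem_code r\<^sub>0 (a + neg_part z\<^sub>0 * w) (b + pos_part z\<^sub>0 * w)" for r\<^sub>0 z\<^sub>0 a b
    unfolding ex_int_encode_iff ex_cmp_sem_iff_cmp_sem_code[OF w_pos] ..
  have neg: "(\<exists>\<phi>. x = enc_cc \<phi> \<and> \<not> sat \<phi> v) \<longleftrightarrow> cc_code x \<and> \<not> sat_code v x" for x
    by (auto simp: sat_code_def cc_code_def)
  have conj: "(\<exists>\<phi> \<psi>. x = enc_cc \<phi> \<and> y = enc_cc \<psi> \<and> sat \<phi> v \<and> sat \<psi> v) \<longleftrightarrow>
      sat_code v x \<and> sat_code v y" for x y
    by (auto simp: sat_code_def)
  have disj: "(\<exists>\<phi> \<psi>. x = enc_cc \<phi> \<and> y = enc_cc \<psi> \<and> (sat \<phi> v \<or> sat \<psi> v)) \<longleftrightarrow>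
      cc_code x \<and> cc_code y \<and> (sat_code v x \<or> sat_code v y)" for x y
    by (auto simp: sat_code_def cc_code_def)
  show ?thesis
    unfolding sat_code_def[of v c] ex_cc_iff[of "\<lambda>\<phi>. c = enc_cc \<phi> \<and> sat \<phi> v"]
      enc_cc.simps list_encode_eq_iff sat_code_body_def
      cmp[symmetric] neg[symmetric] conj[symmetric] disj[symmetric]
    by (simp add: v_eq)
qed

lemma computable_pos_part [computable_intros]: "computable f \<Longrightarrow> computable (\<lambda>e. pos_part (f e))"
  unfolding pos_part_def by (intro computable_intros)

lemma computable_neg_part [computable_intros]: "computable f \<Longrightarrow> computable (\<lambda>e. neg_part (f e))"
  unfolding neg_part_def by (intro computable_intros)

lemma decidable_cmp_sem_code [computable_intros]:
  "computable f \<Longrightarrow> computable g \<Longrightarrow> computable h \<Longrightarrow> decidable (\<lambda>e. cmp_sem_code (f e) (g e) (h e))"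
  unfolding cmp_sem_code_def by (intro computable_intros)

lemma decidable_cc_code [computable_intros]:
  assumes "computable f" shows "decidable (\<lambda>e. cc_code (f e))"
proof -
  have "decidable (\<lambda>p. cc_code (snd_decode p))"
  proof (rule decidable_code_recursion)
    show "\<not> cc_code 0" using enc_cc_pos by (auto simp: cc_code_def)
    show "cc_code c \<longleftrightarrow> cc_code_body c (\<lambda>i. cc_code (nth_code c i))" for c by (rule cc_code_rec)
    show "decidable (\<lambda>p. cc_code_body (fst_decode (snd_decode p)) (H p))"
      if decidable_H: "decidable (\<lambda>p. H (fst_decode p) (snd_decode p))" for H
      unfolding cc_code_body_def by (intro computable_intros decidable_curry[OF decidable_H])
  qed
  from decidable_curry[OF this computable_const assms] show ?thesis .
qed

lemma decidable_sat_code [computable_intros]: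
  assumes "computable f" "computable c" "computable u" "computable j"
  shows "decidable (\<lambda>e. sat_code (delayed_grid_point (c e) (u e) (j e)) (f e))"
proof -
  define w where "w e = 2 * Suc (fst_decode e)" for e
  define t where
    "t e x = 2 * nth_code (fst_decode (snd_decode e)) x + snd_decode (snd_decode e)" for e x
  define v where "v e x = real (t e x) / real (w e)" for e x
  have "decidable (\<lambda>p. sat_code (v (fst_decode p)) (snd_decode p))"
  proof (rule decidable_code_recursion)
    show "\<not> sat_code (v e) 0" for e using enc_cc_pos by (auto simp: sat_code_def)
    show "sat_code (v e) c \<longleftrightarrow>
        sat_code_body (w e) (t e) c (\<lambda>i. sat_code (v e) (nth_code c i))" for e c
      by (rule sat_code_rec) (simp_all add: w_def v_def)
    show "decidable (\<lambda>p. sat_code_body (w (fst_decode p)) (t (fst_decode p))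
        (fst_decode (snd_decode p)) (H p))"
      if decidable_H: "decidable (\<lambda>p. H (fst_decode p) (snd_decode p))" for H
      unfolding sat_code_body_def w_def t_def
      by (intro computable_intros decidable_curry[OF decidable_H])
  qed
  moreover have "computable (\<lambda>e. prod_encode (c e, prod_encode (u e, j e)))"
    using assms by (intro computable_intros)
  ultimately have "decidable (\<lambda>e. sat_code (v (prod_encode (c e, prod_encode (u e, j e)))) (f e))"
    using assms(1) by (rule decidable_curry)
  moreover have
    "v (prod_encode (c e, prod_encode (u e, j e))) = delayed_grid_point (c e) (u e) (j e)" for e
    by (rule ext) (simp only: v_def t_def w_def delayed_grid_point_def prod_encode_inverse prod.sel)
  ultimately show ?thesis by simp
qed

subsection \<open>Codes of instances\<close>

lemma ex_enc_letter: "\<exists>\<sigma>. c = enc_letter \<sigma>"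
proof (cases c)
  case 0
  then show ?thesis by (metis enc_letter.simps(1))
next
  case (Suc x)
  then have "c = enc_letter (Some (prod_decode x))"
    by (cases "prod_decode x") (metis enc_letter.simps(2) prod_decode_inverse)
  then show ?thesis ..
qed

lemma enc_letter_inject [simp]: "enc_letter \<sigma> = enc_letter \<sigma>' \<longleftrightarrow> \<sigma> = \<sigma>'"
  by (cases \<sigma> rule: enc_letter.cases; cases \<sigma>' rule: enc_letter.cases) auto

lemma ex_enc_rule_iff: "(\<exists>r. c = enc_rule r) \<longleftrightarrow> length_code c = 5 \<and> cc_code (nth_code c 2)"
proof -
  have "\<exists>Y. x = list_encode Y" for x by (metis list_decode_inverse)
  then show ?thesis
    unfolding split_paired_Ex enc_rule.simps list_encode_eq_iff
    by (simp add: ex_enc_letter cc_code_def)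
qed

definition instance_code :: "nat \<Rightarrow> bool" where
  "instance_code n \<longleftrightarrow> length_code n = 6 \<and>
    (\<forall>c\<in>set (list_decode (nth_code n 5)). length_code c = 5 \<and> cc_code (nth_code c 2))"

lemma instance_code_iff: "instance_code n \<longleftrightarrow> (\<exists>I. n = enc_instance I)"
proof
  assume n_eq: "instance_code n"
  then have "\<forall>c\<in>set (list_decode (nth_code n 5)). \<exists>r. c = enc_rule r"
    unfolding ex_enc_rule_iff by (simp add: instance_code_def)
  then obtain rs where rules_eq: "list_decode (nth_code n 5) = map enc_rule rs"
    unfolding ex_map_conv[symmetric] ..
  have "n = enc_instance (nth_code n 0, nth_code n 1, \<lparr>ta_clocks = nth_code n 2,
      ta_init = list_decode (nth_code n 3), ta_final = list_decode (nth_code n 4), ta_rules = rs\<rparr>)"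
    using n_eq unfolding enc_instance.simps list_encode_eq_iff
    by (simp add: rules_eq[symmetric] instance_code_def)
  then show "\<exists>I. n = enc_instance I" ..
next
  assume "\<exists>I. n = enc_instance I"
  then obtain na nb T where n_eq: "n = enc_instance (na, nb, T)" by (metis prod_cases3)
  then have "length_code n = 6" "nth_code n 5 = list_encode (map enc_rule (ta_rules T))"
    unfolding enc_instance.simps list_encode_eq_iff by simp_all
  moreover have "length_code (enc_rule r) = 5 \<and> cc_code (nth_code (enc_rule r) 2)" for r
    using ex_enc_rule_iff by blast
  ultimately show "instance_code n"
    by (simp add: instance_code_def del: enc_rule.simps list_encode.simps)
qed

lemma abs_le_int_encode: "\<bar>z\<bar> \<le> int (int_encode z)"
  by (auto simp: int_encode_def sum_encode_def)

lemma cc_over_if_enc_cc_le: "enc_cc \<phi> \<le> N \<Longrightarrow> cc_over {0..<N} N \<phi>"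
proof (induction \<phi>)
  case (CAtom x r z)
  have "x < enc_cc (CAtom x r z)" "int_encode z < enc_cc (CAtom x r z)"
    unfolding enc_cc.simps by (rule less_list_encode_of_mem, simp)+
  then show ?case using CAtom abs_le_int_encode[of z] by auto
next
  case (CDiff x y r z)
  have "x < enc_cc (CDiff x y r z)" "y < enc_cc (CDiff x y r z)"
    "int_encode z < enc_cc (CDiff x y r z)"
    unfolding enc_cc.simps by (rule less_list_encode_of_mem, simp)+
  then show ?case using CDiff abs_le_int_encode[of z] by auto
next
  case (CNot \<phi>)
  have "enc_cc \<phi> < enc_cc (CNot \<phi>)" unfolding enc_cc.simps by (rule less_list_encode_of_mem) simp
  then show ?case using CNot by simp
next
  case (CAnd \<phi> \<psi>)
  have "enc_cc \<phi> < enc_cc (CAnd \<phi> \<psi>)" "enc_cc \<psi> < enc_cc (CAnd \<phi> \<psi>)"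
    unfolding enc_cc.simps by (rule less_list_encode_of_mem, simp)+
  then show ?case using CAnd by simp
next
  case (COr \<phi> \<psi>)
  have "enc_cc \<phi> < enc_cc (COr \<phi> \<psi>)" "enc_cc \<psi> < enc_cc (COr \<phi> \<psi>)"
    unfolding enc_cc.simps by (rule less_list_encode_of_mem, simp)+
  then show ?case using COr by simp
qed simp

locale coded_instance_game = instance_game k m na nb T n U
  for k m na nb :: nat and T :: ta and n U :: nat +
  assumes n_eq: "n = enc_instance (na, nb, T)"

lemma coded_instance_gameI:
  assumes n_eq: "n = enc_instance (na, nb, T)" and closed: "grid_closed (n + k) (n + m) U"
  shows "coded_instance_game k m na nb T n U"
proof
  have less: "x < n" if "x \<in> set [na, nb, ta_clocks T, list_encode (ta_init T),
      list_encode (ta_final T), list_encode (map enc_rule (ta_rules T))]" for x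
    unfolding n_eq enc_instance.simps using that by (rule less_list_encode_of_mem)
  show "ta_clocks T \<le> n" using less[of "ta_clocks T"] by simp
  show "p < n" if "p \<in> set (ta_init T)" for p
    using less_list_encode_of_mem[OF that] less[of "list_encode (ta_init T)"] by simp
  fix p \<sigma> \<phi> Y q assume "(p, \<sigma>, \<phi>, Y, q) \<in> set (ta_rules T)"
  then have "enc_rule (p, \<sigma>, \<phi>, Y, q) < list_encode (map enc_rule (ta_rules T))"
    by (intro less_list_encode_of_mem) force
  also have "\<dots> < n" by (rule less) simp
  finally have "x < n" if "x \<in> set [p, enc_letter \<sigma>, enc_cc \<phi>, list_encode Y, q]" for x
    using less_list_encode_of_mem[OF that] by simp
  from this[of p] this[of q] this[of "enc_cc \<phi>"] show "p < n \<and> q < n \<and> cc_over {0..<n} n \<phi>"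
    using cc_over_if_enc_cc_le[of \<phi> n] by simp
qed (rule closed n_eq)+

subsection \<open>The game graph on codes\<close>

lemma computable_vertex [computable_intros]:
  "computable f \<Longrightarrow> decidable P \<Longrightarrow> computable g \<Longrightarrow> computable (\<lambda>e. vertex (f e) (P e) (g e))"
  unfolding vertex_def by (intro computable_intros)

lemma computable_vertex_location [computable_intros]:
  "computable f \<Longrightarrow> computable (\<lambda>e. vertex_location (f e))"
  unfolding vertex_location_def by (intro computable_intros)

lemma decidable_vertex_flag [computable_intros]: "computable f \<Longrightarrow> decidable (\<lambda>e. vertex_flag (f e))"
  unfolding vertex_flag_def by (intro computable_intros)

lemma computable_vertex_grid [computable_intros]:
  "computable f \<Longrightarrow> computable (\<lambda>e. vertex_grid (f e))"
  unfolding vertex_grid_def by (intro computable_intros)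

lemma computable_num_vertices [computable_intros]:
  "computable f \<Longrightarrow> computable g \<Longrightarrow> computable (\<lambda>e. num_vertices (f e) (g e))"
  unfolding num_vertices_def by (intro computable_intros)

lemma decidable_mem_Un_image_plus [computable_intros]:
  assumes "computable f" "computable n"
    and "decidable (\<lambda>e. f e \<in> A e)" "decidable (\<lambda>e. f e - n e \<in> B e)"
  shows "decidable (\<lambda>e. f e \<in> A e \<union> (+) (n e) ` B e)"
proof -
  have "x \<in> A \<union> (+) n ` B \<longleftrightarrow> x \<in> A \<or> n \<le> x \<and> x - n \<in> B" for x n :: nat and A B
    by (force intro: image_eqI[of _ _ "x - n"])
  then show ?thesis using assms by (simp only:) (intro computable_intros)
qed

context
  fixes k m :: nat
begin

definition vertex_step_code :: "nat \<Rightarrow> nat \<Rightarrow> nat \<Rightarrow> nat \<Rightarrow> nat \<Rightarrow> nat \<Rightarrow> bool" where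
  "vertex_step_code n \<sigma> B j s s' \<longleftrightarrow> (\<exists>r\<in>set (list_decode (nth_code n 5)).
     nth_code r 0 = vertex_location s \<and> nth_code r 1 = \<sigma> \<and> nth_code r 4 = vertex_location s' \<and>
     (\<forall>x\<in>set (list_decode (nth_code r 3)). x < nth_code n 2) \<and>
     sat_code (delayed_grid_point (n + k) (vertex_grid s) j) (nth_code r 2) \<and>
     region_equiv {0..<n + k} (n + m)
       (reset (set (list_decode (nth_code r 3)) \<union> (+) n ` set_decode B)
         (delayed_grid_point (n + k) (vertex_grid s) j))
       (grid_point (n + k) (vertex_grid s')))"

definition silent_edge_code :: "nat \<Rightarrow> nat \<Rightarrow> nat \<Rightarrow> bool" where
  "silent_edge_code n s s' \<longleftrightarrow>
     (vertex_flag s' \<longleftrightarrow> vertex_location s' \<in> set (list_decode (nth_code n 4)) \<or> vertex_flag s) \<and>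
     (\<exists>j\<le>max_delay (n + k) (n + m). vertex_step_code n 0 0 j s s')"

definition letter_edge_code :: "nat \<Rightarrow> nat \<Rightarrow> nat \<Rightarrow> nat \<Rightarrow> nat \<Rightarrow> nat \<Rightarrow> nat \<Rightarrow> bool" where
  "letter_edge_code n a \<rho> b Y s s' \<longleftrightarrow>
     (vertex_flag s' \<longleftrightarrow> vertex_location s' \<in> set (list_decode (nth_code n 4))) \<and>
     (\<exists>j\<le>max_delay (n + k) (n + m). vertex_step_code n (Suc (prod_encode (a, b))) Y j s s' \<and>
       region_equiv {0..<k} m (\<lambda>x. delayed_grid_point (n + k) (vertex_grid s) j (n + x))
         (\<lambda>x. grid_point (n + k) \<rho> (n + x)))"

text \<open>Budgets are coded by lists of numbers, with \<open>0\<close> for \<open>\<infinity>\<close>, also beyond the end of the list, and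
  \<open>Suc b\<close> for \<open>b\<close>.\<close>

definition budget_le :: "nat \<Rightarrow> bool \<Rightarrow> nat \<Rightarrow> bool" where
  "budget_le y c x \<longleftrightarrow> (0 < x \<longrightarrow> 0 < y \<and> y + of_bool c \<le> x)"

definition budget_family_code :: "nat \<Rightarrow> nat \<Rightarrow> nat \<Rightarrow> bool" where
  "budget_family_code n U W \<longleftrightarrow>
    (\<exists>\<beta>\<in>set (list_decode W). \<forall>p\<in>set (list_decode (nth_code n 3)). 0 < nth_code \<beta> (vertex p False 0)) \<and>
    (\<forall>\<beta>\<in>set (list_decode W). \<forall>s<num_vertices n U. \<forall>s'<num_vertices n U.
      silent_edge_code n s s' \<longrightarrow> budget_le (nth_code \<beta> s') False (nth_code \<beta> s)) \<and>
    (\<forall>\<beta>\<in>set (list_decode W). \<forall>a<nth_code n 0. \<forall>\<rho><U. \<exists>b<nth_code n 1. \<exists>Y<2 ^ k.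
      \<exists>\<beta>'\<in>set (list_decode W). \<forall>s<num_vertices n U. \<forall>s'<num_vertices n U.
        letter_edge_code n a \<rho> b Y s s' \<longrightarrow>
            budget_le (nth_code \<beta>' s') (vertex_flag s) (nth_code \<beta> s))"

lemma decidable_vertex_step_code [computable_intros]:
  assumes "computable n" "computable \<sigma>" "computable B" "computable j" "computable s" "computable s'"
  shows "decidable (\<lambda>e. vertex_step_code (n e) (\<sigma> e) (B e) (j e) (s e) (s' e))"
  unfolding vertex_step_code_def by (intro computable_intros assms[THEN computable_compose])

lemma decidable_budget_family_code [computable_intros]:
  assumes "computable n" "computable U" "computable W"
  shows "decidable (\<lambda>e. budget_family_code (n e) (U e) (W e))"
  unfolding budget_family_code_def silent_edge_code_def letter_edge_code_def budget_le_def
  by (intro computable_intros decidable_region_equiv_shifted_grid assms[THEN computable_compose])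

end

definition budget_value :: "nat \<Rightarrow> enat" where
  "budget_value x = (case x of 0 \<Rightarrow> \<infinity> | Suc b \<Rightarrow> enat b)"

definition budget_number :: "enat \<Rightarrow> nat" where
  "budget_number b = (case b of enat i \<Rightarrow> Suc i | \<infinity> \<Rightarrow> 0)"

lemma budget_value_number [simp]: "budget_value (budget_number b) = b"
  by (simp add: budget_value_def budget_number_def split: enat.split)

lemma budget_value_0 [simp]: "budget_value 0 = \<infinity>"
  by (simp add: budget_value_def)

lemma budget_value_finite_iff: "budget_value x \<noteq> \<infinity> \<longleftrightarrow> 0 < x"
  by (simp add: budget_value_def split: nat.split)

lemma budget_value_le_iff: "budget_value y + of_bool c \<le> budget_value x \<longleftrightarrow> budget_le y c x"
  by (cases c) (auto simp: budget_value_def budget_le_def one_enat_def split: nat.splits)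

context coded_instance_game
begin

lemma nth_code_n:
  "nth_code n 0 = na" "nth_code n 1 = nb" "nth_code n 2 = ta_clocks T"
  "nth_code n 3 = list_encode (ta_init T)"
  "nth_code n 4 = list_encode (ta_final T)" "nth_code n 5 = list_encode (map enc_rule (ta_rules T))"
  using n_eq unfolding enc_instance.simps list_encode_eq_iff by blast+

lemma nth_code_enc_rule:
  "nth_code (enc_rule (p, \<sigma>, \<phi>, Y, q)) 0 = p" "nth_code (enc_rule (p, \<sigma>, \<phi>, Y, q)) 1 = enc_letter \<sigma>"
  "nth_code (enc_rule (p, \<sigma>, \<phi>, Y, q)) 2 = enc_cc \<phi>"
  "nth_code (enc_rule (p, \<sigma>, \<phi>, Y, q)) 3 = list_encode Y"
  "nth_code (enc_rule (p, \<sigma>, \<phi>, Y, q)) 4 = q"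
  using enc_rule.simps[of p \<sigma> \<phi> Y q] unfolding list_encode_eq_iff by blast+

lemma vertex_step_code_iff:
  "vertex_step_code k m n (enc_letter \<sigma>) B j s s' \<longleftrightarrow> vertex_step \<sigma> (set_decode B) j s s'"
proof -
  have "(\<exists>r\<in>enc_rule ` R. P r) \<longleftrightarrow>
      (\<exists>p \<sigma> \<phi> Y q. (p, \<sigma>, \<phi>, Y, q) \<in> R \<and> P (enc_rule (p, \<sigma>, \<phi>, Y, q)))" for R P
    by (auto simp: Bex_def)
  then show ?thesis
    unfolding vertex_step_code_def vertex_step_def nth_code_n list_encode_inverse set_map
    by (simp only: nth_code_enc_rule enc_letter_inject sat_code_enc_cc list_encode_inverse
        subset_iff atLeastLessThan_iff Ball_def le0 simp_thms) blast
qed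

lemma silent_edge_code_iff:
  "(s, s') \<in> silent_edges \<longleftrightarrow>
      s < num_vertices n U \<and> s' < num_vertices n U \<and> silent_edge_code k m n s s'"
  unfolding silent_edges_def silent_edge_code_def
  using vertex_step_code_iff[of None 0] by (simp add: nth_code_n)

lemma letter_edge_code_iff:
  "(s, c, s') \<in> letter_edges (a, \<rho>) (b, Y) \<longleftrightarrow> s < num_vertices n U \<and> s' < num_vertices n U \<and>
    c = vertex_flag s \<and> letter_edge_code k m n a \<rho> b Y s s'"
  unfolding letter_edges_def letter_edge_code_def controller_region_def
  using vertex_step_code_iff[of "Some (a, b)" Y] by (simp add: nth_code_n region_of_eq_iff)

lemma budget_family_code_iff:
  "budget_family_code k m n U W \<longleftrightarrow>
      budget_family ((\<lambda>\<beta> s. budget_value (nth_code \<beta> s)) ` set (list_decode W))"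
proof -
  have silent: "(\<forall>(s, s')\<in>silent_edges. P s s') \<longleftrightarrow> (\<forall>s<num_vertices n U. \<forall>s'<num_vertices n U.
      silent_edge_code k m n s s' \<longrightarrow> P s s')" for P
    by (auto simp: silent_edge_code_iff)
  have letter: "(\<forall>(s, c, s')\<in>letter_edges (a, \<rho>) (b, Y). P s c s') \<longleftrightarrow>
      (\<forall>s<num_vertices n U. \<forall>s'<num_vertices n U.
      letter_edge_code k m n a \<rho> b Y s s' \<longrightarrow> P s (vertex_flag s) s')" for a \<rho> b Y P
    unfolding Ball_def split_paired_All prod.case letter_edge_code_iff by blast
  have ball_Xs: "(\<forall>x\<in>{..<na} \<times> {..<U}. P x) \<longleftrightarrow> (\<forall>a<na. \<forall>\<rho><U. P (a, \<rho>))" for P by auto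
  have bex_Ys: "(\<exists>y\<in>{..<nb} \<times> {..<2 ^ k}. P y) \<longleftrightarrow> (\<exists>b<nb. \<exists>Y<2 ^ k. P (b, Y))" for P by auto
  have budget_le: "budget_value y \<le> budget_value x \<longleftrightarrow> budget_le y False x" for x y
    using budget_value_le_iff[of y False x] by simp
  show ?thesis
    unfolding budget_family_code_def budget_family_def
    unfolding initial_vertices_def ball_simps bex_simps silent letter ball_Xs bex_Ys
      budget_le budget_value_le_iff budget_value_finite_iff nth_code_n list_encode_inverse ..
qed

end

text \<open>Codes a family of \<open>memory_bound N\<close> budgets, each with the largest value everywhere.\<close>

definition budget_family_bound :: "nat \<Rightarrow> nat" where
  "budget_family_bound N = list_encode (replicate (memory_bound N)
    (list_encode (replicate N (Suc (memory_bound N * N)))))"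

lemma computable_budget_family_bound [computable_intros]:
  "computable f \<Longrightarrow> computable (\<lambda>e. budget_family_bound (f e))"
  unfolding budget_family_bound_def memory_bound_def by (intro computable_intros)

lemma code_of_small_family:
  fixes F :: "(nat \<Rightarrow> enat) set"
  assumes small: "finite F" "card F \<le> memory_bound N"
    and values_le: "\<forall>\<beta>\<in>F. \<forall>s. \<beta> s \<le> enat (memory_bound N * N) \<or> \<beta> s = \<infinity>"
  obtains W where "W \<le> budget_family_bound N"
    "(\<lambda>\<beta> s. budget_value (nth_code \<beta> s)) ` set (list_decode W) =
      (\<lambda>\<beta> s. if s \<in> {..<N} then \<beta> s else \<infinity>) ` F"
proof -
  obtain bs where bs_eq: "set bs = F" "length bs = card F"
    using finite_distinct_list[OF small(1)] distinct_card by metis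
  define code where "code \<beta> = list_encode (map (\<lambda>s. budget_number (\<beta> s)) [0..<N])"
    for \<beta> :: "nat \<Rightarrow> enat"
  have "budget_value (nth_code (code \<beta>) s) = (if s \<in> {..<N} then \<beta> s else \<infinity>)" for \<beta> s
    by (simp add: code_def nth_default_def)
  then have image:
    "(\<lambda>\<beta> s. budget_value (nth_code \<beta> s)) ` set (list_decode (list_encode (map code bs))) =
      (\<lambda>\<beta> s. if s \<in> {..<N} then \<beta> s else \<infinity>) ` F"
    by (simp add: bs_eq(1) image_image)
  have "list_encode (map code bs) \<le> budget_family_bound N"
    unfolding budget_family_bound_def
  proof (rule list_encode_le_replicate)
    show "length (map code bs) \<le> memory_bound N" using bs_eq(2) small(2) by simp
    have "budget_number (\<beta> s) \<le> Suc (memory_bound N * N)" if "\<beta> \<in> F" for \<beta> s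
      using values_le[rule_format, OF that, of s]
      by (auto simp: budget_number_def split: enat.split)
    then have "code \<beta> \<le> list_encode (replicate N (Suc (memory_bound N * N)))" if "\<beta> \<in> F" for \<beta>
      unfolding code_def using that by (intro list_encode_le_replicate) auto
    then show "\<forall>x\<in>set (map code bs). x \<le> list_encode (replicate N (Suc (memory_bound N * N)))"
      by (auto simp: bs_eq(1)[symmetric])
  qed
  then show thesis using image by (rule that)
qed

lemma has_winning_controller_iff_code:
  assumes "n = enc_instance (na, nb, T)" and "grid_closed (n + k) (n + m) U"
  shows "has_winning_controller k m (na, nb, T) \<longleftrightarrow>
    (\<exists>W\<le>budget_family_bound (num_vertices n U). budget_family_code k m n U W)"
proof -
  interpret coded_instance_game k m na nb T n U using assms by (rule coded_instance_gameI)
  show ?thesis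
    unfolding has_winning_controller_iff_budget_family budget_family_code_iff
  proof
    assume "\<exists>F. budget_family F \<and> small_family F"
    then obtain F where family: "budget_family F" "small_family F" by blast
    obtain W where code: "W \<le> budget_family_bound (num_vertices n U)"
      "(\<lambda>\<beta> s. budget_value (nth_code \<beta> s)) ` set (list_decode W) =
        (\<lambda>\<beta> s. if s \<in> {..<num_vertices n U} then \<beta> s else \<infinity>) ` F"
      using family(2) code_of_small_family[of F "num_vertices n U"] by (auto simp: small_family_def)
    moreover have "budget_family ((\<lambda>\<beta> s. budget_value (nth_code \<beta> s)) ` set (list_decode W))"
      unfolding code(2) using family(1) by (rule budget_family_restrict)
    ultimately show "\<exists>W\<le>budget_family_bound (num_vertices n U).
        budget_family ((\<lambda>\<beta> s. budget_value (nth_code \<beta> s)) ` set (list_decode W))" by blast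
  next
    assume "\<exists>W\<le>budget_family_bound (num_vertices n U).
        budget_family ((\<lambda>\<beta> s. budget_value (nth_code \<beta> s)) ` set (list_decode W))"
    then obtain F where family: "budget_family F" "finite F" by blast
    then have "has_winning_controller k m (na, nb, T)"
      by (rule winning_if_budget_family) (rule has_winning_controller_if_winning)
    then show "\<exists>F. budget_family F \<and> small_family F"
      by (simp only: has_winning_controller_iff_budget_family)
  qed
qed

definition grid_size :: "nat \<Rightarrow> nat \<Rightarrow> nat" where
  "grid_size C M = (LEAST U. grid_closed C M U)"

lemma grid_closed_grid_size: "grid_closed C M (grid_size C M)"
  unfolding grid_size_def using grid_closed_exists by (rule LeastI_ex)

lemma computable_grid_size [computable_intros]:
  assumes "computable f" "computable g" shows "computable (\<lambda>e. grid_size (f e) (g e))"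
  unfolding grid_size_def
  by (intro computable_intros grid_closed_exists assms[THEN computable_compose])

theorem theorem2:
  fixes k m :: nat
  shows "decidable_set {enc_instance I | I. has_winning_controller k m I}"
proof -
  define U where "U n = grid_size (n + k) (n + m)" for n
  define decide where "decide n \<longleftrightarrow> instance_code n \<and>
    (\<exists>W\<le>budget_family_bound (num_vertices n (U n)). budget_family_code k m n (U n) W)" for n
  have "decide n \<longleftrightarrow> (\<exists>I. n = enc_instance I \<and> has_winning_controller k m I)" for n
    unfolding decide_def instance_code_iff split_paired_Ex
    using has_winning_controller_iff_code[OF _ grid_closed_grid_size]
    by (auto simp: U_def simp del: enc_instance.simps)
  then have "{enc_instance I | I. has_winning_controller k m I} = {n. decide n}" by auto
  moreover have "decidable decide"
    unfolding decide_def[abs_def] instance_code_def U_def by (intro computable_intros)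
  ultimately show ?thesis by (simp add: decidable_set_Collect)
qed

end
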